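(* The subspace lattice $\mathrm{Lat}\,\mathcal{A}_p$ is not synthetic relative to $M_{H^\infty(\mathbb{R})}$. Equivalently, there exists a weak$^*$-closed operator algebra $\mathcal{A}$ on $L^2(\mathbb{R})$ with $M_{H^\infty(\mathbb{R})}\subseteq\mathcal{A}$ and $\mathrm{Lat}\,\mathcal{A}=\mathrm{Lat}\,\mathcal{A}_p$ but $\mathcal{A}\neq\mathcal{A}_p$.
   Context: On $L^2(\mathbb{R})$ let $(M_\lambda f)(x)=e^{i\lambda x}f(x)$ and $(D_\mu f)(x)=f(x-\mu)$. The parabolic algebra $\mathcal{A}_p$ is the weak operator topology closed algebra generated by $\{M_\lambda:\lambda\geq0\}\cup\{D_\mu:\mu\geq0\}$; it is reflexive, i.e. $\mathcal{A}_p=\mathrm{Alg}\,\mathrm{Lat}\,\mathcal{A}_p$, where $\mathrm{Lat}$ denotes the lattice of closed invariant subspaces and $\mathrm{Alg}\,\mathcal{L}$ the algebra of operators leaving every subspace of $\mathcal{L}$ invariant. $H^\infty(\mathbb{R})$ is the algebra of boundary values of bounded analytic functions on the upper half-plane and $M_{H^\infty(\mathbb{R})}=\{M_h:h\in H^\infty(\mathbb{R})\}$ the corresponding multiplication operators, a maximal abelian subalgebra of $\mathcal{A}_p$. Definition: a reflexive subspace lattice $\mathcal{L}$ is synthetic relative to a maximal abelian subalgebra $\mathcal{B}$ of $\mathrm{Alg}\,\mathcal{L}$ if $\mathrm{Alg}\,\mathcal{L}$ is the unique weak$^*$-closed operator algebra $\mathcal{A}$ with $\mathrm{Lat}\,\mathcal{A}=\mathcal{L}$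 and $\mathcal{B}\subseteq\mathcal{A}$. *)

theory Defs
  imports "HOL-Analysis.Analysis" "HOL-Complex_Analysis.Complex_Analysis"
begin

text \<open>Concrete model of L2(R): complex functions on the reals, square integrable
  w.r.t. Lebesgue measure, identified up to almost-everywhere equality.
  Operators are maps on such functions that respect a.e. equality.\<close>

type_synonym fn = "real \<Rightarrow> complex"
type_synonym op = "fn \<Rightarrow> fn"

definition L2 :: "fn set" where
  "L2 = {f. f \<in> borel_measurable lborel \<and> integrable lborel (\<lambda>x. (cmod (f x))\<^sup>2)}"

definition aeq :: "fn \<Rightarrow> fn \<Rightarrow> bool" where
  "aeq f g \<longleftrightarrow> (AE x in lborel. f x = g x)"

definition inner2 :: "fn \<Rightarrow> fn \<Rightarrow> complex" where
  "inner2 f g = (LINT x|lborel. f x * cnj (g x))"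

definition norm2 :: "fn \<Rightarrow> real" where
  "norm2 f = sqrt (LINT x|lborel. (cmod (f x))\<^sup>2)"

definition bop :: "op \<Rightarrow> bool" where
  "bop T \<longleftrightarrow>
     (\<forall>f\<in>L2. T f \<in> L2) \<and>
     (\<forall>f\<in>L2. \<forall>g\<in>L2. aeq f g \<longrightarrow> aeq (T f) (T g)) \<and>
     (\<forall>f\<in>L2. \<forall>g\<in>L2. \<forall>a b. aeq (T (\<lambda>x. a * f x + b * g x)) (\<lambda>x. a * T f x + b * T g x)) \<and>
     (\<exists>C. \<forall>f\<in>L2. norm2 (T f) \<le> C * norm2 f)"

definition closed_subspace :: "fn set \<Rightarrow> bool" where
  "closed_subspace K \<longleftrightarrow>
     K \<subseteq> L2 \<and> (\<lambda>x. 0) \<in> K \<and>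
     (\<forall>f\<in>K. \<forall>g\<in>K. \<forall>a b. (\<lambda>x. a * f x + b * g x) \<in> K) \<and>
     (\<forall>f\<in>K. \<forall>g\<in>L2. aeq f g \<longrightarrow> g \<in> K) \<and>
     (\<forall>s f. (\<forall>n. s n \<in> K) \<longrightarrow> f \<in> L2 \<longrightarrow>
        ((\<lambda>n. norm2 (\<lambda>x. s n x - f x)) \<longlonglongrightarrow> 0) \<longrightarrow> f \<in> K)"

definition Lat :: "op set \<Rightarrow> fn set set" where
  "Lat A = {K. closed_subspace K \<and> (\<forall>T\<in>A. \<forall>f\<in>K. T f \<in> K)}"

definition op_algebra :: "op set \<Rightarrow> bool" where
  "op_algebra A \<longleftrightarrow> A \<noteq> {} \<and> (\<forall>T\<in>A. bop T) \<and>
     (\<forall>T\<in>A. \<forall>S\<in>A. (\<lambda>f x. T f x + S f x) \<in> A) \<and>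
     (\<forall>T\<in>A. \<forall>c. (\<lambda>f x. c * T f x) \<in> A) \<and>
     (\<forall>T\<in>A. \<forall>S\<in>A. T \<circ> S \<in> A)"

definition wot_closed :: "op set \<Rightarrow> bool" where
  "wot_closed A \<longleftrightarrow> A \<subseteq> Collect bop \<and>
     (\<forall>T. bop T \<longrightarrow>
        (\<forall>vs :: (fn \<times> fn) list. \<forall>e>0. set vs \<subseteq> L2 \<times> L2 \<longrightarrow>
           (\<exists>S\<in>A. \<forall>(f,g)\<in>set vs. cmod (inner2 (S f) g - inner2 (T f) g) < e))
        \<longrightarrow> T \<in> A)"

definition ultraweak_data :: "(nat \<Rightarrow> fn) \<Rightarrow> (nat \<Rightarrow> fn) \<Rightarrow> bool" where
  "ultraweak_data x y \<longleftrightarrow> (\<forall>n. x n \<in> L2 \<and> y n \<in> L2) \<and>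
     summable (\<lambda>n. (norm2 (x n))\<^sup>2) \<and> summable (\<lambda>n. (norm2 (y n))\<^sup>2)"

definition ultraweak_fun :: "(nat \<Rightarrow> fn) \<Rightarrow> (nat \<Rightarrow> fn) \<Rightarrow> op \<Rightarrow> complex" where
  "ultraweak_fun x y T = (\<Sum>n. inner2 (T (x n)) (y n))"

definition weak_star_closed :: "op set \<Rightarrow> bool" where
  "weak_star_closed A \<longleftrightarrow> A \<subseteq> Collect bop \<and>
     (\<forall>T. bop T \<longrightarrow>
        (\<forall>ps :: ((nat \<Rightarrow> fn) \<times> (nat \<Rightarrow> fn)) list. \<forall>e>0.
           (\<forall>(x,y)\<in>set ps. ultraweak_data x y) \<longrightarrow>
           (\<exists>S\<in>A. \<forall>(x,y)\<in>set ps. cmod (ultraweak_fun x y S - ultraweak_fun x y T) < e))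
        \<longrightarrow> T \<in> A)"

definition Mop :: "real \<Rightarrow> op" where
  "Mop l = (\<lambda>f x. exp (\<i> * complex_of_real (l * x)) * f x)"

definition Dop :: "real \<Rightarrow> op" where
  "Dop m = (\<lambda>f x. f (x - m))"

definition parabolic_algebra :: "op set" where
  "parabolic_algebra = \<Inter>{B. op_algebra B \<and> wot_closed B \<and>
      (\<forall>l\<ge>0. Mop l \<in> B) \<and> (\<forall>m\<ge>0. Dop m \<in> B)}"

definition Hinf :: "fn set" where
  "Hinf = {h. h \<in> borel_measurable lborel \<and>
     (\<exists>F. F holomorphic_on {z. 0 < Im z} \<and> bounded (F ` {z. 0 < Im z}) \<and>
        (AE x in lborel. ((\<lambda>y. F (Complex x y)) \<longlongrightarrow> h x) (at_right 0)))}"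

definition mult_op :: "fn \<Rightarrow> op" where
  "mult_op h = (\<lambda>f x. h x * f x)"

end

theory Submission
  imports Defs "HOL-Probability.Sinc_Integral" "HOL-Real_Asymp.Real_Asymp"
begin

text \<open>
  For \<open>c > 0\<close> the operators \<open>M\<^sub>l D\<^sub>m\<close> with \<open>l, m \<ge> 0\<close> and (\<open>m = 0\<close> or \<open>l \<ge> c\<close>) form a
  semigroup up to scalars. The closure of its span is an algebra containing all \<open>M\<^sub>h\<close> with \<open>h\<close> in
  \<open>H\<^sup>\<infinity>\<close>, and a functional of rank two separates it from \<open>D\<^sub>1\<close>.

  It has the same invariant subspaces as the parabolic algebra. Let \<open>K\<close> be invariant, \<open>f \<in> K\<close>,
  \<open>\<psi>\<close> orthogonal to \<open>K\<close>, and \<open>\<phi>\<^sub>m(x) = f(x - m) \<psi>(x)\<^sup>*\<close>. Then \<open>\<phi>\<^sub>0\<close> and all \<open>exp (\<i> c x) \<phi>\<^sub>m\<close> belong to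
  the Hardy space \<open>H\<^sup>1\<close> of the upper half-plane, and the identity
  \<open>\<phi>\<^sub>m(x) \<phi>\<^sub>m(x - m) = \<phi>\<^bsub>2m\<^esub>(x) \<phi>\<^sub>0(x - m)\<close> persists for the analytic extensions by an argument of
  Beurling. Comparing exponential types as in Titchmarsh's convolution theorem gives
  \<open>exp (\<i> c x / 2) \<phi>\<^sub>m \<in> H\<^sup>1\<close>. So \<open>c\<close> may be replaced by \<open>c / 2\<close>, and in the limit \<open>K\<close> is
  invariant under \<open>D\<^sub>m\<close>.
\<close>

section \<open>Square integrable functions\<close>

lemma integrable_mult_of_square_integrable:
  fixes f g :: "'a \<Rightarrow> 'b :: {banach, second_countable_topology, real_normed_div_algebra}"
  assumes [measurable]: "f \<in> borel_measurable M" "g \<in> borel_measurable M"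
    and "integrable M (\<lambda>x. (norm (f x))\<^sup>2)" "integrable M (\<lambda>x. (norm (g x))\<^sup>2)"
  shows "integrable M (\<lambda>x. f x * g x)"
proof (rule Bochner_Integration.integrable_bound)
  show "integrable M (\<lambda>x. (norm (f x))\<^sup>2 + (norm (g x))\<^sup>2)"
    using assms by simp
  have "norm (f x) * norm (g x) \<le> (norm (f x))\<^sup>2 + (norm (g x))\<^sup>2" for x
    using sum_squares_bound[of "norm (f x)" "norm (g x)"]
      mult_nonneg_nonneg[of "norm (f x)" "norm (g x)"]
    by (simp del: mult_nonneg_nonneg)
  then show "AE x in M. norm (f x * g x) \<le> norm ((norm (f x))\<^sup>2 + (norm (g x))\<^sup>2)"
    by (simp add: norm_mult)
qed simp

lemma square_integrable_add:
  fixes f g :: "'a \<Rightarrow> 'b :: {banach, second_countable_topology}"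
  assumes [measurable]: "f \<in> borel_measurable M" "g \<in> borel_measurable M"
    and "integrable M (\<lambda>x. (norm (f x))\<^sup>2)" "integrable M (\<lambda>x. (norm (g x))\<^sup>2)"
  shows "integrable M (\<lambda>x. (norm (f x + g x))\<^sup>2)"
proof (rule Bochner_Integration.integrable_bound)
  show "integrable M (\<lambda>x. 2 * (norm (f x))\<^sup>2 + 2 * (norm (g x))\<^sup>2)"
    using assms by simp
  have "(norm (f x + g x))\<^sup>2 \<le> 2 * (norm (f x))\<^sup>2 + 2 * (norm (g x))\<^sup>2" for x
  proof -
    have "(norm (f x + g x))\<^sup>2 \<le> (norm (f x) + norm (g x))\<^sup>2"
      by (intro power_mono norm_triangle_ineq) auto
    also have "\<dots> \<le> 2 * (norm (f x))\<^sup>2 + 2 * (norm (g x))\<^sup>2"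
      using sum_squares_bound[of "norm (f x)" "norm (g x)"] by (simp add: power2_sum)
    finally show ?thesis .
  qed
  then show "AE x in M. norm ((norm (f x + g x))\<^sup>2)
    \<le> norm (2 * (norm (f x))\<^sup>2 + 2 * (norm (g x))\<^sup>2)"
    by simp
qed simp

lemma borel_measurable_cnj [measurable]:
  "f \<in> borel_measurable M \<Longrightarrow> (\<lambda>x. cnj (f x)) \<in> borel_measurable M"
  by (rule borel_measurable_continuous_on) (auto intro: continuous_intros)

lemma L2_measurable [measurable_dest]: "f \<in> L2 \<Longrightarrow> f \<in> borel_measurable borel"
  by (simp add: L2_def)

lemma L2_square_integrable: "f \<in> L2 \<Longrightarrow> integrable lborel (\<lambda>x. (cmod (f x))\<^sup>2)"
  by (simp add: L2_def)

lemma L2_integrable_mult: "f \<in> L2 \<Longrightarrow> g \<in> L2 \<Longrightarrow> integrable lborel (\<lambda>x. f x * g x)"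
  by (auto simp: L2_def intro: integrable_mult_of_square_integrable)

lemma L2_cnj: "f \<in> L2 \<Longrightarrow> (\<lambda>x. cnj (f x)) \<in> L2"
  by (auto simp: L2_def)

lemma L2_integrable_inner:
  "f \<in> L2 \<Longrightarrow> g \<in> L2 \<Longrightarrow> integrable lborel (\<lambda>x. f x * cnj (g x))"
  using L2_integrable_mult[OF _ L2_cnj] .

lemma L2_bounded_mult:
  assumes f: "f \<in> L2" and [measurable]: "u \<in> borel_measurable lborel"
    and bound: "AE x in lborel. cmod (u x) \<le> C"
  shows "(\<lambda>x. u x * f x) \<in> L2"
proof -
  have [measurable]: "f \<in> borel_measurable lborel"
    using f by (simp add: L2_def)
  have "integrable lborel (\<lambda>x. (cmod (u x * f x))\<^sup>2)"
  proof (rule Bochner_Integration.integrable_bound)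
    show "integrable lborel (\<lambda>x. C\<^sup>2 * (cmod (f x))\<^sup>2)"
      using L2_square_integrable[OF f] by simp
    show "AE x in lborel. norm ((cmod (u x * f x))\<^sup>2) \<le> norm (C\<^sup>2 * (cmod (f x))\<^sup>2)"
      using bound by eventually_elim
        (auto simp: norm_mult power_mult_distrib intro!: mult_right_mono power_mono)
  qed simp
  then show ?thesis by (simp add: L2_def)
qed

lemma L2_zero [simp]: "(\<lambda>x. 0) \<in> L2"
  by (simp add: L2_def)

lemma L2_scale: "f \<in> L2 \<Longrightarrow> (\<lambda>x. a * f x) \<in> L2"
  by (rule L2_bounded_mult[where C = "cmod a"]) auto

lemma L2_add: "f \<in> L2 \<Longrightarrow> g \<in> L2 \<Longrightarrow> (\<lambda>x. f x + g x) \<in> L2"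
  by (auto simp: L2_def intro: square_integrable_add)

lemma L2_lincomb: "f \<in> L2 \<Longrightarrow> g \<in> L2 \<Longrightarrow> (\<lambda>x. a * f x + b * g x) \<in> L2"
  by (intro L2_add L2_scale)

lemma L2_minus: "f \<in> L2 \<Longrightarrow> (\<lambda>x. - f x) \<in> L2"
  by (simp add: L2_def)

lemma L2_diff: "f \<in> L2 \<Longrightarrow> g \<in> L2 \<Longrightarrow> (\<lambda>x. f x - g x) \<in> L2"
  using L2_add[OF _ L2_minus] by simp

lemma integrable_lborel_translate:
  fixes f :: "real \<Rightarrow> 'a :: {banach, second_countable_topology}"
  shows "integrable lborel f \<Longrightarrow> integrable lborel (\<lambda>x. f (x - m))"
  using lborel_integrable_real_affine[of f 1 "- m"] by simp

lemma integral_lborel_translate: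
  fixes f :: "real \<Rightarrow> 'a :: {banach, second_countable_topology}"
  shows "(LINT x|lborel. f (x - m)) = (LINT x|lborel. f x)"
  using lborel_integral_real_affine[of 1 f "- m"] by simp

lemma AE_lborel_translate:
  assumes "AE x in lborel. P (x :: real)"
  shows "AE x in lborel. P (x - m)"
proof -
  have "AE x in distr lborel borel ((+) (- m)). P x"
    by (subst lborel_distr_plus) (rule assms)
  then have "AE x in lborel. P (- m + x)"
    by (rule AE_distrD[rotated]) simp
  then show ?thesis by simp
qed

lemma L2_translate: "f \<in> L2 \<Longrightarrow> (\<lambda>x. f (x - m)) \<in> L2"
  using integrable_lborel_translate[of "\<lambda>x. (cmod (f x))\<^sup>2" m] by (auto simp: L2_def)


section \<open>The inner product and the norm\<close>

abbreviation dist2 :: "fn \<Rightarrow> fn \<Rightarrow> real" where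
  "dist2 f g \<equiv> norm2 (\<lambda>x. f x - g x)"

lemma inner2_lincomb_left:
  assumes "f \<in> L2" "g \<in> L2" "h \<in> L2"
  shows "inner2 (\<lambda>x. a * f x + b * g x) h = a * inner2 f h + b * inner2 g h"
  using L2_integrable_inner[of f h] L2_integrable_inner[of g h] assms
  by (simp add: inner2_def algebra_simps)

lemma inner2_diff_left:
  assumes "f \<in> L2" "g \<in> L2" "h \<in> L2"
  shows "inner2 (\<lambda>x. f x - g x) h = inner2 f h - inner2 g h"
  using inner2_lincomb_left[OF assms, of 1 "-1"] by simp

lemma inner2_add_left:
  assumes "f \<in> L2" "g \<in> L2" "h \<in> L2"
  shows "inner2 (\<lambda>x. f x + g x) h = inner2 f h + inner2 g h"
  using inner2_lincomb_left[OF assms, of 1 1] by simp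

lemma inner2_scale_left: "inner2 (\<lambda>x. a * f x) h = a * inner2 f h"
  by (simp add: inner2_def mult.assoc)

lemma inner2_commute: "inner2 g f = cnj (inner2 f g)"
proof -
  have "inner2 g f = (LINT x|lborel. cnj (f x * cnj (g x)))"
    by (simp add: inner2_def mult.commute)
  also have "\<dots> = cnj (inner2 f g)"
    unfolding inner2_def by (rule Bochner_Integration.integral_cnj)
  finally show ?thesis .
qed

lemma inner2_minus_right: "inner2 f (\<lambda>x. - g x) = - inner2 f g"
  by (simp add: inner2_def)

lemma inner2_self: "inner2 f f = of_real ((norm2 f)\<^sup>2)"
proof -
  have "inner2 f f = (LINT x|lborel. complex_of_real ((cmod (f x))\<^sup>2))"
    by (simp only: inner2_def complex_norm_square)
  also have "\<dots> = of_real (LINT x|lborel. (cmod (f x))\<^sup>2)"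
    by (rule integral_complex_of_real)
  finally show ?thesis by (simp add: norm2_def)
qed

lemma inner2_zero_right [simp]: "inner2 f (\<lambda>x. 0) = 0"
  by (simp add: inner2_def)

lemma norm2_zero [simp]: "norm2 (\<lambda>x. 0) = 0"
  by (simp add: norm2_def)

lemma norm2_nonneg [simp]: "0 \<le> norm2 f"
  by (simp add: norm2_def)

lemma norm2_power2: "(norm2 f)\<^sup>2 = (LINT x|lborel. (cmod (f x))\<^sup>2)"
  by (simp add: norm2_def)

lemma norm2_scale: "norm2 (\<lambda>x. a * f x) = cmod a * norm2 f"
  by (simp add: norm2_def norm_mult power_mult_distrib real_sqrt_mult)

lemma norm2_minus_commute: "dist2 f g = dist2 g f"
  by (simp add: norm2_def norm_minus_commute)

lemma norm2_unimodular_mult: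
  assumes "\<And>x. cmod (u x) = 1"
  shows "norm2 (\<lambda>x. u x * f x) = norm2 f"
  using assms by (simp add: norm2_def norm_mult)

lemma norm2_mono_AE:
  assumes "f \<in> L2" "g \<in> L2" "AE x in lborel. cmod (f x) \<le> B * cmod (g x)" "0 \<le> B"
  shows "norm2 f \<le> B * norm2 g"
proof -
  have "(norm2 f)\<^sup>2 \<le> (LINT x|lborel. B\<^sup>2 * (cmod (g x))\<^sup>2)"
    unfolding norm2_power2
  proof (rule integral_mono_AE)
    show "AE x in lborel. (cmod (f x))\<^sup>2 \<le> B\<^sup>2 * (cmod (g x))\<^sup>2"
      using assms(3) by eventually_elim
        (auto simp: power_mult_distrib[symmetric] intro!: power_mono)
  qed (use assms L2_square_integrable in auto)
  also have "\<dots> = (B * norm2 g)\<^sup>2"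
    by (simp add: norm2_power2 power_mult_distrib)
  finally show ?thesis
    by (rule power2_le_imp_le) (use assms(4) in simp)
qed

lemma norm2_eq_0_iff:
  assumes "f \<in> L2"
  shows "norm2 f = 0 \<longleftrightarrow> (AE x in lborel. f x = 0)"
  unfolding norm2_def using integral_nonneg_eq_0_iff_AE[OF L2_square_integrable[OF assms]] by simp

lemma norm2_add_scale_power2:
  assumes "f \<in> L2" "g \<in> L2"
  shows "(norm2 (\<lambda>x. f x + t * g x))\<^sup>2
    = (norm2 f)\<^sup>2 + 2 * Re (cnj t * inner2 f g) + (cmod t)\<^sup>2 * (norm2 g)\<^sup>2"
proof -
  have "(cmod (f x + t * g x))\<^sup>2
      = (cmod (f x))\<^sup>2 + 2 * Re (cnj t * (f x * cnj (g x))) + (cmod t)\<^sup>2 * (cmod (g x))\<^sup>2" for x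
    unfolding cmod_power2 by (simp add: power2_eq_square algebra_simps)
  then have "(norm2 (\<lambda>x. f x + t * g x))\<^sup>2 = (LINT x|lborel.
      (cmod (f x))\<^sup>2 + 2 * Re (cnj t * (f x * cnj (g x))) + (cmod t)\<^sup>2 * (cmod (g x))\<^sup>2)"
    by (simp add: norm2_power2)
  also have "\<dots> = (norm2 f)\<^sup>2 + 2 * (LINT x|lborel. Re (cnj t * (f x * cnj (g x))))
      + (cmod t)\<^sup>2 * (norm2 g)\<^sup>2"
    using assms[THEN L2_square_integrable] L2_integrable_inner[OF assms]
    by (simp add: norm2_power2 del: times_complex.sel)
  also have "(LINT x|lborel. Re (cnj t * (f x * cnj (g x)))) = Re (cnj t * inner2 f g)"
    using L2_integrable_inner[OF assms] by (simp add: inner2_def del: times_complex.sel)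
  finally show ?thesis .
qed

lemma norm2_parallelogram:
  assumes "f \<in> L2" "g \<in> L2"
  shows "(norm2 (\<lambda>x. f x - g x))\<^sup>2 + (norm2 (\<lambda>x. f x + g x))\<^sup>2 = 2 * (norm2 f)\<^sup>2 + 2 * (norm2 g)\<^sup>2"
  using norm2_add_scale_power2[OF assms, of 1] norm2_add_scale_power2[OF assms, of "-1"] by simp

lemma Cauchy_Schwarz_integral:
  fixes f g :: "'a \<Rightarrow> real"
  assumes [measurable]: "f \<in> borel_measurable M" "g \<in> borel_measurable M"
    and f: "integrable M (\<lambda>x. (f x)\<^sup>2)" and g: "integrable M (\<lambda>x. (g x)\<^sup>2)"
  shows "(LINT x|M. \<bar>f x * g x\<bar>)\<^sup>2 \<le> (LINT x|M. (f x)\<^sup>2) * (LINT x|M. (g x)\<^sup>2)"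
proof -
  have fg: "integrable M (\<lambda>x. \<bar>f x\<bar> * \<bar>g x\<bar>)"
    using f g by (intro integrable_mult_of_square_integrable) auto
  have "(\<integral>\<^sup>+x. ennreal \<bar>f x\<bar> * ennreal \<bar>g x\<bar> \<partial>M)\<^sup>2
      \<le> (\<integral>\<^sup>+x. (ennreal \<bar>f x\<bar>)\<^sup>2 \<partial>M) * (\<integral>\<^sup>+x. (ennreal \<bar>g x\<bar>)\<^sup>2 \<partial>M)"
    by (intro Cauchy_Schwarz_nn_integral) auto
  also have "(\<integral>\<^sup>+x. ennreal \<bar>f x\<bar> * ennreal \<bar>g x\<bar> \<partial>M) = ennreal (LINT x|M. \<bar>f x * g x\<bar>)"
    using fg by (simp add: nn_integral_eq_integral abs_mult flip: ennreal_mult)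
  also have "(\<integral>\<^sup>+x. (ennreal \<bar>f x\<bar>)\<^sup>2 \<partial>M) = ennreal (LINT x|M. (f x)\<^sup>2)"
    using f by (simp add: nn_integral_eq_integral ennreal_power)
  also have "(\<integral>\<^sup>+x. (ennreal \<bar>g x\<bar>)\<^sup>2 \<partial>M) = ennreal (LINT x|M. (g x)\<^sup>2)"
    using g by (simp add: nn_integral_eq_integral ennreal_power)
  finally show ?thesis
    by (simp add: ennreal_power flip: ennreal_mult)
qed

lemma Cauchy_Schwarz_L2:
  assumes "f \<in> L2" "g \<in> L2"
  shows "cmod (inner2 f g) \<le> norm2 f * norm2 g"
proof -
  have "cmod (inner2 f g) \<le> (LINT x|lborel. \<bar>cmod (f x) * cmod (g x)\<bar>)"
    unfolding inner2_def by (rule order_trans[OF integral_norm_bound]) (simp add: norm_mult)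
  then have "(cmod (inner2 f g))\<^sup>2 \<le> (LINT x|lborel. \<bar>cmod (f x) * cmod (g x)\<bar>)\<^sup>2"
    by (intro power_mono) auto
  also have "\<dots> \<le> (norm2 f * norm2 g)\<^sup>2"
    using assms Cauchy_Schwarz_integral[of "\<lambda>x. cmod (f x)" lborel "\<lambda>x. cmod (g x)"]
    by (auto simp: L2_def norm2_power2 power_mult_distrib)
  finally show ?thesis
    by (rule power2_le_imp_le) simp
qed

lemma norm2_triangle:
  assumes "f \<in> L2" "g \<in> L2"
  shows "norm2 (\<lambda>x. f x + g x) \<le> norm2 f + norm2 g"
proof -
  have "(norm2 (\<lambda>x. f x + g x))\<^sup>2 = (norm2 f)\<^sup>2 + 2 * Re (inner2 f g) + (norm2 g)\<^sup>2"
    using norm2_add_scale_power2[OF assms, of 1] by simp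
  also have "\<dots> \<le> (norm2 f)\<^sup>2 + 2 * (norm2 f * norm2 g) + (norm2 g)\<^sup>2"
    using Cauchy_Schwarz_L2[OF assms] complex_Re_le_cmod[of "inner2 f g"] by simp
  also have "\<dots> = (norm2 f + norm2 g)\<^sup>2"
    by (simp add: power2_sum)
  finally show ?thesis
    by (rule power2_le_imp_le) simp
qed

lemma dist2_triangle:
  assumes "f \<in> L2" "g \<in> L2" "h \<in> L2"
  shows "dist2 f h \<le> dist2 f g + dist2 g h"
  using norm2_triangle[OF L2_diff[OF assms(1,2)] L2_diff[OF assms(2,3)]] by simp

lemma inner2_cong_AE:
  assumes [measurable]: "f \<in> L2" "g \<in> L2" "h \<in> L2" and "aeq f g"
  shows "inner2 f h = inner2 g h"
  unfolding inner2_def using assms(4)[unfolded aeq_def] by (intro integral_cong_AE) auto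

lemma inner2_tendsto:
  assumes s: "\<And>n. s n \<in> L2" and f: "f \<in> L2" and g: "g \<in> L2" and lim: "(\<lambda>n. dist2 (s n) f) \<longlonglongrightarrow> 0"
  shows "(\<lambda>n. inner2 (s n) g) \<longlonglongrightarrow> inner2 f g"
proof (rule LIM_zero_cancel, rule Lim_null_comparison)
  show "\<forall>\<^sub>F n in sequentially. cmod (inner2 (s n) g - inner2 f g) \<le> dist2 (s n) f * norm2 g"
    using Cauchy_Schwarz_L2[OF L2_diff[OF s f] g]
    by (intro always_eventually) (simp add: inner2_diff_left s f g)
  show "(\<lambda>n. dist2 (s n) f * norm2 g) \<longlonglongrightarrow> 0"
    using tendsto_mult_right[OF lim, of "norm2 g"] by simp
qed


section \<open>Completeness and orthogonal projections\<close>

lemma AE_summable_of_summable_integrals: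
  fixes D :: "nat \<Rightarrow> 'a \<Rightarrow> real"
  assumes int: "\<And>n. integrable M (D n)" and nonneg: "\<And>n x. 0 \<le> D n x"
    and sum: "summable (\<lambda>n. LINT x|M. D n x)"
  shows "AE x in M. summable (\<lambda>n. D n x)"
proof -
  have [measurable]: "D n \<in> borel_measurable M" for n
    using int by (rule borel_measurable_integrable)
  have "(\<integral>\<^sup>+ x. (\<Sum>n. ennreal (D n x)) \<partial>M) = (\<Sum>n. \<integral>\<^sup>+ x. ennreal (D n x) \<partial>M)"
    by (intro nn_integral_suminf) simp
  also have "\<dots> = (\<Sum>n. ennreal (LINT x|M. D n x))"
    using int nonneg by (simp add: nn_integral_eq_integral)
  also have "\<dots> = ennreal (\<Sum>n. LINT x|M. D n x)"
    using nonneg by (intro suminf_ennreal_eq summable_sums[OF sum]) simp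
  finally have "(\<integral>\<^sup>+ x. (\<Sum>n. ennreal (D n x)) \<partial>M) \<noteq> \<infinity>"
    by simp
  then have "AE x in M. (\<Sum>n. ennreal (D n x)) \<noteq> \<infinity>"
    by (intro nn_integral_PInf_AE) auto
  then show ?thesis
    by eventually_elim (use nonneg in \<open>auto intro: summable_suminf_not_top\<close>)
qed

lemma convergent_of_summable_weighted_increments:
  fixes X :: "nat \<Rightarrow> 'a :: banach"
  assumes "summable (\<lambda>n. 2 ^ n * (norm (X (Suc n) - X n))\<^sup>2)"
  shows "convergent X"
proof -
  have "norm d \<le> 2 ^ n * (norm d)\<^sup>2 + (1/2) ^ n" for n and d :: 'a
  proof -
    have "0 \<le> (2 ^ n * norm d - 1)\<^sup>2 / 2 ^ n"
      by simp
    also have "\<dots> = 2 ^ n * (norm d)\<^sup>2 + (1/2) ^ n - 2 * norm d"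
      by (simp add: power2_diff power_one_over field_simps power2_eq_square)
    finally show ?thesis
      using norm_ge_zero[of d] by linarith
  qed
  moreover have "summable (\<lambda>n. 2 ^ n * (norm (X (Suc n) - X n))\<^sup>2 + (1/2) ^ n)"
    using assms by (intro summable_add summable_geometric) auto
  ultimately have "summable (\<lambda>n. X (Suc n) - X n)"
    by (rule summable_comparison_test'[where N = 0, rotated])
  then have "(\<lambda>n. X n - X 0) \<longlonglongrightarrow> (\<Sum>n. X (Suc n) - X n)"
    using summable_LIMSEQ sum_lessThan_telescope[of X] by force
  from tendsto_add[OF this tendsto_const[of "X 0"]] show ?thesis
    by (auto simp: convergent_def)
qed

lemma L2_fast_Cauchy_AE_limit:
  assumes s: "\<And>n. s n \<in> L2" and fast: "\<And>n. dist2 (s (Suc n)) (s n) \<le> (1/2) ^ n"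
  obtains f where "f \<in> borel_measurable borel" "AE x in lborel. (\<lambda>n. s n x) \<longlonglongrightarrow> f x"
proof -
  have [measurable]: "s n \<in> borel_measurable borel" for n
    using s L2_measurable by blast
  have "summable (\<lambda>n. LINT x|lborel. 2 ^ n * (cmod (s (Suc n) x - s n x))\<^sup>2)"
  proof (rule summable_comparison_test'[OF summable_geometric[of "1/2 :: real"]])
    fix n
    have "(dist2 (s (Suc n)) (s n))\<^sup>2 \<le> ((1/2) ^ n)\<^sup>2"
      using fast by (intro power_mono) auto
    then have "2 ^ n * (dist2 (s (Suc n)) (s n))\<^sup>2 \<le> (1/2) ^ n"
      by (simp add: power_one_over power2_eq_square field_simps)
    then show "norm (LINT x|lborel. 2 ^ n * (cmod (s (Suc n) x - s n x))\<^sup>2) \<le> (1/2) ^ n"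
      by (simp add: norm2_power2)
  qed simp
  then have "AE x in lborel. summable (\<lambda>n. 2 ^ n * (cmod (s (Suc n) x - s n x))\<^sup>2)"
    using L2_square_integrable[OF L2_diff[OF s s]] by (intro AE_summable_of_summable_integrals) auto
  then have conv: "AE x in lborel. convergent (\<lambda>n. s n x)"
    by eventually_elim (rule convergent_of_summable_weighted_increments)
  show ?thesis
  proof (rule that)
    show "(\<lambda>x. lim (\<lambda>n. s n x)) \<in> borel_measurable borel"
      by measurable
    show "AE x in lborel. (\<lambda>n. s n x) \<longlonglongrightarrow> lim (\<lambda>n. s n x)"
      using conv by eventually_elim (simp add: convergent_LIMSEQ_iff)
  qed
qed

lemma L2_Fatou:
  assumes g: "\<And>k. g k \<in> L2" and bound: "\<forall>\<^sub>F k in sequentially. norm2 (g k) \<le> B" and B: "0 \<le> B"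
    and [measurable]: "f \<in> borel_measurable borel" and lim: "AE x in lborel. (\<lambda>k. g k x) \<longlonglongrightarrow> f x"
  shows "f \<in> L2" "norm2 f \<le> B"
proof -
  have [measurable]: "g k \<in> borel_measurable borel" for k
    using g L2_measurable by blast
  have "AE x in lborel. ennreal ((cmod (f x))\<^sup>2) = liminf (\<lambda>k. ennreal ((cmod (g k x))\<^sup>2))"
    using lim
  proof eventually_elim
    case (elim x)
    then have "(\<lambda>k. ennreal ((cmod (g k x))\<^sup>2)) \<longlonglongrightarrow> ennreal ((cmod (f x))\<^sup>2)"
      by (intro tendsto_intros)
    then show ?case
      by (rule lim_imp_Liminf[OF sequentially_bot, symmetric])
  qed
  then have "(\<integral>\<^sup>+ x. ennreal ((cmod (f x))\<^sup>2) \<partial>lborel)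
      = (\<integral>\<^sup>+ x. liminf (\<lambda>k. ennreal ((cmod (g k x))\<^sup>2)) \<partial>lborel)"
    by (rule nn_integral_cong_AE)
  also have "\<dots> \<le> liminf (\<lambda>k. \<integral>\<^sup>+ x. ennreal ((cmod (g k x))\<^sup>2) \<partial>lborel)"
    by (intro nn_integral_liminf) measurable
  also have "\<dots> = liminf (\<lambda>k. ennreal ((norm2 (g k))\<^sup>2))"
    using L2_square_integrable[OF g] by (simp add: nn_integral_eq_integral norm2_power2)
  also have "\<dots> \<le> liminf (\<lambda>k. ennreal (B\<^sup>2))"
    using bound by (intro Liminf_mono) (auto elim!: eventually_mono intro!: ennreal_leI power_mono)
  finally have nn_bound: "(\<integral>\<^sup>+ x. ennreal ((cmod (f x))\<^sup>2) \<partial>lborel) \<le> ennreal (B\<^sup>2)"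
    by (simp add: Liminf_const)
  then have int: "integrable lborel (\<lambda>x. (cmod (f x))\<^sup>2)"
    by (intro integrableI_bounded) (auto simp: le_less_trans)
  then show "f \<in> L2"
    by (simp add: L2_def)
  have "(norm2 f)\<^sup>2 \<le> B\<^sup>2"
    using nn_bound int by (simp add: norm2_power2 nn_integral_eq_integral)
  then show "norm2 f \<le> B"
    using B by (rule power2_le_imp_le)
qed

lemma L2_fast_Cauchy_converges:
  assumes s: "\<And>n. s n \<in> L2" and fast: "\<And>k l. k \<le> l \<Longrightarrow> dist2 (s l) (s k) \<le> (1/2) ^ k"
  obtains f where "f \<in> L2" "\<And>k. dist2 (s k) f \<le> (1/2) ^ k"
proof -
  have "dist2 (s (Suc n)) (s n) \<le> (1/2) ^ n" for n
    using fast by simp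
  then obtain f where f [measurable]: "f \<in> borel_measurable borel"
      and lim: "AE x in lborel. (\<lambda>n. s n x) \<longlonglongrightarrow> f x"
    using L2_fast_Cauchy_AE_limit[of s, OF s] by blast
  have close: "(\<lambda>x. s k x - f x) \<in> L2 \<and> dist2 (s k) f \<le> (1/2) ^ k" for k
  proof -
    have [measurable]: "s k \<in> borel_measurable borel"
      using s L2_measurable by blast
    have bound: "\<forall>\<^sub>F l in sequentially. dist2 (s k) (s l) \<le> (1/2) ^ k"
      using eventually_ge_at_top[of k]
      by eventually_elim (simp add: fast norm2_minus_commute[of "s k" "s _"])
    have "AE x in lborel. (\<lambda>l. s k x - s l x) \<longlonglongrightarrow> s k x - f x"
      using lim by eventually_elim (intro tendsto_intros)
    note Fatou = L2_Fatou[OF L2_diff[OF s s] bound _ _ this]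
    show ?thesis
      by (intro conjI Fatou) auto
  qed
  moreover have "f \<in> L2"
    using L2_diff[OF s[of 0] conjunct1[OF close[of 0]]] by simp
  ultimately show thesis
    using that by blast
qed

theorem L2_complete:
  assumes s: "\<And>n. s n \<in> L2"
    and Cauchy: "\<And>e. 0 < e \<Longrightarrow> \<exists>N. \<forall>m\<ge>N. \<forall>n\<ge>N. dist2 (s m) (s n) < e"
  obtains f where "f \<in> L2" "(\<lambda>n. dist2 (s n) f) \<longlonglongrightarrow> 0"
proof -
  have "\<forall>k. \<exists>N. \<forall>m\<ge>N. \<forall>n\<ge>N. dist2 (s m) (s n) < (1/2) ^ k"
    using Cauchy by simp
  then obtain N where N: "\<And>k m n. N k \<le> m \<Longrightarrow> N k \<le> n \<Longrightarrow> dist2 (s m) (s n) < (1/2) ^ k"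
    by metis
  define r where "r k = sum N {..k}" for k
  have N_le_r: "N k \<le> r l" if "k \<le> l" for k l
    unfolding r_def using that by (intro member_le_sum) auto
  obtain f where f: "f \<in> L2" "\<And>k. dist2 (s (r k)) f \<le> (1/2) ^ k"
    using L2_fast_Cauchy_converges[of "\<lambda>k. s (r k)", OF s] N N_le_r less_imp_le order_refl by metis
  have "\<exists>M. \<forall>n\<ge>M. dist2 (s n) f < e" if "0 < e" for e :: real
  proof -
    obtain k where k: "(1/2) ^ k < e / 2"
      using real_arch_pow_inv[OF half_gt_zero[OF \<open>0 < e\<close>], of "1/2"] by auto
    have "dist2 (s n) f < e" if "N k \<le> n" for n
      using dist2_triangle[OF s[of n] s[of "r k"] f(1)] N[OF that N_le_r[of k k]] f(2)[of k] k
      by simp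
    then show ?thesis by blast
  qed
  then have "(\<lambda>n. dist2 (s n) f) \<longlonglongrightarrow> 0"
    by (simp add: LIMSEQ_iff)
  with f(1) show thesis
    by (rule that)
qed

lemma closed_subspaceD:
  assumes "closed_subspace K"
  shows "\<And>f. f \<in> K \<Longrightarrow> f \<in> L2" "(\<lambda>x. 0) \<in> K"
    "\<And>f g a b. f \<in> K \<Longrightarrow> g \<in> K \<Longrightarrow> (\<lambda>x. a * f x + b * g x) \<in> K"
    "\<And>f g. f \<in> K \<Longrightarrow> g \<in> L2 \<Longrightarrow> aeq f g \<Longrightarrow> g \<in> K"
    "\<And>s f. (\<And>n. s n \<in> K) \<Longrightarrow> f \<in> L2 \<Longrightarrow> (\<lambda>n. dist2 (s n) f) \<longlonglongrightarrow> 0 \<Longrightarrow> f \<in> K"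
  using assms unfolding closed_subspace_def by blast+

definition orthogonal_complement :: "fn set \<Rightarrow> fn set" where
  "orthogonal_complement K = {g \<in> L2. \<forall>h\<in>K. inner2 h g = 0}"

lemma orthogonal_complementD:
  assumes "g \<in> orthogonal_complement K"
  shows "g \<in> L2" "\<And>h. h \<in> K \<Longrightarrow> inner2 h g = 0" "\<And>h. h \<in> K \<Longrightarrow> inner2 g h = 0"
  using assms inner2_commute[of g] by (auto simp: orthogonal_complement_def)

lemma dist2_near_minimizers:
  assumes K: "closed_subspace K" and v: "v \<in> L2" and k: "k \<in> K" "k' \<in> K"
    and lower: "\<And>h. h \<in> K \<Longrightarrow> d \<le> (dist2 v h)\<^sup>2"
  shows "(dist2 k k')\<^sup>2 \<le> 2 * ((dist2 v k)\<^sup>2 - d) + 2 * ((dist2 v k')\<^sup>2 - d)"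
proof -
  define mid where "mid = (\<lambda>x. 1/2 * k x + 1/2 * k' x)"
  have "(norm2 (\<lambda>x. (v x - k' x) - (v x - k x)))\<^sup>2 + (norm2 (\<lambda>x. (v x - k' x) + (v x - k x)))\<^sup>2
      = 2 * (dist2 v k')\<^sup>2 + 2 * (dist2 v k)\<^sup>2"
    by (intro norm2_parallelogram L2_diff v closed_subspaceD(1)[OF K] k)
  moreover have "(\<lambda>x. (v x - k' x) + (v x - k x)) = (\<lambda>x. 2 * (v x - mid x))"
    by (auto simp: mid_def algebra_simps)
  then have "(norm2 (\<lambda>x. (v x - k' x) + (v x - k x)))\<^sup>2 = 4 * (dist2 v mid)\<^sup>2"
    by (simp only: norm2_scale) (simp add: power_mult_distrib)
  moreover have "d \<le> (dist2 v mid)\<^sup>2"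
    unfolding mid_def by (intro lower closed_subspaceD(3)[OF K] k)
  ultimately show ?thesis by simp
qed

lemma minimizing_sequence_Cauchy:
  assumes K: "closed_subspace K" and v: "v \<in> L2" and lower: "\<And>h. h \<in> K \<Longrightarrow> d \<le> (dist2 v h)\<^sup>2"
    and k: "\<And>n. k n \<in> K" "\<And>n. (dist2 v (k n))\<^sup>2 < d + 1 / real (Suc n)" and e: "0 < e"
  shows "\<exists>N. \<forall>m\<ge>N. \<forall>n\<ge>N. dist2 (k m) (k n) < e"
proof -
  obtain N where N: "4 / e\<^sup>2 < real N"
    using reals_Archimedean2 by blast
  have N_pos: "0 < real N"
    using N e by (meson divide_pos_pos less_trans zero_less_numeral zero_less_power)
  have "dist2 (k m) (k n) < e" if "N \<le> m" "N \<le> n" for m n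
  proof -
    have "1 / real (Suc m) \<le> 1 / real N" "1 / real (Suc n) \<le> 1 / real N"
      using that N_pos by (auto intro!: divide_left_mono)
    then have "(dist2 (k m) (k n))\<^sup>2 \<le> 4 / real N"
      using dist2_near_minimizers[OF K v k(1) k(1) lower, of m n] k(2)[of m] k(2)[of n] by simp
    also have "\<dots> < e\<^sup>2"
      using N e N_pos by (simp add: field_simps)
    finally show ?thesis
      using e by (simp add: power2_less_imp_less)
  qed
  then show ?thesis by blast
qed

lemma exists_nearest_point:
  assumes K: "closed_subspace K" and v: "v \<in> L2"
  obtains f where "f \<in> K" "\<And>h. h \<in> K \<Longrightarrow> dist2 v f \<le> dist2 v h"
proof -
  note KL = closed_subspaceD(1)[OF K]
  define d where "d = (INF h\<in>K. (dist2 v h)\<^sup>2)"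
  have bdd: "bdd_below ((\<lambda>h. (dist2 v h)\<^sup>2) ` K)"
    by (intro bdd_belowI[of _ 0]) auto
  have lower: "d \<le> (dist2 v h)\<^sup>2" if "h \<in> K" for h
    unfolding d_def using that bdd by (intro cINF_lower)
  have d: "0 \<le> d"
    unfolding d_def using closed_subspaceD(2)[OF K] by (intro cINF_greatest) auto
  have "\<exists>h\<in>K. (dist2 v h)\<^sup>2 < d + 1 / real (Suc n)" for n
    unfolding d_def using closed_subspaceD(2)[OF K] bdd by (subst cINF_less_iff[symmetric]) auto
  then obtain k where k: "\<And>n. k n \<in> K" "\<And>n. (dist2 v (k n))\<^sup>2 < d + 1 / real (Suc n)"
    by metis
  obtain f where f: "f \<in> L2" "(\<lambda>n. dist2 (k n) f) \<longlonglongrightarrow> 0"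
    using L2_complete[OF KL[OF k(1)] minimizing_sequence_Cauchy[OF K v lower k]] .
  have "dist2 v (k n) \<le> sqrt (d + 1 / real (Suc n))" for n
    using k(2) by (intro real_le_rsqrt less_imp_le)
  then have "dist2 v f \<le> sqrt (d + 1 / real (Suc n)) + dist2 (k n) f" for n
    by (rule order_trans[OF dist2_triangle[OF v KL[OF k(1)] f(1)] add_right_mono])
  moreover have "(\<lambda>n. sqrt (d + 1 / real (Suc n)) + dist2 (k n) f) \<longlonglongrightarrow> sqrt (d + 0) + 0"
    by (intro tendsto_intros f LIMSEQ_Suc[OF lim_1_over_n])
  ultimately have "dist2 v f \<le> sqrt (d + 0) + 0"
    by (intro LIMSEQ_le_const) auto
  moreover have "sqrt d \<le> dist2 v h" if "h \<in> K" for h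
    using lower[OF that] by (simp add: real_le_lsqrt)
  ultimately have "dist2 v f \<le> dist2 v h" if "h \<in> K" for h
    using that by fastforce
  with closed_subspaceD(5)[OF K k(1) f] show thesis
    by (rule that)
qed

lemma nearest_point_orthogonal:
  assumes K: "closed_subspace K" and v: "v \<in> L2"
    and f: "f \<in> K" "\<And>h. h \<in> K \<Longrightarrow> dist2 v f \<le> dist2 v h"
  shows "(\<lambda>x. v x - f x) \<in> orthogonal_complement K"
proof -
  define e where "e = (\<lambda>x. v x - f x)"
  have e: "e \<in> L2"
    unfolding e_def by (intro L2_diff v closed_subspaceD(1)[OF K f(1)])
  have "inner2 e h = 0" if h: "h \<in> K" for h
  proof -
    define a where "a = (cmod (inner2 e h))\<^sup>2"
    define t where "t = 1 / ((norm2 h)\<^sup>2 + 1)"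
    have t: "0 < t" "t * (norm2 h)\<^sup>2 < 1"
      using add_nonneg_pos[OF zero_le_power2[of "norm2 h"] zero_less_one] by (simp_all add: t_def)
    define u where "u = - of_real t * inner2 e h"
    have "(\<lambda>x. 1 * f x + (- u) * h x) \<in> K"
      by (intro closed_subspaceD(3)[OF K] f(1) h)
    then have "norm2 e \<le> norm2 (\<lambda>x. e x + u * h x)"
      using f(2)[of "\<lambda>x. 1 * f x + (- u) * h x"] by (simp add: e_def algebra_simps)
    then have "(norm2 e)\<^sup>2 \<le> (norm2 (\<lambda>x. e x + u * h x))\<^sup>2"
      by (intro power_mono) auto
    also have "\<dots> = (norm2 e)\<^sup>2 + 2 * Re (cnj u * inner2 e h) + (cmod u)\<^sup>2 * (norm2 h)\<^sup>2"
      by (rule norm2_add_scale_power2[OF e closed_subspaceD(1)[OF K h]])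
    also have "cnj u * inner2 e h = of_real (- t * a)"
      unfolding u_def a_def of_real_mult complex_norm_square by simp
    also have "(cmod u)\<^sup>2 = t * a * t"
      using t by (simp add: u_def a_def norm_mult power_mult_distrib power2_eq_square)
    finally have "2 * (t * a) \<le> (t * a) * (t * (norm2 h)\<^sup>2)"
      by simp
    also have "\<dots> \<le> (t * a) * 1"
      using t by (intro mult_left_mono) (auto simp: a_def)
    finally show ?thesis
      using t by (simp add: a_def mult_le_0_iff)
  qed
  then show ?thesis
    using e inner2_commute[of _ e] by (auto simp: orthogonal_complement_def e_def)
qed

theorem orthogonal_projection:
  assumes "closed_subspace K" "v \<in> L2"
  obtains k where "k \<in> K" "(\<lambda>x. v x - k x) \<in> orthogonal_complement K"
  using exists_nearest_point[OF assms] nearest_point_orthogonal[OF assms] by metis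

corollary closed_subspace_mem_iff:
  assumes K: "closed_subspace K" and v: "v \<in> L2"
  shows "v \<in> K \<longleftrightarrow> (\<forall>g\<in>orthogonal_complement K. inner2 v g = 0)"
proof
  assume orth: "\<forall>g\<in>orthogonal_complement K. inner2 v g = 0"
  obtain k where k: "k \<in> K" "(\<lambda>x. v x - k x) \<in> orthogonal_complement K"
    using orthogonal_projection[OF K v] .
  define e where "e = (\<lambda>x. v x - k x)"
  have e: "e \<in> orthogonal_complement K"
    using k(2) by (simp add: e_def)
  have "inner2 e e = inner2 v e - inner2 k e"
    using inner2_diff_left[OF v closed_subspaceD(1)[OF K k(1)] orthogonal_complementD(1)[OF e]]
    by (simp add: e_def)
  also have "\<dots> = 0"
    using orth e orthogonal_complementD(2)[OF e k(1)] by simp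
  finally have "AE x in lborel. e x = 0"
    using norm2_eq_0_iff[OF orthogonal_complementD(1)[OF e]] by (simp add: inner2_self)
  then have "aeq k v"
    unfolding aeq_def by eventually_elim (simp add: e_def)
  then show "v \<in> K"
    by (rule closed_subspaceD(4)[OF K k(1) v])
qed (auto dest: orthogonal_complementD(2))


section \<open>Integration against bounded kernels\<close>

lemma borel_measurable_cis [measurable]:
  "f \<in> borel_measurable M \<Longrightarrow> (\<lambda>x. cis (f x)) \<in> borel_measurable M"
  by (rule borel_measurable_continuous_on) (auto intro: continuous_intros)

lemma integrable_imp_borel_measurable_lborel [measurable_dest]:
  fixes \<phi> :: "real \<Rightarrow> 'b :: {banach, second_countable_topology}"
  shows "integrable lborel \<phi> \<Longrightarrow> \<phi> \<in> borel_measurable borel"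
  using borel_measurable_integrable by force

lemma bounded_mult_integral:
  fixes \<phi> u :: "'a \<Rightarrow> 'b :: {banach, second_countable_topology, real_normed_div_algebra}"
  assumes \<phi>: "integrable M \<phi>" and u: "u \<in> borel_measurable M" "AE x in M. norm (u x) \<le> C"
  shows "integrable M (\<lambda>x. u x * \<phi> x)"
    and "norm (LINT x|M. u x * \<phi> x) \<le> C * (LINT x|M. norm (\<phi> x))"
proof -
  have bound: "AE x in M. norm (u x * \<phi> x) \<le> C * norm (\<phi> x)"
    using u(2) by eventually_elim (auto simp: norm_mult intro: mult_right_mono)
  show int: "integrable M (\<lambda>x. u x * \<phi> x)"
  proof (rule Bochner_Integration.integrable_bound)
    show "integrable M (\<lambda>x. C * norm (\<phi> x))"
      using \<phi> by simp
    show "(\<lambda>x. u x * \<phi> x) \<in> borel_measurable M"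
      using \<phi> u(1) by (intro borel_measurable_times) auto
    show "AE x in M. norm (u x * \<phi> x) \<le> norm (C * norm (\<phi> x))"
      using bound by eventually_elim (auto intro: order_trans)
  qed
  have "norm (LINT x|M. u x * \<phi> x) \<le> (LINT x|M. C * norm (\<phi> x))"
    by (rule order_trans[OF integral_norm_bound integral_mono_AE]) (use \<phi> int bound in auto)
  then show "norm (LINT x|M. u x * \<phi> x) \<le> C * (LINT x|M. norm (\<phi> x))"
    by simp
qed

lemma (in pair_sigma_finite) Fubini_bounded_kernel:
  fixes k :: "'a \<Rightarrow> 'b \<Rightarrow> 'c :: {banach, second_countable_topology, real_normed_field}"
  assumes g: "integrable M1 g" and \<phi>: "integrable M2 \<phi>"
    and k: "(\<lambda>(s, t). k s t) \<in> borel_measurable (M1 \<Otimes>\<^sub>M M2)" and bound: "\<And>s t. norm (k s t) \<le> C"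
  shows "(LINT s|M1. g s * (LINT t|M2. k s t * \<phi> t)) = (LINT t|M2. (LINT s|M1. g s * k s t) * \<phi> t)"
proof -
  have [measurable]: "g \<in> borel_measurable M1" "\<phi> \<in> borel_measurable M2"
    using g \<phi> by auto
  have "integrable (M1 \<Otimes>\<^sub>M M2) (\<lambda>(s, t). g s * \<phi> t)"
  proof (rule Fubini_integrable)
    show "integrable M1 (\<lambda>s. LINT t|M2. norm (case (s, t) of (s, t) \<Rightarrow> g s * \<phi> t))"
      using g by (simp add: norm_mult)
  qed (use \<phi> in auto)
  from bounded_mult_integral(1)[OF this k, of C]
  have "integrable (M1 \<Otimes>\<^sub>M M2) (\<lambda>(s, t). g s * (k s t * \<phi> t))"
    using bound by (simp add: case_prod_unfold ac_simps)
  then have "(LINT t|M2. LINT s|M1. g s * (k s t * \<phi> t))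
    = (LINT s|M1. LINT t|M2. g s * (k s t * \<phi> t))"
    by (rule Fubini_integral)
  then show ?thesis
    by (simp flip: mult.assoc) (simp add: mult.assoc)
qed

lemma AE_eq_0_of_interval_integrals:
  fixes \<phi> :: "real \<Rightarrow> 'a :: euclidean_space"
  assumes \<phi>: "integrable lborel \<phi>" and zero: "\<And>a b. a < b \<Longrightarrow> (LINT x:{a..b}|lborel. \<phi> x) = 0"
  shows "AE x in lborel. \<phi> x = 0"
proof -
  have "set_integrable lborel {a..b} \<phi>" for a b
    unfolding set_integrable_def using \<phi> by (intro integrable_mult_indicator) auto
  note HK = set_borel_integral_eq_integral[OF this]
  obtain N where N: "negligible N" "\<And>x e. x \<notin> N \<Longrightarrow> 0 < e \<Longrightarrow>
      \<exists>d>0. \<forall>h. 0 < h \<and> h < d \<longrightarrow> norm (integral {x..x + h} \<phi> /\<^sub>R h - \<phi> x) < e"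
    using integrable_ccontinuous_explicit[of \<phi>] HK(1) by auto
  have "\<phi> x = 0" if "x \<notin> N" for x
  proof (rule ccontr)
    assume "\<phi> x \<noteq> 0"
    with N(2)[OF that, of "norm (\<phi> x)"] obtain d where
      d: "0 < d" "\<And>h. 0 < h \<Longrightarrow> h < d \<Longrightarrow> norm (integral {x..x + h} \<phi> /\<^sub>R h - \<phi> x) < norm (\<phi> x)"
      by auto
    then show False
      using d(2)[of "d / 2"] zero[of x "x + d / 2"] HK(2)[of x "x + d / 2"] by simp
  qed
  then have "AE x in lebesgue. \<phi> x = 0"
    using N(1) by (intro AE_I'[of N]) (auto simp: negligible_iff_null_sets)
  then show ?thesis
    by (simp add: AE_completion_iff)
qed

lemma set_integral_exp_halfline:
  assumes a: "Re a < 0"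
  shows "set_integrable lborel {0<..} (\<lambda>l. exp (a * of_real l))"
    and "(LINT l:{0<..}|lborel. exp (a * of_real l)) = - inverse a"
proof -
  have a0: "a \<noteq> 0"
    using a by auto
  have "set_integrable lborel {0<..} (\<lambda>l. exp (- (l * (- Re a))))"
    using a by (intro integrable_I0i_exp_mscale) simp
  then show int: "set_integrable lborel {0<..} (\<lambda>l. exp (a * of_real l))"
    by (rule set_integrable_bound) (auto simp: set_borel_measurable_def mult.commute)
  have halfline: "einterval 0 \<infinity> = {0<..}"
    by (auto simp: einterval_def)
  have "(LBINT l=0..\<infinity>. exp (a * of_real l)) = 0 - inverse a"
  proof (rule interval_integral_FTC_integrable[where F = "\<lambda>l. exp (a * of_real l) / a"])
    show "((\<lambda>l. exp (a * of_real l) / a) has_vector_derivative exp (a * of_real x)) (at x)" for x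
      by (rule has_vector_derivative_real_field) (use a0 in \<open>auto intro!: derivative_eq_intros\<close>)
    show "isCont (\<lambda>l. exp (a * complex_of_real l)) x" for x
      by (intro continuous_intros)
    show "set_integrable lborel (einterval 0 \<infinity>) (\<lambda>l. exp (a * complex_of_real l))"
      using int by (simp add: halfline)
    have "((\<lambda>l. exp (a * complex_of_real l) / a) \<longlongrightarrow> exp (a * complex_of_real 0) / a) (at_right 0)"
      by (intro tendsto_intros a0)
    then show "(((\<lambda>l. exp (a * complex_of_real l) / a) \<circ> real_of_ereal) \<longlongrightarrow> inverse a) (at_right 0)"
      by (simp add: ereal_tendsto_simps zero_ereal_def inverse_eq_divide)
    have "((\<lambda>l. exp (Re a * l) / cmod a) \<longlongrightarrow> 0) at_top"
      using a a0 by real_asymp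
    then have "((\<lambda>l. exp (a * complex_of_real l) / a) \<longlongrightarrow> 0) at_top"
      by (rule Lim_null_comparison[rotated]) (simp add: norm_divide)
    then show "(((\<lambda>l. exp (a * complex_of_real l) / a) \<circ> real_of_ereal) \<longlongrightarrow> 0) (at_left \<infinity>)"
      by (simp add: ereal_tendsto_simps)
  qed simp
  then show "(LINT l:{0<..}|lborel. exp (a * of_real l)) = - inverse a"
    by (simp add: interval_lebesgue_integral_def halfline)
qed


section \<open>Laplace transforms of bounded functions\<close>

definition laplace :: "(real \<Rightarrow> complex) \<Rightarrow> complex \<Rightarrow> complex" where
  "laplace X z = (LINT l:{0<..}|lborel. exp (\<i> * z * of_real l) * X l)"

definition truncated_laplace :: "real \<Rightarrow> (real \<Rightarrow> complex) \<Rightarrow> complex \<Rightarrow> complex" where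
  "truncated_laplace a X z = integral {0..a} (\<lambda>l. exp (\<i> * z * of_real l) * X l)"

lemma norm_exp_i_mult_of_real: "cmod (exp (\<i> * z * of_real l)) = exp (- (l * Im z))"
  by (simp add: mult.commute)

lemma laplace_set_integrable:
  assumes "X \<in> borel_measurable borel" "\<And>l. cmod (X l) \<le> M" "0 < Im z"
  shows "set_integrable lborel {0<..} (\<lambda>l. exp (\<i> * z * of_real l) * X l)"
  using bounded_mult_integral(1)
    [OF set_integral_exp_halfline(1)[of "\<i> * z", unfolded set_integrable_def], of X M]
    assms
  by (simp add: set_integrable_def mult.commute)

lemma norm_laplace_le:
  assumes "X \<in> borel_measurable borel" "\<And>l. cmod (X l) \<le> M" "0 < Im z"
  shows "cmod (laplace X z) \<le> M / Im z"
proof -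
  have "cmod (LINT l|lborel. X l * (indicator {0<..} l *\<^sub>R exp (\<i> * z * of_real l)))
      \<le> M * (LINT l|lborel. cmod (indicator {0<..} l *\<^sub>R exp (\<i> * z * of_real l)))"
    using set_integral_exp_halfline(1)[of "\<i> * z"] assms
    by (intro bounded_mult_integral) (auto simp: set_integrable_def)
  moreover have "(LINT l|lborel. cmod (indicator {0<..} l *\<^sub>R exp (\<i> * z * of_real l))) = 1 / Im z"
    using LBINT_I0i_exp_mscale[OF assms(3)]
      interval_integral_to_infinity_eq[of lborel 0 "\<lambda>l. exp (- (l * Im z))"]
    by (simp add: norm_exp_i_mult_of_real set_lebesgue_integral_def zero_ereal_def mult.commute)
  ultimately show ?thesis
    by (simp add: laplace_def set_lebesgue_integral_def mult.commute)
qed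

lemma set_integral_greaterThan_translate:
  fixes f :: "real \<Rightarrow> 'a :: {banach, second_countable_topology}"
  shows "(LINT l:{a<..}|lborel. f l) = (LINT l:{0<..}|lborel. f (l + a))"
  using integral_lborel_translate[of "\<lambda>l. indicator {0<..} l *\<^sub>R f (l + a)" a]
  by (simp add: set_lebesgue_integral_def indicator_def)

lemma laplace_split:
  assumes X: "continuous_on UNIV X" "\<And>l. cmod (X l) \<le> M" and a: "0 \<le> a" and z: "0 < Im z"
  shows "laplace X z
    = truncated_laplace a X z + exp (\<i> * z * of_real a) * laplace (\<lambda>l. X (l + a)) z"
proof -
  define f where "f = (\<lambda>l. exp (\<i> * z * of_real l) * X l)"
  have "exp (\<i> * z * of_real (l + a)) = exp (\<i> * z * of_real a) * exp (\<i> * z * of_real l)" for l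
    by (simp add: mult_exp_exp distrib_left add.commute)
  then have shift: "f (l + a)
    = exp (\<i> * z * of_real a) * (exp (\<i> * z * of_real l) * X (l + a))" for l
    by (simp only: f_def mult.assoc)
  have int: "set_integrable lborel {0<..} f"
    unfolding f_def
    by (intro laplace_set_integrable[OF _ X(2) z] borel_measurable_continuous_onI X(1))
  have parts: "set_integrable lborel {0<..a} f" "set_integrable lborel {a<..} f"
    by (rule set_integrable_subset[OF int]; use a in auto)+
  have "laplace X z = (LINT l:{0<..a} \<union> {a<..}|lborel. f l)"
    using ivl_disj_un_one(5)[of 0 a] a by (simp add: laplace_def f_def)
  also have "\<dots> = (LINT l:{0<..a}|lborel. f l) + (LINT l:{a<..}|lborel. f l)"
    by (intro set_integral_Un parts) auto
  also have "(LINT l:{0<..a}|lborel. f l) = integral {0<..a} f"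
    by (rule set_borel_integral_eq_integral(2)[OF parts(1)])
  also have "\<dots> = truncated_laplace a X z"
    unfolding truncated_laplace_def f_def[symmetric]
    by (rule integral_spike_set; rule negligible_subset[of "{0}"]) auto
  also have "(LINT l:{a<..}|lborel. f l) = (LINT l:{0<..}|lborel. f (l + a))"
    by (rule set_integral_greaterThan_translate)
  also have "\<dots> = exp (\<i> * z * of_real a) * laplace (\<lambda>l. X (l + a)) z"
    by (simp add: shift laplace_def)
  finally show ?thesis .
qed


section \<open>Cauchy integrals\<close>

text \<open>Without the customary factor \<open>1 / (2 \<pi> \<i>)\<close>.\<close>

definition cauchy :: "fn \<Rightarrow> complex \<Rightarrow> complex" where
  "cauchy \<phi> z = (LINT x|lborel. inverse (of_real x - z) * \<phi> x)"

lemma of_real_minus_nonreal_neq_0: "Im z \<noteq> 0 \<Longrightarrow> of_real x - z \<noteq> 0"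
  by (auto simp: complex_eq_iff)

lemma norm_inverse_of_real_minus_le:
  assumes "Im z \<noteq> 0"
  shows "cmod (inverse (of_real x - z)) \<le> 1 / \<bar>Im z\<bar>"
proof -
  have "\<bar>Im z\<bar> \<le> cmod (of_real x - z)"
    using abs_Im_le_cmod[of "of_real x - z"] by simp
  then show ?thesis
    using assms by (simp add: norm_inverse inverse_eq_divide[of "cmod _"] frac_le)
qed

lemma cauchy_integrable:
  assumes "integrable lborel \<phi>" "Im z \<noteq> 0"
  shows "integrable lborel (\<lambda>x. inverse (of_real x - z) * \<phi> x)"
  using norm_inverse_of_real_minus_le[OF assms(2)]
  by (intro bounded_mult_integral(1)[OF assms(1)]) auto

lemma norm_cauchy_le:
  assumes "integrable lborel \<phi>" "Im z \<noteq> 0"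
  shows "cmod (cauchy \<phi> z) \<le> (LINT x|lborel. cmod (\<phi> x)) / \<bar>Im z\<bar>"
  using bounded_mult_integral(2)[OF assms(1), of "\<lambda>x. inverse (of_real x - z)" "1 / \<bar>Im z\<bar>"]
    norm_inverse_of_real_minus_le[OF assms(2)]
  by (simp add: cauchy_def)

lemma norm_cauchy_le_of_Im_ge_1:
  assumes "integrable lborel \<phi>" "1 \<le> Im z"
  shows "cmod (cauchy \<phi> z) \<le> (LINT x|lborel. cmod (\<phi> x))"
proof -
  have "cmod (cauchy \<phi> z) \<le> (LINT x|lborel. cmod (\<phi> x)) / \<bar>Im z\<bar>"
    using assms by (intro norm_cauchy_le) auto
  also have "\<dots> \<le> (LINT x|lborel. cmod (\<phi> x)) / 1"
    using assms(2) by (intro divide_left_mono) auto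
  finally show ?thesis by simp
qed

lemma cauchy_scale: "cauchy (\<lambda>x. a * \<phi> x) z = a * cauchy \<phi> z"
  by (simp add: cauchy_def mult.left_commute)

lemma cauchy_lincomb:
  assumes "integrable lborel \<phi>" "integrable lborel \<theta>" "Im z \<noteq> 0"
  shows "cauchy (\<lambda>x. a * \<phi> x + b * \<theta> x) z = a * cauchy \<phi> z + b * cauchy \<theta> z"
proof -
  have "cauchy (\<lambda>x. a * \<phi> x + b * \<theta> x) z
      = (LINT x|lborel. a * (inverse (of_real x - z) * \<phi> x) + b * (inverse (of_real x - z) * \<theta> x))"
    by (simp add: cauchy_def algebra_simps)
  also have "\<dots> = a * cauchy \<phi> z + b * cauchy \<theta> z"
    using cauchy_integrable[OF assms(1,3)] cauchy_integrable[OF assms(2,3)]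
    by (simp add: cauchy_def)
  finally show ?thesis .
qed

lemma cauchy_cong_AE:
  assumes [measurable]: "integrable lborel \<phi>" "integrable lborel \<theta>" and "AE x in lborel. \<phi> x = \<theta> x"
  shows "cauchy \<phi> z = cauchy \<theta> z"
  unfolding cauchy_def by (rule integral_cong_AE) (use assms(3) in auto)

lemma cauchy_cnj: "cauchy (\<lambda>x. cnj (\<phi> x)) z = cnj (cauchy \<phi> (cnj z))"
proof -
  have "cauchy (\<lambda>x. cnj (\<phi> x)) z = (LINT x|lborel. cnj (inverse (of_real x - cnj z) * \<phi> x))"
    by (simp add: cauchy_def)
  also have "\<dots> = cnj (cauchy \<phi> (cnj z))"
    unfolding cauchy_def by (rule Bochner_Integration.integral_cnj)
  finally show ?thesis .
qed

lemma cauchy_translate: "cauchy (\<lambda>x. \<phi> (x - m)) z = cauchy \<phi> (z - of_real m)"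
proof -
  have "cauchy (\<lambda>x. \<phi> (x - m)) z
      = (LINT x|lborel. inverse (of_real (x - m) - (z - of_real m)) * \<phi> (x - m))"
    by (simp add: cauchy_def)
  also have "\<dots> = cauchy \<phi> (z - of_real m)"
    unfolding cauchy_def by (rule integral_lborel_translate)
  finally show ?thesis .
qed

lemma cauchy_reflect: "cauchy (\<lambda>x. \<phi> (- x)) z = - cauchy \<phi> (- z)"
proof -
  have "inverse (of_real x - z) = - inverse (of_real (- x) - (- z))" for x
    by (simp flip: inverse_minus_eq)
  then have "cauchy (\<lambda>x. \<phi> (- x)) z = - (LINT x|lborel. inverse (of_real (- x) - (- z)) * \<phi> (- x))"
    by (simp add: cauchy_def)
  also have "\<dots> = - cauchy \<phi> (- z)"
    unfolding cauchy_def
    using lborel_integral_real_affine[of "-1" "\<lambda>x. inverse (of_real x - (- z)) * \<phi> x" 0] by simp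
  finally show ?thesis .
qed

lemma cauchy_difference_quotient:
  assumes \<phi>: "integrable lborel \<phi>" and nonreal: "Im w \<noteq> 0" "Im z \<noteq> 0" and "w \<noteq> z"
  shows "(cauchy \<phi> w - cauchy \<phi> z) / (w - z)
    = (LINT x|lborel. inverse (of_real x - w) * inverse (of_real x - z) * \<phi> x)"
proof -
  have "(inverse (of_real x - w) - inverse (of_real x - z)) / (w - z)
      = inverse (of_real x - w) * inverse (of_real x - z)" for x
    using nonreal[THEN of_real_minus_nonreal_neq_0, of x] \<open>w \<noteq> z\<close> by (simp add: divide_simps)
  moreover have "(cauchy \<phi> w - cauchy \<phi> z) / (w - z)
      = (LINT x|lborel. (inverse (of_real x - w) - inverse (of_real x - z)) / (w - z) * \<phi> x)"
    using nonreal[THEN cauchy_integrable[OF \<phi>]]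
    by (simp add: cauchy_def left_diff_distrib diff_divide_distrib)
  ultimately show ?thesis by simp
qed

lemma cauchy_has_field_derivative:
  assumes \<phi> [measurable]: "integrable lborel \<phi>" and z: "Im z \<noteq> 0"
  shows "(cauchy \<phi> has_field_derivative (LINT x|lborel. (inverse (of_real x - z))\<^sup>2 * \<phi> x)) (at z)"
proof -
  define U where "U = {w. \<bar>Im z\<bar> / 2 < \<bar>Im w\<bar>}"
  have U: "open U" "z \<in> U"
    using z by (auto simp: U_def intro!: open_Collect_less continuous_intros)
  have "((\<lambda>w. (cauchy \<phi> w - cauchy \<phi> z) / (w - z))
    \<longlongrightarrow> (LINT x|lborel. (inverse (of_real x - z))\<^sup>2 * \<phi> x))
      (at z within U)"
    unfolding tendsto_at_iff_sequentially o_def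
  proof (intro allI impI)
    fix w assume w: "\<forall>n. w n \<in> U - {z}" and lim: "w \<longlonglongrightarrow> z"
    have nonreal: "Im (w n) \<noteq> 0" for n
      using w[rule_format, of n] z by (auto simp: U_def)
    have "(\<lambda>n. LINT x|lborel. inverse (of_real x - w n) * inverse (of_real x - z) * \<phi> x)
        \<longlonglongrightarrow> (LINT x|lborel. inverse (of_real x - z) * inverse (of_real x - z) * \<phi> x)"
    proof (rule integral_dominated_convergence
        [where w = "\<lambda>x. 2 / \<bar>Im z\<bar> * (1 / \<bar>Im z\<bar>) * cmod (\<phi> x)"])
      show "integrable lborel (\<lambda>x. 2 / \<bar>Im z\<bar> * (1 / \<bar>Im z\<bar>) * cmod (\<phi> x))"
        using \<phi> by simp
      show "AE x in lborel. (\<lambda>n. inverse (of_real x - w n) * inverse (of_real x - z) * \<phi> x)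
          \<longlonglongrightarrow> inverse (of_real x - z) * inverse (of_real x - z) * \<phi> x"
        by (intro AE_I2 tendsto_intros lim of_real_minus_nonreal_neq_0 z)
      show "AE x in lborel. norm (inverse (of_real x - w n) * inverse (of_real x - z) * \<phi> x)
          \<le> 2 / \<bar>Im z\<bar> * (1 / \<bar>Im z\<bar>) * cmod (\<phi> x)" for n
      proof (rule AE_I2)
        fix x
        have "cmod (inverse (of_real x - w n)) \<le> 1 / \<bar>Im (w n)\<bar>"
          by (rule norm_inverse_of_real_minus_le[OF nonreal])
        also have "\<dots> \<le> 2 / \<bar>Im z\<bar>"
          using w[rule_format, of n] z nonreal[of n] by (auto simp: U_def field_simps)
        finally show "norm (inverse (of_real x - w n) * inverse (of_real x - z) * \<phi> x)
            \<le> 2 / \<bar>Im z\<bar> * (1 / \<bar>Im z\<bar>) * cmod (\<phi> x)"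
          unfolding norm_mult
          by (intro mult_right_mono mult_mono norm_inverse_of_real_minus_le z) auto
      qed
    qed simp_all
    then show "(\<lambda>n. (cauchy \<phi> (w n) - cauchy \<phi> z) / (w n - z))
        \<longlonglongrightarrow> (LINT x|lborel. (inverse (of_real x - z))\<^sup>2 * \<phi> x)"
      using w by (simp add: cauchy_difference_quotient[OF \<phi> nonreal z] power2_eq_square)
  qed
  moreover have "at z within U = at z"
    using U by (intro at_within_open)
  ultimately show ?thesis
    by (simp only: has_field_derivative_iff)
qed

lemma cauchy_holomorphic:
  assumes "integrable lborel \<phi>"
  shows "cauchy \<phi> holomorphic_on {z. Im z \<noteq> 0}"
  using cauchy_has_field_derivative[OF assms]
  by (intro holomorphic_onI)
    (auto simp: field_differentiable_def intro: has_field_derivative_at_within)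


section \<open>The Poisson kernel\<close>

definition poisson_kernel :: "real \<Rightarrow> real \<Rightarrow> real" where
  "poisson_kernel y x = y / (x\<^sup>2 + y\<^sup>2)"

lemma borel_measurable_poisson_kernel [measurable]:
  "f \<in> borel_measurable M \<Longrightarrow> (\<lambda>x. poisson_kernel y (f x)) \<in> borel_measurable M"
  by (simp add: poisson_kernel_def)

lemma poisson_kernel_bounds:
  assumes "0 < y"
  shows "0 \<le> poisson_kernel y x" "poisson_kernel y x \<le> 1 / y"
proof -
  have "y\<^sup>2 \<le> x\<^sup>2 + y\<^sup>2" "0 < x\<^sup>2 + y\<^sup>2"
    using assms by (auto simp: add_nonneg_pos)
  then show "0 \<le> poisson_kernel y x" "poisson_kernel y x \<le> 1 / y"
    using assms by (auto simp: poisson_kernel_def field_simps power2_eq_square)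
qed

lemma poisson_kernel_eq_jump:
  assumes "0 < Im z"
  shows "inverse (of_real x - z) - inverse (of_real x - cnj z)
    = 2 * \<i> * of_real (poisson_kernel (Im z) (x - Re z))"
proof -
  have neq: "of_real x - z \<noteq> 0" "of_real x - cnj z \<noteq> 0"
    using assms of_real_minus_nonreal_neq_0[of z x] of_real_minus_nonreal_neq_0[of "cnj z" x]
    by simp_all
  have "(of_real x - z) * (of_real x - cnj z) = of_real ((x - Re z)\<^sup>2 + (Im z)\<^sup>2)"
    by (simp add: complex_eq_iff power2_eq_square algebra_simps)
  moreover have "z - cnj z = 2 * \<i> * of_real (Im z)"
    by (simp add: complex_eq_iff)
  moreover have "inverse (of_real x - z) - inverse (of_real x - cnj z)
      = (z - cnj z) / ((of_real x - z) * (of_real x - cnj z))"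
    using neq by (simp add: field_simps)
  ultimately show ?thesis
    by (simp add: poisson_kernel_def)
qed

lemma poisson_kernel_has_arctan_primitive:
  assumes "0 < y"
  shows "((\<lambda>s. arctan ((s - t) / y)) has_real_derivative poisson_kernel y (t - s)) (at s within S)"
proof -
  have "1 + ((s - t) / y)\<^sup>2 = ((t - s)\<^sup>2 + y\<^sup>2) / y\<^sup>2"
    using assms by (simp add: field_simps power2_commute)
  then show ?thesis
    using assms by (auto intro!: derivative_eq_intros simp: poisson_kernel_def power2_eq_square)
qed

lemma integral_poisson_kernel:
  assumes y: "0 < y"
  shows "integrable lborel (\<lambda>s. poisson_kernel y (s - x))"
    and "(LINT s|lborel. poisson_kernel y (s - x)) = pi"
proof -
  have line: "einterval (- \<infinity>) \<infinity> = UNIV"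
    by (auto simp: einterval_def)
  have int: "integrable lborel (\<lambda>s::real. inverse (1 + s\<^sup>2))"
    using integrable_inverse_1_plus_square by (simp add: line set_integrable_def)
  have scale: "poisson_kernel y = (\<lambda>s. inverse y * inverse (1 + (0 + 1 / y * s)\<^sup>2))"
    using y by (simp add: fun_eq_iff poisson_kernel_def field_simps power2_eq_square)
  have "(LINT s|lborel. inverse (1 + (0 + 1 / y * s)\<^sup>2)) = pi * y"
    using lborel_integral_real_affine[of "1 / y" "\<lambda>s. inverse (1 + s\<^sup>2)" 0] y
      LBINT_inverse_1_plus_square
    by (simp add: interval_lebesgue_integral_def line set_lebesgue_integral_def field_simps)
  then show "(LINT s|lborel. poisson_kernel y (s - x)) = pi"
    unfolding integral_lborel_translate using y by (simp add: scale)
  have "integrable lborel (poisson_kernel y)"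
    unfolding scale using lborel_integrable_real_affine[OF int, of "1 / y" 0] y by simp
  then show "integrable lborel (\<lambda>s. poisson_kernel y (s - x))"
    by (rule integrable_lborel_translate)
qed

lemma integral_poisson_kernel_interval:
  assumes "a \<le> b" "0 < y"
  shows "(LINT s:{a..b}|lborel. poisson_kernel y (t - s))
    = arctan ((b - t) / y) - arctan ((a - t) / y)"
  unfolding set_lebesgue_integral_def
proof (rule integral_FTC_Icc[OF assms(1)])
  show "continuous_on {a..b} (\<lambda>s. poisson_kernel y (t - s))"
    using assms(2) unfolding poisson_kernel_def
    by (intro continuous_intros) (auto simp: add_nonneg_eq_0_iff)
qed (use poisson_kernel_has_arctan_primitive[OF assms(2)] in
  \<open>simp add: has_real_derivative_iff_has_vector_derivative\<close>)

lemma arctan_interval_tendsto_indicator: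
  assumes "a < b" "t \<noteq> a" "t \<noteq> b"
  shows "(\<lambda>n. arctan ((b - t) / (1 / real (Suc n))) - arctan ((a - t) / (1 / real (Suc n))))
    \<longlonglongrightarrow> pi * indicator {a..b} t"
proof -
  have scaled: "0 < u \<Longrightarrow> (\<lambda>n. arctan (u / (1 / real (Suc n)))) \<longlonglongrightarrow> pi / 2"
      "u < 0 \<Longrightarrow> (\<lambda>n. arctan (u / (1 / real (Suc n)))) \<longlonglongrightarrow> - (pi / 2)" for u :: real
    by real_asymp+
  consider "t < a" | "a < t" "t < b" | "b < t"
    using assms(2,3) by linarith
  then show ?thesis
  proof cases
    case 1
    then show ?thesis
      using tendsto_diff[OF scaled(1)[of "b - t"] scaled(1)[of "a - t"]] assms(1) by simp
  next
    case 2
    then show ?thesis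
      using tendsto_diff[OF scaled(1)[of "b - t"] scaled(2)[of "a - t"]] by simp
  next
    case 3
    then show ?thesis
      using tendsto_diff[OF scaled(2)[of "b - t"] scaled(2)[of "a - t"]] assms(1) by simp
  qed
qed

lemma poisson_integral_eq_cauchy_jump:
  assumes \<phi>: "integrable lborel \<phi>" and y: "0 < y"
  shows "(LINT t|lborel. of_real (poisson_kernel y (t - s)) * \<phi> t)
    = (cauchy \<phi> (Complex s y) - cauchy \<phi> (Complex s (- y))) / (2 * \<i>)"
proof -
  have "cnj (Complex s y) = Complex s (- y)"
    by (simp add: complex_eq_iff)
  then have "inverse (of_real t - Complex s y) * \<phi> t - inverse (of_real t - Complex s (- y)) * \<phi> t
      = 2 * \<i> * (of_real (poisson_kernel y (t - s)) * \<phi> t)" for t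
    using poisson_kernel_eq_jump[of "Complex s y" t] y by (simp flip: left_diff_distrib)
  then have "cauchy \<phi> (Complex s y) - cauchy \<phi> (Complex s (- y))
      = (LINT t|lborel. 2 * \<i> * (of_real (poisson_kernel y (t - s)) * \<phi> t))"
    using cauchy_integrable[OF \<phi>, of "Complex s y"] cauchy_integrable[OF \<phi>, of "Complex s (- y)"] y
    by (simp add: cauchy_def flip: Bochner_Integration.integral_diff)
  then show ?thesis by simp
qed

lemma integral_arctan_eq_0_of_cauchy_eq_0:
  assumes \<phi>: "integrable lborel \<phi>" and zero: "\<And>z. Im z \<noteq> 0 \<Longrightarrow> cauchy \<phi> z = 0"
    and ab: "a \<le> b" and y: "0 < y"
  shows "(LINT t|lborel. of_real (arctan ((b - t) / y) - arctan ((a - t) / y)) * \<phi> t) = 0"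
proof -
  define u where "u = (\<lambda>s. complex_of_real (indicator {a..b} s))"
  have "(LINT s|lborel. u s * (LINT t|lborel. of_real (poisson_kernel y (t - s)) * \<phi> t))
      = (LINT t|lborel. (LINT s|lborel. u s * of_real (poisson_kernel y (t - s))) * \<phi> t)"
  proof (rule lborel_pair.Fubini_bounded_kernel[OF _ \<phi>, where C = "1 / y"])
    show "integrable lborel u"
      unfolding u_def using ab by (intro integrable_of_real integrable_real_indicator) auto
    show "cmod (of_real (poisson_kernel y (t - s))) \<le> 1 / y" for s t
      using poisson_kernel_bounds[OF y] by simp
  qed measurable
  moreover have "(LINT s|lborel. u s * of_real (poisson_kernel y (t - s)))
      = of_real (arctan ((b - t) / y) - arctan ((a - t) / y))" for t
  proof -
    have "(LINT s|lborel. u s * of_real (poisson_kernel y (t - s)))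
        = (LINT s|lborel. complex_of_real (indicator {a..b} s *\<^sub>R poisson_kernel y (t - s)))"
      by (simp add: u_def)
    also have "\<dots> = of_real (LINT s:{a..b}|lborel. poisson_kernel y (t - s))"
      unfolding set_lebesgue_integral_def by (rule integral_complex_of_real)
    finally show ?thesis
      by (simp only: integral_poisson_kernel_interval[OF ab y])
  qed
  ultimately show ?thesis
    using y by (simp add: poisson_integral_eq_cauchy_jump[OF \<phi> y] zero)
qed

theorem AE_eq_0_of_cauchy_eq_0:
  assumes \<phi> [measurable]: "integrable lborel \<phi>" and zero: "\<And>z. Im z \<noteq> 0 \<Longrightarrow> cauchy \<phi> z = 0"
  shows "AE x in lborel. \<phi> x = 0"
proof (rule AE_eq_0_of_interval_integrals[OF \<phi>])
  fix a b :: real assume ab: "a < b"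
  define A where "A = (\<lambda>n t. arctan ((b - t) / (1 / real (Suc n)))
    - arctan ((a - t) / (1 / real (Suc n))))"
  have [measurable]: "A n \<in> borel_measurable borel" for n
    unfolding A_def by measurable
  have "(\<lambda>n. LINT t|lborel. of_real (A n t) * \<phi> t)
      \<longlonglongrightarrow> (LINT t|lborel. of_real (pi * indicator {a..b} t) * \<phi> t)"
  proof (rule integral_dominated_convergence[where w = "\<lambda>x. pi * cmod (\<phi> x)"])
    show "AE t in lborel. norm (complex_of_real (A n t) * \<phi> t) \<le> pi * cmod (\<phi> t)" for n
    proof (rule AE_I2)
      fix t
      have "\<bar>A n t\<bar> \<le> pi"
        using arctan_bounded[of "(b - t) / (1 / real (Suc n))"]
          arctan_bounded[of "(a - t) / (1 / real (Suc n))"]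
        unfolding A_def by linarith
      then show "norm (complex_of_real (A n t) * \<phi> t) \<le> pi * cmod (\<phi> t)"
        unfolding norm_mult norm_of_real by (intro mult_right_mono) auto
    qed
    have "AE t in lborel. t \<noteq> a" "AE t in lborel. t \<noteq> b"
      by (auto intro: AE_lborel_singleton)
    then show "AE t in lborel. (\<lambda>n. of_real (A n t) * \<phi> t)
      \<longlonglongrightarrow> of_real (pi * indicator {a..b} t) * \<phi> t"
      unfolding A_def
      by eventually_elim
        (intro tendsto_mult tendsto_of_real arctan_interval_tendsto_indicator[OF ab] tendsto_const)
  qed (use \<phi> in auto)
  moreover have "(LINT t|lborel. of_real (A n t) * \<phi> t) = 0" for n
    unfolding A_def using ab by (intro integral_arctan_eq_0_of_cauchy_eq_0 \<phi> zero) auto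
  ultimately have "(LINT t|lborel. of_real (pi * indicator {a..b} t) * \<phi> t) = 0"
    by (simp add: LIMSEQ_const_iff)
  then show "(LINT x:{a..b}|lborel. \<phi> x) = 0"
    by (simp add: set_lebesgue_integral_def scaleR_conv_of_real mult.assoc)
qed


section \<open>Fourier transforms and the Hardy space\<close>

definition fourier :: "fn \<Rightarrow> real \<Rightarrow> complex" where
  "fourier \<phi> l = (LINT x|lborel. cis (l * x) * \<phi> x)"

lemma Mop_eq_cis: "Mop l f = (\<lambda>x. cis (l * x) * f x)"
  by (simp add: Mop_def cis_conv_exp)

lemma Mop_0 [simp]: "Mop 0 f = f"
  by (simp add: Mop_def)

lemma Mop_Mop: "Mop a (Mop b f) = Mop (a + b) f"
  by (simp add: Mop_eq_cis cis_mult distrib_right flip: mult.assoc)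

lemma Mop_integrable: "integrable lborel \<phi> \<Longrightarrow> integrable lborel (Mop l \<phi>)"
  unfolding Mop_eq_cis by (intro bounded_mult_integral(1)[where C = 1]) auto

lemma norm_fourier_le:
  assumes "integrable lborel \<phi>"
  shows "cmod (fourier \<phi> l) \<le> (LINT x|lborel. cmod (\<phi> x))"
  using bounded_mult_integral(2)[OF assms, of "\<lambda>x. cis (l * x)" 1] by (simp add: fourier_def)

lemma fourier_continuous:
  assumes \<phi> [measurable]: "integrable lborel \<phi>"
  shows "continuous_on A (fourier \<phi>)"
proof -
  have "(\<lambda>n. fourier \<phi> (l n)) \<longlonglongrightarrow> fourier \<phi> a" if "l \<longlonglongrightarrow> a" for l a
    unfolding fourier_def
    by (rule integral_dominated_convergence[where w = "\<lambda>x. cmod (\<phi> x)"])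
      (use \<phi> that in \<open>auto simp: norm_mult intro!: tendsto_intros\<close>)
  then show ?thesis
    by (auto simp: continuous_on_sequentially o_def)
qed

lemma fourier_lincomb:
  assumes "integrable lborel \<phi>" "integrable lborel \<theta>"
  shows "fourier (\<lambda>x. a * \<phi> x + b * \<theta> x) l = a * fourier \<phi> l + b * fourier \<theta> l"
proof -
  have "fourier (\<lambda>x. a * \<phi> x + b * \<theta> x) l = (LINT x|lborel. a * Mop l \<phi> x + b * Mop l \<theta> x)"
    by (simp add: fourier_def Mop_eq_cis algebra_simps)
  also have "\<dots> = a * fourier \<phi> l + b * fourier \<theta> l"
    using assms[THEN Mop_integrable[of _ l]] by (simp add: fourier_def Mop_eq_cis)
  finally show ?thesis .
qed

lemma fourier_translate: "fourier (\<lambda>x. \<phi> (x - m)) l = cis (l * m) * fourier \<phi> l"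
proof -
  have "cis (l * x) * \<phi> (x - m) = cis (l * m) * (cis (l * (x - m)) * \<phi> (x - m))" for x
    by (simp add: cis_mult right_diff_distrib flip: mult.assoc)
  then have "fourier (\<lambda>x. \<phi> (x - m)) l
    = (LINT x|lborel. cis (l * m) * (cis (l * (x - m)) * \<phi> (x - m)))"
    by (simp only: fourier_def)
  also have "\<dots> = cis (l * m) * fourier \<phi> l"
    unfolding fourier_def using integral_lborel_translate[of "\<lambda>x. cis (l * x) * \<phi> x" m] by simp
  finally show ?thesis .
qed

lemma fourier_reflect: "fourier (\<lambda>x. \<phi> (- x)) l = fourier \<phi> (- l)"
  unfolding fourier_def using lborel_integral_real_affine[of "-1" "\<lambda>x. cis (- l * x) * \<phi> x" 0]
  by simp

lemma fourier_Mop: "fourier (Mop a \<phi>) l = fourier \<phi> (l + a)"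
  by (simp add: fourier_def Mop_eq_cis cis_mult distrib_right flip: mult.assoc)

lemma inner2_Mop: "inner2 (Mop l f) g = fourier (\<lambda>x. f x * cnj (g x)) l"
  by (simp add: inner2_def Mop_eq_cis fourier_def mult.assoc)

lemma cauchy_eq_laplace_fourier_lower:
  assumes \<phi>: "integrable lborel \<phi>" and w: "Im w < 0"
  shows "cauchy \<phi> w = - \<i> * laplace (fourier \<phi>) (- w)"
proof -
  define g where "g = (\<lambda>l::real. indicator {0<..} l *\<^sub>R exp (- \<i> * w * of_real l))"
  have g: "integrable lborel g"
    using set_integral_exp_halfline(1)[of "- \<i> * w"] w by (simp add: g_def set_integrable_def)
  have "(LINT l|lborel. g l * fourier \<phi> l)
    = (LINT t|lborel. (LINT l|lborel. g l * cis (l * t)) * \<phi> t)"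
    unfolding fourier_def by (rule lborel_pair.Fubini_bounded_kernel[OF g \<phi>, where C = 1]) auto
  also have "\<dots> = (LINT t|lborel. \<i> * inverse (of_real t - w) * \<phi> t)"
  proof -
    have "(LINT l|lborel. g l * cis (l * t)) = \<i> * inverse (of_real t - w)" for t
    proof -
      have "(LINT l|lborel. g l * cis (l * t))
        = (LINT l:{0<..}|lborel. exp (\<i> * (of_real t - w) * of_real l))"
        by (simp add: g_def set_lebesgue_integral_def cis_conv_exp mult_exp_exp algebra_simps)
      also have "\<dots> = - inverse (\<i> * (of_real t - w))"
        using w by (intro set_integral_exp_halfline(2)) simp
      finally show ?thesis by simp
    qed
    then show ?thesis by simp
  qed
  also have "\<dots> = \<i> * cauchy \<phi> w"
    by (simp add: cauchy_def mult.assoc)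
  finally have "\<i> * cauchy \<phi> w = laplace (fourier \<phi>) (- w)"
    by (simp add: g_def laplace_def set_lebesgue_integral_def)
  then show ?thesis
    by (metis mult.assoc mult_minus_left i_squared mult_1 minus_minus)
qed

lemma cauchy_eq_laplace_fourier_upper:
  assumes \<phi>: "integrable lborel \<phi>" and z: "0 < Im z"
  shows "cauchy \<phi> z = \<i> * laplace (\<lambda>l. fourier \<phi> (- l)) z"
  using cauchy_eq_laplace_fourier_lower[of "\<lambda>x. \<phi> (- x)" "- z"] z
    lborel_integrable_real_affine[OF \<phi>, of "-1" 0]
  by (simp add: cauchy_reflect fourier_reflect[abs_def])

corollary AE_eq_0_of_fourier_eq_0:
  assumes \<phi>: "integrable lborel \<phi>" and zero: "\<And>l. fourier \<phi> l = 0"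
  shows "AE x in lborel. \<phi> x = 0"
proof (rule AE_eq_0_of_cauchy_eq_0[OF \<phi>])
  fix z assume "Im z \<noteq> 0"
  then consider "Im z < 0" | "0 < Im z"
    by linarith
  then show "cauchy \<phi> z = 0"
    by cases (simp_all add: cauchy_eq_laplace_fourier_lower cauchy_eq_laplace_fourier_upper
      laplace_def \<phi> zero)
qed

definition hardy_space :: "fn set" where
  "hardy_space = {\<phi>. integrable lborel \<phi> \<and> (\<forall>l\<ge>0. fourier \<phi> l = 0)}"

lemma hardy_spaceD:
  assumes "\<phi> \<in> hardy_space"
  shows "integrable lborel \<phi>" "0 \<le> l \<Longrightarrow> fourier \<phi> l = 0"
  using assms by (auto simp: hardy_space_def)

lemma Mop_in_hardy_space_iff:
  assumes "integrable lborel \<phi>"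
  shows "Mop c \<phi> \<in> hardy_space \<longleftrightarrow> (\<forall>l\<ge>c. fourier \<phi> l = 0)"
proof -
  have "(\<forall>l\<ge>0. fourier \<phi> (l + c) = 0) \<longleftrightarrow> (\<forall>l\<ge>c. fourier \<phi> l = 0)"
    by (metis add_increasing add_le_cancel_right diff_add_cancel diff_ge_0_iff_ge add_0)
  then show ?thesis
    using Mop_integrable[OF assms] by (simp add: hardy_space_def fourier_Mop)
qed

lemma hardy_space_Mop: "\<phi> \<in> hardy_space \<Longrightarrow> 0 \<le> l \<Longrightarrow> Mop l \<phi> \<in> hardy_space"
  by (simp add: Mop_in_hardy_space_iff hardy_spaceD)

lemma hardy_space_lincomb:
  assumes "\<phi> \<in> hardy_space" "\<theta> \<in> hardy_space"
  shows "(\<lambda>x. a * \<phi> x + b * \<theta> x) \<in> hardy_space"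
  using assms by (simp add: hardy_space_def fourier_lincomb)

lemma hardy_space_scale: "\<phi> \<in> hardy_space \<Longrightarrow> (\<lambda>x. a * \<phi> x) \<in> hardy_space"
  using hardy_space_lincomb[of \<phi> \<phi> a 0] by simp

lemma hardy_space_translate: "\<phi> \<in> hardy_space \<Longrightarrow> (\<lambda>x. \<phi> (x - m)) \<in> hardy_space"
  by (simp add: hardy_space_def fourier_translate integrable_lborel_translate)

lemma cauchy_hardy_space_lower:
  assumes "\<phi> \<in> hardy_space" "Im w < 0"
  shows "cauchy \<phi> w = 0"
proof -
  have "indicator {0<..} l *\<^sub>R (exp (\<i> * (- w) * of_real l) * fourier \<phi> l) = 0" for l
    using assms(1) by (auto simp: hardy_spaceD indicator_def)
  then show ?thesis
    unfolding cauchy_eq_laplace_fourier_lower[OF hardy_spaceD(1)[OF assms(1)] assms(2)]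
      laplace_def set_lebesgue_integral_def
    by (simp only: integral_zero mult_zero_right)
qed

lemma hardy_space_resolvent:
  assumes \<phi>: "\<phi> \<in> hardy_space" and w: "Im w < 0"
  shows "(\<lambda>x. inverse (of_real x - w) * \<phi> x) \<in> hardy_space"
proof -
  have "fourier (\<lambda>x. inverse (of_real x - w) * \<phi> x) l = cauchy (Mop l \<phi>) w" for l
    by (simp add: fourier_def cauchy_def Mop_eq_cis mult.left_commute)
  moreover have "cauchy (Mop l \<phi>) w = 0" if "0 \<le> l" for l
    by (intro cauchy_hardy_space_lower hardy_space_Mop \<phi> that w)
  moreover have "integrable lborel (\<lambda>x. inverse (of_real x - w) * \<phi> x)"
    using w by (intro cauchy_integrable hardy_spaceD(1)[OF \<phi>]) auto
  ultimately show ?thesis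
    by (simp add: hardy_space_def)
qed

lemma cauchy_Mop_hardy_space:
  assumes \<phi>: "\<phi> \<in> hardy_space" and c: "0 \<le> c" and z: "0 < Im z"
  shows "cauchy (Mop c \<phi>) z = exp (\<i> * z * of_real c) * cauchy \<phi> z"
proof -
  note int = hardy_spaceD(1)[OF \<phi>]
  define X where "X = (\<lambda>l. fourier \<phi> (- l + c))"
  have "continuous_on UNIV X"
    unfolding X_def
    by (intro continuous_on_compose2[OF fourier_continuous[OF int]] continuous_intros) auto
  then have "laplace X z
    = truncated_laplace c X z + exp (\<i> * z * of_real c) * laplace (\<lambda>l. X (l + c)) z"
    unfolding X_def by (intro laplace_split[OF _ norm_fourier_le[OF int] c z])
  moreover have "exp (\<i> * z * of_real l) * X l = 0" if "l \<in> {0..c}" for l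
    using that by (simp add: X_def hardy_spaceD(2)[OF \<phi>])
  then have "truncated_laplace c X z = 0"
    unfolding truncated_laplace_def by (subst Henstock_Kurzweil_Integration.integral_cong) auto
  ultimately show ?thesis
    using cauchy_eq_laplace_fourier_upper[OF Mop_integrable[OF int] z]
      cauchy_eq_laplace_fourier_upper[OF int z]
    by (simp add: fourier_Mop X_def)
qed


section \<open>Analytic functions on the upper half-plane\<close>

lemma path_image_upper_half_circle:
  assumes "0 \<le> R" "w \<in> path_image (part_circlepath 0 R 0 pi)"
  shows "0 \<le> Im w" "cmod w = R"
proof -
  obtain t where t: "t \<in> {0..pi}" "w = of_real R * exp (\<i> * of_real t)"
    using assms by (auto simp: path_image_part_circlepath)
  have "Im w = R * sin t"
    by (simp add: t(2) Im_exp)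
  then show "0 \<le> Im w"
    using assms(1) t(1) by (simp add: sin_ge_zero)
  show "cmod w = R"
    using assms(1) by (simp add: t(2) norm_mult)
qed

lemma continuous_on_real_line_of_holomorphic:
  assumes "0 < e" "g holomorphic_on {z. - e < Im z}"
  shows "continuous_on A (\<lambda>x. g (complex_of_real x))"
  by (rule continuous_on_compose2[OF holomorphic_on_imp_continuous_on[OF assms(2)]])
    (use assms(1) in \<open>auto intro!: continuous_intros\<close>)

lemma integral_segment_eq_upper_half_circle:
  assumes e: "0 < e" and hol: "g holomorphic_on {z. - e < Im z}" and R: "0 < R"
  shows "(LINT x:{-R..R}|lborel. g (of_real x)) = - contour_integral (part_circlepath 0 R 0 pi) g"
proof -
  define \<gamma> where "\<gamma> = linepath (- complex_of_real R) (of_real R)"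
  define \<omega> where "\<omega> = part_circlepath 0 R 0 pi"
  have cont: "continuous_on {z. - e < Im z} g"
    using hol by (rule holomorphic_on_imp_continuous_on)
  have "path_image \<gamma> \<subseteq> {z. - e < Im z}"
    unfolding \<gamma>_def path_image_linepath using e
    by (intro closed_segment_subset convex_halfspace_Im_gt) auto
  moreover have "path_image \<omega> \<subseteq> {z. - e < Im z}"
    unfolding \<omega>_def using path_image_upper_half_circle(1)[of R] R e by force
  ultimately have img: "path_image \<gamma> \<subseteq> {z. - e < Im z}" "path_image \<omega> \<subseteq> {z. - e < Im z}"
    by blast+
  have ends: "pathfinish \<gamma> = pathstart \<omega>" "pathfinish \<omega> = pathstart \<gamma>"
    by (simp_all add: \<gamma>_def \<omega>_def exp_pi_i)
  have int: "g contour_integrable_on \<gamma>" "g contour_integrable_on \<omega>"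
    using img unfolding \<gamma>_def \<omega>_def
    by (auto intro!: contour_integrable_continuous_linepath
        contour_integrable_continuous_part_circlepath
        continuous_on_subset[OF cont])
  have valid: "valid_path \<gamma>" "valid_path \<omega>"
    by (simp_all add: \<gamma>_def \<omega>_def)
  have "(g has_contour_integral 0) (\<gamma> +++ \<omega>)"
    using img valid ends
    by (intro Cauchy_theorem_convex_simple[OF hol] convex_halfspace_Im_gt valid_path_join
      subset_path_image_join) auto
  then have "contour_integral \<gamma> g = - contour_integral \<omega> g"
    using contour_integral_unique contour_integral_join[OF int valid] by (metis eq_neg_iff_add_eq_0)
  moreover have "((\<lambda>x. g (of_real x)) has_integral contour_integral \<gamma> g) {-R..R}"
    using has_contour_integral_linepath_Reals_iff[of "- complex_of_real R" "of_real R" g]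
      has_contour_integral_integral[OF int(1)] R
    by (auto simp: \<gamma>_def Reals_minus_iff)
  moreover have "set_integrable lborel {-R..R} (\<lambda>x. g (of_real x))"
    by (rule borel_integrable_atLeastAtMost'[OF continuous_on_real_line_of_holomorphic[OF e hol]])
  ultimately show ?thesis
    by (simp add: set_borel_integral_eq_integral(2) integral_unique \<omega>_def)
qed

lemma integral_symmetric_interval_tendsto:
  fixes f :: "real \<Rightarrow> 'a :: {banach, second_countable_topology}"
  assumes f [measurable]: "integrable lborel f"
  shows "(\<lambda>n. LINT x:{- real n..real n}|lborel. f x) \<longlonglongrightarrow> (LINT x|lborel. f x)"
  unfolding set_lebesgue_integral_def
proof (rule integral_dominated_convergence[where w = "\<lambda>x. norm (f x)"])
  show "AE x in lborel. (\<lambda>n. indicator {- real n..real n} x *\<^sub>R f x) \<longlonglongrightarrow> f x"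
  proof (rule AE_I2, rule tendsto_eventually)
    fix x :: real
    obtain N where "\<bar>x\<bar> < real N"
      using reals_Archimedean2 by blast
    then show "\<forall>\<^sub>F n in sequentially. indicator {- real n..real n} x *\<^sub>R f x = f x"
      by (intro eventually_sequentiallyI[of N]) (auto simp: indicator_def)
  qed
qed (use f in \<open>auto simp: indicator_def\<close>)

lemma integral_real_line_eq_0:
  assumes e: "0 < e" and hol: "g holomorphic_on {z. - e < Im z}"
    and int: "integrable lborel (\<lambda>x. g (of_real x))"
    and decay: "\<And>z. 0 \<le> Im z \<Longrightarrow> R0 \<le> cmod z \<Longrightarrow> cmod (g z) \<le> C / (cmod z)\<^sup>2"
  shows "(LINT x|lborel. g (of_real x)) = 0"
proof -
  have bound: "norm (LINT x:{- real n..real n}|lborel. g (of_real x))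
    \<le> \<bar>C\<bar> / (real n)\<^sup>2 * real n * \<bar>pi - 0\<bar>"
    if n: "1 \<le> real n" "R0 \<le> real n" for n
  proof -
    have "cmod (contour_integral (part_circlepath 0 (real n) 0 pi) g)
      \<le> \<bar>C\<bar> / (real n)\<^sup>2 * real n * \<bar>pi - 0\<bar>"
    proof (rule contour_integral_bound_part_circlepath)
      show "g contour_integrable_on part_circlepath 0 (real n) 0 pi"
        using path_image_upper_half_circle(1)[of "real n"] e
        by (intro contour_integrable_continuous_part_circlepath
            continuous_on_subset[OF holomorphic_on_imp_continuous_on[OF hol]]) force
      fix w assume "w \<in> path_image (part_circlepath 0 (real n) 0 pi)"
      then have "cmod (g w) \<le> C / (real n)\<^sup>2"
        using path_image_upper_half_circle[of "real n" w] decay[of w] n by auto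
      also have "\<dots> \<le> \<bar>C\<bar> / (real n)\<^sup>2"
        by (intro divide_right_mono) auto
      finally show "cmod (g w) \<le> \<bar>C\<bar> / (real n)\<^sup>2" .
    qed auto
    then show ?thesis
      using integral_segment_eq_upper_half_circle[OF e hol, of "real n"] n by simp
  qed
  have "(\<lambda>n. LINT x:{- real n..real n}|lborel. g (of_real x)) \<longlonglongrightarrow> 0"
  proof (rule Lim_null_comparison)
    have "\<forall>\<^sub>F n in sequentially. max 1 R0 \<le> real n"
      by (rule eventually_sequentiallyI[of "nat \<lceil>max 1 R0\<rceil>"]) linarith
    then show "\<forall>\<^sub>F n in sequentially. norm (LINT x:{- real n..real n}|lborel. g (of_real x))
        \<le> \<bar>C\<bar> / (real n)\<^sup>2 * real n * \<bar>pi - 0\<bar>"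
      by eventually_elim (rule bound; simp)
    show "(\<lambda>n. \<bar>C\<bar> / (real n)\<^sup>2 * real n * \<bar>pi - 0\<bar>) \<longlonglongrightarrow> 0"
      by real_asymp
  qed
  with integral_symmetric_interval_tendsto[OF int] show ?thesis
    by (rule LIMSEQ_unique)
qed

lemma integrable_real_line_of_decay:
  assumes "0 < e" "G holomorphic_on {z. - e < Im z}"
    and decay: "\<And>z. 0 \<le> Im z \<Longrightarrow> cmod (G z) \<le> C / (1 + (cmod z)\<^sup>2)"
  shows "integrable lborel (\<lambda>s. G (of_real s))"
proof (rule Bochner_Integration.integrable_bound)
  show "integrable lborel (\<lambda>s. C * poisson_kernel 1 (s - 0))"
    using integral_poisson_kernel(1)[of 1 0] by (intro integrable_mult_right) simp
  have "cmod (G (of_real s)) \<le> C * poisson_kernel 1 (s - 0)" for s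
    using decay[of "of_real s"] by (simp add: poisson_kernel_def add.commute)
  then show "AE s in lborel. norm (G (of_real s)) \<le> norm (C * poisson_kernel 1 (s - 0))"
    by (auto intro: order_trans[OF _ abs_ge_self])
  show "(\<lambda>s. G (of_real s)) \<in> borel_measurable lborel"
    using continuous_on_real_line_of_holomorphic[OF assms(1,2), of UNIV]
    by (simp add: borel_measurable_continuous_onI)
qed

text \<open>On the real line the second term of \<open>poisson_defect G p z / (z - p)\<close> is \<open>G p\<close> times a multiple of the
  Poisson kernel. It removes the pole at \<open>p\<close> without destroying the decay.\<close>

definition poisson_defect :: "(complex \<Rightarrow> complex) \<Rightarrow> complex \<Rightarrow> complex \<Rightarrow> complex" where
  "poisson_defect G p z = G z - G p * (p - cnj p) * inverse (z - cnj p)"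

definition pole_remainder :: "(complex \<Rightarrow> complex) \<Rightarrow> complex \<Rightarrow> complex \<Rightarrow> complex" where
  "pole_remainder G p z =
    (if z = p then deriv (poisson_defect G p) p else poisson_defect G p z / (z - p))"

lemma pole_remainder_holomorphic:
  assumes hol: "G holomorphic_on {z. - e < Im z}" and p: "0 < Im p"
  shows "pole_remainder G p holomorphic_on {z. - min e (Im p) < Im z}" (is "_ holomorphic_on ?S")
proof -
  have "z - cnj p \<noteq> 0" if "z \<in> ?S" for z
    using that by auto
  then have defect_hol: "poisson_defect G p holomorphic_on ?S"
    unfolding poisson_defect_def
    by (intro holomorphic_intros holomorphic_on_subset[OF hol]) auto
  have "p - cnj p \<noteq> 0"
    using p by (simp add: complex_eq_iff)
  then have "poisson_defect G p p = 0"
    by (simp add: poisson_defect_def)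
  then show ?thesis
    by (intro pole_theorem_open_0[OF defect_hol open_halfspace_Im_gt, where a = p])
      (auto simp: pole_remainder_def)
qed

lemma pole_remainder_of_real:
  assumes p: "0 < Im p"
  shows "pole_remainder G p (of_real s) = inverse (of_real s - p) * G (of_real s)
    - G p * (2 * \<i> * of_real (poisson_kernel (Im p) (s - Re p)))"
proof -
  have nonzero: "of_real s - p \<noteq> 0" "of_real s - cnj p \<noteq> 0"
    using p of_real_minus_nonreal_neq_0[of p s] of_real_minus_nonreal_neq_0[of "cnj p" s] by auto
  have "pole_remainder G p (of_real s) = poisson_defect G p (of_real s) * inverse (of_real s - p)"
    using nonzero by (simp add: pole_remainder_def divide_inverse)
  also have "\<dots> = inverse (of_real s - p) * G (of_real s)
      - G p * ((p - cnj p) * inverse (of_real s - cnj p) * inverse (of_real s - p))"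
    by (simp add: poisson_defect_def algebra_simps)
  also have "(p - cnj p) * inverse (of_real s - cnj p) * inverse (of_real s - p)
      = inverse (of_real s - p) - inverse (of_real s - cnj p)"
    using nonzero by (simp add: field_simps)
  finally show ?thesis
    by (simp only: poisson_kernel_eq_jump[OF p])
qed

lemma norm_poisson_defect_le:
  assumes G: "cmod (G z) \<le> C / (1 + (cmod z)\<^sup>2)" and C: "0 \<le> C" and z: "2 * cmod p + 1 \<le> cmod z"
  shows "cmod (poisson_defect G p z) \<le> (C + 2 * (cmod (G p) * cmod (p - cnj p))) / cmod z"
proof -
  have z1: "1 \<le> cmod z"
    using z norm_ge_zero[of p] by linarith
  then have "cmod z \<le> 1 + (cmod z)\<^sup>2"
    by (simp add: power2_eq_square add_increasing mult_le_cancel_right1)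
  then have "C / (1 + (cmod z)\<^sup>2) \<le> C / cmod z"
    using C z1 by (intro divide_left_mono mult_pos_pos add_pos_nonneg) auto
  moreover have "cmod z / 2 \<le> cmod (z - cnj p)"
    using norm_triangle_ineq2[of z "cnj p"] z by simp
  then have "cmod (G p) * cmod (p - cnj p) * inverse (cmod (z - cnj p))
      \<le> cmod (G p) * cmod (p - cnj p) * inverse (cmod z / 2)"
    using z1 by (intro mult_left_mono le_imp_inverse_le) auto
  moreover have "cmod (poisson_defect G p z)
      \<le> cmod (G z) + cmod (G p) * cmod (p - cnj p) * inverse (cmod (z - cnj p))"
    unfolding poisson_defect_def
    by (rule order_trans[OF norm_triangle_ineq4]) (simp add: norm_mult norm_inverse)
  ultimately have "cmod (poisson_defect G p z)
    \<le> C / cmod z + cmod (G p) * cmod (p - cnj p) * inverse (cmod z / 2)"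
    using G by linarith
  also have "\<dots> = (C + 2 * (cmod (G p) * cmod (p - cnj p))) / cmod z"
    by (simp add: add_divide_distrib)
  finally show ?thesis .
qed

lemma norm_pole_remainder_le:
  assumes G: "cmod (G z) \<le> C / (1 + (cmod z)\<^sup>2)" and C: "0 \<le> C" and z: "2 * cmod p + 1 \<le> cmod z"
  shows "cmod (pole_remainder G p z) \<le> 2 * (C + 2 * (cmod (G p) * cmod (p - cnj p))) / (cmod z)\<^sup>2"
proof -
  have z1: "1 \<le> cmod z"
    using z norm_ge_zero[of p] by linarith
  have far: "cmod z / 2 \<le> cmod (z - p)"
    using norm_triangle_ineq2[of z p] z by simp
  then have "cmod (pole_remainder G p z) = cmod (poisson_defect G p z) / cmod (z - p)"
    using z1 by (auto simp: pole_remainder_def norm_divide)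
  also have "\<dots> \<le> (C + 2 * (cmod (G p) * cmod (p - cnj p))) / cmod z / (cmod z / 2)"
    using far z1 C norm_poisson_defect_le[of G z C p, OF assms]
    by (intro frac_le divide_nonneg_nonneg add_nonneg_nonneg mult_nonneg_nonneg) auto
  also have "\<dots> = 2 * (C + 2 * (cmod (G p) * cmod (p - cnj p))) / (cmod z)\<^sup>2"
    by (simp add: power2_eq_square)
  finally show ?thesis .
qed

theorem half_plane_Cauchy_formula:
  assumes e: "0 < e" and hol: "G holomorphic_on {z. - e < Im z}"
    and decay: "\<And>z. 0 \<le> Im z \<Longrightarrow> cmod (G z) \<le> C / (1 + (cmod z)\<^sup>2)" and p: "0 < Im p"
  shows "cauchy (\<lambda>s. G (of_real s)) p = 2 * of_real pi * \<i> * G p"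
proof -
  have C: "0 \<le> C"
    using order_trans[OF norm_ge_zero decay[of 0]] by simp
  have int: "integrable lborel (\<lambda>s. inverse (of_real s - p) * G (of_real s))"
    using p by (intro cauchy_integrable integrable_real_line_of_decay[OF e hol decay]) auto
  have poisson: "integrable lborel (\<lambda>s. G p * (2 * \<i> * of_real (poisson_kernel (Im p) (s - Re p))))"
    by (intro integrable_mult_right integrable_of_real integral_poisson_kernel p)
  have "(LINT s|lborel. pole_remainder G p (of_real s)) = 0"
  proof (rule integral_real_line_eq_0[OF _ pole_remainder_holomorphic[OF hol p]])
    show "integrable lborel (\<lambda>s. pole_remainder G p (of_real s))"
      unfolding pole_remainder_of_real[OF p] using int poisson by simp
    show "cmod (pole_remainder G p z) \<le> 2 * (C + 2 * (cmod (G p) * cmod (p - cnj p))) / (cmod z)\<^sup>2"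
      if "0 \<le> Im z" "2 * cmod p + 1 \<le> cmod z" for z
      by (rule norm_pole_remainder_le[of G, OF decay[OF that(1)] C that(2)])
  qed (use e p in auto)
  then have "cauchy (\<lambda>s. G (of_real s)) p
      = (LINT s|lborel. G p * (2 * \<i> * of_real (poisson_kernel (Im p) (s - Re p))))"
    unfolding pole_remainder_of_real[OF p] cauchy_def using int poisson by simp
  also have "\<dots> = G p * (2 * \<i> * of_real pi)"
    by (simp only: integral_mult_right_zero integral_complex_of_real
      integral_poisson_kernel(2)[OF p])
  finally show ?thesis
    by (simp add: ac_simps)
qed

lemma hardy_space_of_analytic_decay:
  assumes e: "0 < e" and hol: "G holomorphic_on {z. - e < Im z}"
    and decay: "\<And>z. 0 \<le> Im z \<Longrightarrow> cmod (G z) \<le> C / (1 + (cmod z)\<^sup>2)"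
  shows "(\<lambda>s. G (of_real s)) \<in> hardy_space"
proof -
  note int = integrable_real_line_of_decay[OF assms]
  have "fourier (\<lambda>s. G (of_real s)) l = 0" if l: "0 \<le> l" for l
  proof -
    have line: "exp (\<i> * of_real s * of_real l) * G (of_real s) = Mop l (\<lambda>s. G (of_real s)) s" for s
      by (simp add: Mop_def mult.commute mult.left_commute)
    have "(LINT s|lborel. exp (\<i> * of_real s * of_real l) * G (of_real s)) = 0"
    proof (rule integral_real_line_eq_0[OF e])
      show "(\<lambda>z. exp (\<i> * z * of_real l) * G z) holomorphic_on {z. - e < Im z}"
        using hol by (intro holomorphic_intros)
      show "integrable lborel (\<lambda>s. exp (\<i> * of_real s * of_real l) * G (of_real s))"
        unfolding line by (rule Mop_integrable[OF int])
      fix z assume z: "0 \<le> Im z" "1 \<le> cmod z"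
      have "0 \<le> C"
        using order_trans[OF norm_ge_zero decay[of 0]] by simp
      then have "C / (1 + (cmod z)\<^sup>2) \<le> C / (cmod z)\<^sup>2"
        using z(2) by (intro divide_left_mono) (auto intro!: mult_pos_pos add_pos_nonneg)
      moreover have "cmod (exp (\<i> * z * of_real l)) \<le> 1"
        unfolding norm_exp_i_mult_of_real using z(1) l by simp
      then have "cmod (exp (\<i> * z * of_real l) * G z) \<le> 1 * (C / (1 + (cmod z)\<^sup>2))"
        unfolding norm_mult by (intro mult_mono decay z(1)) auto
      ultimately show "cmod (exp (\<i> * z * of_real l) * G z) \<le> C / (cmod z)\<^sup>2"
        by simp
    qed
    then show ?thesis
      unfolding line by (simp add: fourier_def Mop_eq_cis)
  qed
  then show ?thesis
    using int by (simp add: hardy_space_def)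
qed


section \<open>Bounded analytic functions annihilate the Hardy space\<close>

lemma integral_analytic_mult_hardy_space_eq_0:
  assumes e: "0 < e" and hol: "G holomorphic_on {z. - e < Im z}"
    and decay: "\<And>z. 0 \<le> Im z \<Longrightarrow> cmod (G z) \<le> C / (1 + (cmod z)\<^sup>2)"
    and \<phi>: "\<phi> \<in> hardy_space" and d: "0 < d"
  shows "(LINT t|lborel. G (Complex t d) * \<phi> t) = 0"
proof -
  have swap: "inverse (of_real s - Complex t d) = - inverse (of_real t - Complex s (- d))" for s t
  proof -
    have "of_real s - Complex t d = - (of_real t - Complex s (- d))"
      by (simp add: complex_eq_iff)
    then show ?thesis
      by (simp only: inverse_minus_eq)
  qed
  have "(LINT s|lborel. G (of_real s) * (LINT t|lborel. inverse (of_real s - Complex t d) * \<phi> t))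
      = (LINT t|lborel. (LINT s|lborel. G (of_real s) * inverse (of_real s - Complex t d)) * \<phi> t)"
  proof (rule lborel_pair.Fubini_bounded_kernel[where C = "1 / d"])
    show "cmod (inverse (of_real s - Complex t d)) \<le> 1 / d" for s t
      using norm_inverse_of_real_minus_le[of "Complex t d" s] d by simp
    have "(\<lambda>(s, t). inverse (complex_of_real s - (of_real t + \<i> * of_real d)))
        \<in> borel_measurable (borel \<Otimes>\<^sub>M borel)"
      by measurable
    then show "(\<lambda>(s, t). inverse (complex_of_real s - Complex t d))
      \<in> borel_measurable (lborel \<Otimes>\<^sub>M lborel)"
      by (simp add: Complex_eq)
  qed (use integrable_real_line_of_decay[OF e hol decay] hardy_spaceD(1)[OF \<phi>] in auto)
  moreover have "(LINT t|lborel. inverse (of_real s - Complex t d) * \<phi> t) = 0" for s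
    using cauchy_hardy_space_lower[OF \<phi>, of "Complex s (- d)"] d by (simp add: swap cauchy_def)
  moreover have "(LINT s|lborel. G (of_real s) * inverse (of_real s - Complex t d))
      = 2 * of_real pi * \<i> * G (Complex t d)" for t
    using half_plane_Cauchy_formula[OF e hol decay, of "Complex t d"] d
    by (simp add: cauchy_def mult.commute)
  ultimately have "(LINT t|lborel. (2 * of_real pi * \<i>) * (G (Complex t d) * \<phi> t)) = 0"
    by (simp only: mult.assoc) simp
  then show ?thesis
    by (simp only: integral_mult_right_zero) simp
qed

definition damping :: "real \<Rightarrow> complex \<Rightarrow> complex" where
  "damping d z = (inverse (1 - \<i> * of_real d * z))\<^sup>2"

lemma norm_damping_le:
  assumes d: "0 < d" "d \<le> 1" and z: "0 \<le> Im z"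
  shows "cmod (damping d z) \<le> 1" "cmod (damping d z) \<le> 1 / (d\<^sup>2 * (1 + (cmod z)\<^sup>2))"
proof -
  define N where "N = (cmod (1 - \<i> * of_real d * z))\<^sup>2"
  have N: "N = 1 + 2 * d * Im z + d\<^sup>2 * (cmod z)\<^sup>2"
    unfolding N_def cmod_power2 by (simp add: power2_eq_square algebra_simps)
  have "0 \<le> 2 * d * Im z" "0 \<le> d\<^sup>2 * (cmod z)\<^sup>2" "d\<^sup>2 \<le> 1" "0 < d\<^sup>2"
    using d z by (auto simp: power_le_one)
  then have "1 \<le> N" "d\<^sup>2 * (1 + (cmod z)\<^sup>2) \<le> N" "0 < d\<^sup>2 * (1 + (cmod z)\<^sup>2)"
    unfolding N by (auto simp: distrib_left add_pos_nonneg)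
  moreover have "cmod (damping d z) = 1 / N"
    by (simp add: damping_def N_def norm_power norm_inverse power_inverse divide_inverse)
  ultimately show "cmod (damping d z) \<le> 1" "cmod (damping d z) \<le> 1 / (d\<^sup>2 * (1 + (cmod z)\<^sup>2))"
    by (auto intro: frac_le)
qed

lemma damping_holomorphic:
  assumes d: "0 < d" "d \<le> 1"
  shows "damping d holomorphic_on {z. - d < Im z}"
proof -
  have "1 - \<i> * of_real d * z \<noteq> 0" if "- d < Im z" for z
  proof -
    have "d * (- d) < d * Im z"
      using that d by (intro mult_strict_left_mono) auto
    moreover have "d * d \<le> 1"
      using d by (simp add: mult_le_one)
    ultimately have "0 < Re (1 - \<i> * of_real d * z)"
      by simp
    then show ?thesis by force
  qed
  then show ?thesis
    unfolding damping_def by (intro holomorphic_intros) auto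
qed

definition damped_translate :: "(complex \<Rightarrow> complex) \<Rightarrow> real \<Rightarrow> fn" where
  "damped_translate F d t = damping d (Complex t d) * F (Complex t (2 * d))"

lemma norm_damped_translate_le:
  assumes "\<And>z. 0 < Im z \<Longrightarrow> cmod (F z) \<le> B" "0 < d" "d \<le> 1"
  shows "cmod (damped_translate F d t) \<le> B"
proof -
  have "cmod (damped_translate F d t) \<le> 1 * B"
    unfolding damped_translate_def norm_mult using assms by (intro mult_mono norm_damping_le) auto
  then show ?thesis by simp
qed

lemma damped_translate_measurable:
  assumes "F holomorphic_on {z. 0 < Im z}" and d: "0 < d" "d \<le> 1"
  shows "damped_translate F d \<in> borel_measurable borel"
proof -
  have "continuous_on UNIV (\<lambda>t. damping d (Complex t d))"
    by (rule continuous_on_compose2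
        [OF holomorphic_on_imp_continuous_on[OF damping_holomorphic[OF d]]])
      (use d in \<open>auto intro!: continuous_intros\<close>)
  moreover have "continuous_on UNIV (\<lambda>t. F (Complex t (2 * d)))"
    by (rule continuous_on_compose2[OF holomorphic_on_imp_continuous_on[OF assms(1)]])
      (use d in \<open>auto intro!: continuous_intros\<close>)
  ultimately show ?thesis
    unfolding damped_translate_def[abs_def]
    by (intro borel_measurable_continuous_onI continuous_intros)
qed

lemma damped_translate_tendsto:
  assumes "((\<lambda>y. F (Complex x y)) \<longlongrightarrow> a) (at_right 0)"
  shows "((\<lambda>d. damped_translate F d x) \<longlongrightarrow> a) (at_right 0)"
proof -
  have "((\<lambda>d. damping d (Complex x d))
    \<longlongrightarrow> (inverse (1 - \<i> * of_real 0 * Complex x 0))\<^sup>2) (at_right 0)"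
    unfolding damping_def by (intro tendsto_intros) simp
  moreover have "filterlim (\<lambda>d::real. 2 * d) (at_right 0) (at_right 0)"
    by real_asymp
  then have "((\<lambda>d. F (Complex x (2 * d))) \<longlongrightarrow> a) (at_right 0)"
    by (rule filterlim_compose[OF assms])
  ultimately have "((\<lambda>d. damped_translate F d x)
    \<longlongrightarrow> (inverse (1 - \<i> * of_real 0 * Complex x 0))\<^sup>2 * a) (at_right 0)"
    unfolding damped_translate_def by (rule tendsto_mult)
  then show ?thesis by simp
qed

lemma integral_damped_translate_mult_hardy_space_eq_0:
  assumes hol: "F holomorphic_on {z. 0 < Im z}" and bound: "\<And>z. 0 < Im z \<Longrightarrow> cmod (F z) \<le> B"
    and \<phi>: "\<phi> \<in> hardy_space" and d: "0 < d" "d \<le> 1"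
  shows "(LINT t|lborel. damped_translate F d t * \<phi> t) = 0"
proof -
  define G where "G = (\<lambda>z. damping d z * F (z + \<i> * of_real d))"
  have "(LINT t|lborel. G (Complex t d) * \<phi> t) = 0"
  proof (rule integral_analytic_mult_hardy_space_eq_0[OF d(1) _ _ \<phi> d(1)])
    have "(\<lambda>z. F (z + \<i> * of_real d)) holomorphic_on {z. - d < Im z}"
      by (rule holomorphic_on_compose_gen[OF _ hol, unfolded o_def])
        (auto intro!: holomorphic_intros)
    then show "G holomorphic_on {z. - d < Im z}"
      unfolding G_def by (intro holomorphic_intros damping_holomorphic d)
    fix z assume "0 \<le> Im z"
    then have "cmod (G z) \<le> 1 / (d\<^sup>2 * (1 + (cmod z)\<^sup>2)) * B"
      unfolding G_def norm_mult using d by (intro mult_mono norm_damping_le bound) auto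
    then show "cmod (G z) \<le> (B / d\<^sup>2) / (1 + (cmod z)\<^sup>2)"
      by simp
  qed
  moreover have "Complex t d + \<i> * of_real d = Complex t (2 * d)" for t
    by (simp add: complex_eq_iff)
  ultimately show ?thesis
    by (simp add: G_def damped_translate_def)
qed

lemma HinfE:
  assumes "h \<in> Hinf"
  obtains F B where "F holomorphic_on {z. 0 < Im z}" "\<And>z. 0 < Im z \<Longrightarrow> cmod (F z) \<le> B"
    "AE x in lborel. ((\<lambda>y. F (Complex x y)) \<longlongrightarrow> h x) (at_right 0)"
  using assms by (auto simp: Hinf_def bounded_iff)

lemma Hinf_measurable: "h \<in> Hinf \<Longrightarrow> h \<in> borel_measurable lborel"
  by (simp add: Hinf_def)

lemma Hinf_AE_bounded:
  assumes "h \<in> Hinf"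
  obtains B where "AE x in lborel. cmod (h x) \<le> B"
proof -
  obtain F B where "F holomorphic_on {z. 0 < Im z}" and bound: "\<And>z. 0 < Im z \<Longrightarrow> cmod (F z) \<le> B"
    and lim: "AE x in lborel. ((\<lambda>y. F (Complex x y)) \<longlongrightarrow> h x) (at_right 0)"
    using HinfE[OF assms] by blast
  have "\<forall>\<^sub>F y in at_right 0. cmod (F (Complex x y)) \<le> B" for x
    using eventually_at_right_less by eventually_elim (simp add: bound)
  then have "cmod (h x) \<le> B" if "((\<lambda>y. F (Complex x y)) \<longlongrightarrow> h x) (at_right 0)" for x
    using tendsto_upperbound[OF tendsto_norm[OF that]] by simp
  with lim have "AE x in lborel. cmod (h x) \<le> B"
    by (rule eventually_mono)
  then show thesis
    by (rule that)
qed

theorem integral_Hinf_mult_hardy_space_eq_0: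
  assumes \<phi>: "\<phi> \<in> hardy_space" and h: "h \<in> Hinf"
  shows "(LINT x|lborel. h x * \<phi> x) = 0"
proof -
  obtain F B where hol: "F holomorphic_on {z. 0 < Im z}" and bound: "\<And>z. 0 < Im z \<Longrightarrow> cmod (F z) \<le> B"
    and lim: "AE x in lborel. ((\<lambda>y. F (Complex x y)) \<longlongrightarrow> h x) (at_right 0)"
    using HinfE[OF h] by blast
  have [measurable]: "\<phi> \<in> borel_measurable borel" "h \<in> borel_measurable borel"
    using hardy_spaceD(1)[OF \<phi>] Hinf_measurable[OF h] by auto
  define d where "d n = 1 / real (Suc n)" for n
  have d: "0 < d n" "d n \<le> 1" for n
    by (auto simp: d_def)
  have d_lim: "filterlim d (at_right 0) sequentially"
    unfolding d_def by real_asymp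
  have [measurable]: "damped_translate F (d n) \<in> borel_measurable borel" for n
    by (rule damped_translate_measurable[OF hol d])
  have "(\<lambda>n. LINT t|lborel. damped_translate F (d n) t * \<phi> t) \<longlonglongrightarrow> (LINT x|lborel. h x * \<phi> x)"
  proof (rule integral_dominated_convergence[where w = "\<lambda>x. B * cmod (\<phi> x)"])
    show "integrable lborel (\<lambda>x. B * cmod (\<phi> x))"
      using hardy_spaceD(1)[OF \<phi>] by simp
    show "AE x in lborel. norm (damped_translate F (d n) x * \<phi> x) \<le> B * cmod (\<phi> x)" for n
      unfolding norm_mult by (intro AE_I2 mult_right_mono norm_damped_translate_le[OF bound d]) auto
    show "AE x in lborel. (\<lambda>n. damped_translate F (d n) x * \<phi> x) \<longlonglongrightarrow> h x * \<phi> x"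
      using lim
      by eventually_elim (intro tendsto_intros filterlim_compose[OF damped_translate_tendsto d_lim])
  qed simp_all
  moreover have "(LINT t|lborel. damped_translate F (d n) t * \<phi> t) = 0" for n
    by (rule integral_damped_translate_mult_hardy_space_eq_0[OF hol bound \<phi> d])
  ultimately show ?thesis
    by (simp add: LIMSEQ_const_iff)
qed


section \<open>Beurling's argument\<close>

lemma closed_subspace_orthogonal_complement:
  assumes G: "G \<subseteq> L2"
  shows "closed_subspace (orthogonal_complement G)"
  unfolding closed_subspace_def
proof (intro conjI allI impI ballI)
  let ?K = "orthogonal_complement G"
  have mem_iff: "f \<in> ?K \<longleftrightarrow> f \<in> L2 \<and> (\<forall>g\<in>G. inner2 f g = 0)" for f
    using inner2_commute[of f] by (auto simp: orthogonal_complement_def)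
  show "?K \<subseteq> L2" "(\<lambda>x. 0) \<in> ?K"
    by (auto simp: orthogonal_complement_def)
  show "(\<lambda>x. a * f x + b * g x) \<in> ?K" if "f \<in> ?K" "g \<in> ?K" for f g a b
    using that G by (auto simp: mem_iff subset_iff inner2_lincomb_left intro: L2_lincomb)
  show "g \<in> ?K" if "f \<in> ?K" "g \<in> L2" "aeq f g" for f g
    using that G inner2_cong_AE[OF _ _ _ \<open>aeq f g\<close>] by (metis mem_iff subsetD)
  show "f \<in> ?K" if s: "\<forall>n. s n \<in> ?K" and f: "f \<in> L2" and lim: "(\<lambda>n. dist2 (s n) f) \<longlonglongrightarrow> 0" for s f
  proof -
    have "(\<lambda>n. inner2 (s n) g) \<longlonglongrightarrow> inner2 f g" if "g \<in> G" for g
      using that s G by (intro inner2_tendsto f lim) (auto simp: mem_iff)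
    then show ?thesis
      using s f by (auto simp: mem_iff LIMSEQ_const_iff)
  qed
qed

lemma closed_subspace_unimodular_preimage:
  assumes K: "closed_subspace K" and u: "u \<in> borel_measurable lborel" "\<And>x. cmod (u x) = 1"
  shows "closed_subspace {f \<in> L2. (\<lambda>x. u x * f x) \<in> K}" (is "closed_subspace ?P")
  unfolding closed_subspace_def
proof (intro conjI allI impI ballI)
  have uL: "(\<lambda>x. u x * f x) \<in> L2" if "f \<in> L2" for f
    using that u by (intro L2_bounded_mult[where C = 1]) auto
  show "?P \<subseteq> L2" "(\<lambda>x. 0) \<in> ?P"
    using closed_subspaceD(2)[OF K] by auto
  show "(\<lambda>x. a * f x + b * g x) \<in> ?P" if "f \<in> ?P" "g \<in> ?P" for f g a b
    using that closed_subspaceD(3)[OF K, of "\<lambda>x. u x * f x" "\<lambda>x. u x * g x" a b]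
    by (auto simp: algebra_simps intro: L2_lincomb)
  show "g \<in> ?P" if f: "f \<in> ?P" and g: "g \<in> L2" "aeq f g" for f g
  proof -
    have "aeq (\<lambda>x. u x * f x) (\<lambda>x. u x * g x)"
      using g(2) unfolding aeq_def by eventually_elim simp
    then show ?thesis
      using f g closed_subspaceD(4)[OF K _ uL[OF g(1)]] by auto
  qed
  show "f \<in> ?P" if s: "\<forall>n. s n \<in> ?P" and f: "f \<in> L2" and lim: "(\<lambda>n. dist2 (s n) f) \<longlonglongrightarrow> 0" for s f
  proof -
    have "dist2 (\<lambda>x. u x * s n x) (\<lambda>x. u x * f x) = dist2 (s n) f" for n
      using norm2_unimodular_mult[of u "\<lambda>x. s n x - f x", OF u(2)] by (simp add: right_diff_distrib)
    then have "(\<lambda>n. dist2 (\<lambda>x. u x * s n x) (\<lambda>x. u x * f x)) \<longlonglongrightarrow> 0"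
      using lim by simp
    then have "(\<lambda>x. u x * f x) \<in> K"
      using s by (intro closed_subspaceD(5)[OF K _ uL[OF f]]) auto
    then show ?thesis
      using f by simp
  qed
qed

lemma L2_resolvent: "f \<in> L2 \<Longrightarrow> Im w \<noteq> 0 \<Longrightarrow> (\<lambda>x. inverse (of_real x - w) * f x) \<in> L2"
  using norm_inverse_of_real_minus_le[of w] by (intro L2_bounded_mult) auto

definition blaschke :: "complex \<Rightarrow> real \<Rightarrow> complex" where
  "blaschke z x = (of_real x - z) * inverse (of_real x - cnj z)"

lemma borel_measurable_blaschke: "blaschke z \<in> borel_measurable lborel"
  unfolding blaschke_def by simp

lemma norm_blaschke: "Im z \<noteq> 0 \<Longrightarrow> cmod (blaschke z x) = 1"
  using complex_mod_cnj[of "of_real x - z"] of_real_minus_nonreal_neq_0[of z x]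
  by (simp add: blaschke_def norm_mult norm_inverse)

lemma blaschke_mult_cnj:
  assumes "Im z \<noteq> 0"
  shows "blaschke z x * (blaschke (cnj z) x * a) = a"
proof -
  have "u * inverse v * (v * inverse u * a) = a" if "u \<noteq> 0" "v \<noteq> 0" for u v :: complex
    using that by (simp add: field_simps)
  then show ?thesis
    using of_real_minus_nonreal_neq_0[of z x] of_real_minus_nonreal_neq_0[of "cnj z" x] assms
    by (simp add: blaschke_def)
qed

locale resolvent_invariant_subspace =
  fixes K :: "fn set"
  assumes closed: "closed_subspace K"
    and resolvent_mem: "h \<in> K \<Longrightarrow> Im w < 0 \<Longrightarrow> (\<lambda>x. inverse (of_real x - w) * h x) \<in> K"
begin

lemma moebius_mult_eq:
  assumes "Im w < 0"
  shows "(\<lambda>x. (of_real x - v) * inverse (of_real x - w) * h x)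
    = (\<lambda>x. 1 * h x + (w - v) * (inverse (of_real x - w) * h x))"
proof
  fix x
  have "(of_real x - v) * inverse (of_real x - w) = 1 + (w - v) * inverse (of_real x - w)"
    using of_real_minus_nonreal_neq_0[of w x] assms by (simp add: field_simps)
  then show "(of_real x - v) * inverse (of_real x - w) * h x
      = 1 * h x + (w - v) * (inverse (of_real x - w) * h x)"
    by (simp only:) (simp add: algebra_simps)
qed

lemma moebius_mult_mem:
  assumes "h \<in> K" "Im w < 0"
  shows "(\<lambda>x. (of_real x - v) * inverse (of_real x - w) * h x) \<in> K"
  unfolding moebius_mult_eq[OF assms(2)]
  by (intro closed_subspaceD(3)[OF closed] assms resolvent_mem)

definition blaschke_multiples :: "complex \<Rightarrow> fn set" where
  "blaschke_multiples z = {f \<in> L2. (\<lambda>x. blaschke (cnj z) x * f x) \<in> K}"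

lemma closed_subspace_blaschke_multiples:
  "Im z \<noteq> 0 \<Longrightarrow> closed_subspace (blaschke_multiples z)"
  unfolding blaschke_multiples_def
  by (intro closed_subspace_unimodular_preimage closed borel_measurable_blaschke norm_blaschke) simp

lemma blaschke_multiples_subset:
  assumes "0 < Im z"
  shows "blaschke_multiples z \<subseteq> K"
proof
  fix f assume "f \<in> blaschke_multiples z"
  then have "(\<lambda>x. (of_real x - z) * inverse (of_real x - cnj z) * (blaschke (cnj z) x * f x)) \<in> K"
    using assms by (intro moebius_mult_mem) (auto simp: blaschke_multiples_def)
  then show "f \<in> K"
    using assms by (simp add: blaschke_mult_cnj flip: blaschke_def)
qed

definition wandering_subspace :: "complex \<Rightarrow> fn set" where
  "wandering_subspace z = K \<inter> orthogonal_complement (blaschke_multiples z)"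

lemma wandering_subspaceD:
  assumes "e \<in> wandering_subspace z"
  shows "e \<in> K" "e \<in> L2" "\<And>h. h \<in> blaschke_multiples z \<Longrightarrow> inner2 h e = 0"
  using assms by (auto simp: wandering_subspace_def dest: orthogonal_complementD)

lemma wandering_decomposition:
  assumes z: "0 < Im z" and g: "g \<in> K"
  obtains e where "e \<in> wandering_subspace z" "(\<lambda>x. g x - e x) \<in> blaschke_multiples z"
proof -
  obtain k where k: "k \<in> blaschke_multiples z"
      "(\<lambda>x. g x - k x) \<in> orthogonal_complement (blaschke_multiples z)"
    using orthogonal_projection
      [OF closed_subspace_blaschke_multiples closed_subspaceD(1)[OF closed g]] z
    by (metis less_irrefl)
  have "(\<lambda>x. 1 * g x + (- 1) * k x) \<in> K"
    using k(1) blaschke_multiples_subset[OF z] by (intro closed_subspaceD(3)[OF closed] g) auto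
  then show thesis
    using that[of "\<lambda>x. g x - k x"] k by (simp add: wandering_subspace_def)
qed

lemma cauchy_wandering_lower:
  assumes z: "0 < Im z" and e: "e \<in> wandering_subspace z" "e' \<in> wandering_subspace z"
    and w: "Im w < 0"
  shows "cauchy (\<lambda>x. e x * cnj (e' x)) w = inner2 e e' * inverse (z - w)"
proof -
  define h where "h = (\<lambda>x. (of_real x - z) * inverse (of_real x - w) * e x)"
  have "h \<in> K"
    unfolding h_def by (intro moebius_mult_mem wandering_subspaceD(1)[OF e(1)] w)
  moreover have "(\<lambda>x. blaschke (cnj z) x * h x)
    = (\<lambda>x. (of_real x - cnj z) * inverse (of_real x - w) * e x)"
    using of_real_minus_nonreal_neq_0[of z] z by (auto simp: blaschke_def h_def)
  then have "(\<lambda>x. blaschke (cnj z) x * h x) \<in> K"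
    using moebius_mult_mem[OF wandering_subspaceD(1)[OF e(1)] w] by simp
  ultimately have "h \<in> blaschke_multiples z"
    by (simp add: blaschke_multiples_def closed_subspaceD(1)[OF closed])
  then have "0 = inner2 h e'"
    using wandering_subspaceD(3)[OF e(2)] by simp
  also have "\<dots> = 1 * inner2 e e' + (w - z) * inner2 (\<lambda>x. inverse (of_real x - w) * e x) e'"
    unfolding h_def moebius_mult_eq[OF w]
    using e w by (intro inner2_lincomb_left L2_resolvent wandering_subspaceD(2)) auto
  also have "inner2 (\<lambda>x. inverse (of_real x - w) * e x) e' = cauchy (\<lambda>x. e x * cnj (e' x)) w"
    by (simp add: inner2_def cauchy_def mult.assoc)
  finally have "(z - w) * cauchy (\<lambda>x. e x * cnj (e' x)) w = inner2 e e'"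
    by (simp add: algebra_simps)
  moreover have "z - w \<noteq> 0"
    using z w by (auto simp: complex_eq_iff)
  ultimately show ?thesis
    by (simp add: field_simps)
qed

lemma cauchy_wandering_upper:
  assumes z: "0 < Im z" and e: "e \<in> wandering_subspace z" "e' \<in> wandering_subspace z"
    and w: "0 < Im w"
  shows "cauchy (\<lambda>x. e x * cnj (e' x)) w = inner2 e e' * inverse (cnj z - w)"
proof -
  have "cauchy (\<lambda>x. e x * cnj (e' x)) w = cauchy (\<lambda>x. cnj (e' x * cnj (e x))) w"
    by (simp add: mult.commute)
  also have "\<dots> = cnj (inner2 e' e * inverse (z - cnj w))"
    unfolding cauchy_cnj using cauchy_wandering_lower[OF z e(2,1), of "cnj w"] w by simp
  also have "\<dots> = inner2 e e' * inverse (cnj z - w)"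
    using inner2_commute[of e e'] by simp
  finally show ?thesis .
qed

lemma wandering_products_proportional:
  assumes z: "0 < Im z"
    and e: "e \<in> wandering_subspace z" "e' \<in> wandering_subspace z"
    and d: "d \<in> wandering_subspace z" "d' \<in> wandering_subspace z"
  shows "AE x in lborel. inner2 d d' * (e x * cnj (e' x)) = inner2 e e' * (d x * cnj (d' x))"
proof -
  define a where "a = inner2 d d'"
  define b where "b = - inner2 e e'"
  have int: "integrable lborel (\<lambda>x. e x * cnj (e' x))" "integrable lborel (\<lambda>x. d x * cnj (d' x))"
    using e d by (auto intro: L2_integrable_inner wandering_subspaceD(2))
  have "AE x in lborel. a * (e x * cnj (e' x)) + b * (d x * cnj (d' x)) = 0"
  proof (rule AE_eq_0_of_cauchy_eq_0)
    show "integrable lborel (\<lambda>x. a * (e x * cnj (e' x)) + b * (d x * cnj (d' x)))"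
      using int by simp
    fix w assume w: "Im w \<noteq> 0"
    then consider "Im w < 0" | "0 < Im w"
      by linarith
    then have "a * cauchy (\<lambda>x. e x * cnj (e' x)) w + b * cauchy (\<lambda>x. d x * cnj (d' x)) w = 0"
      by cases (simp_all add: cauchy_wandering_lower[OF z]
        cauchy_wandering_upper[OF z] e d a_def b_def)
    then show "cauchy (\<lambda>x. a * (e x * cnj (e' x)) + b * (d x * cnj (d' x))) w = 0"
      by (simp only: cauchy_lincomb[OF int w])
  qed
  then show ?thesis
    by eventually_elim (simp add: a_def b_def)
qed

lemma wandering_subspace_dim_le_1:
  assumes z: "0 < Im z" and e: "e \<in> wandering_subspace z" "d \<in> wandering_subspace z"
  shows "AE x in lborel. inner2 e e * d x = inner2 d e * e x"
proof (cases "norm2 e = 0")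
  case True
  then have "AE x in lborel. e x = 0"
    using norm2_eq_0_iff wandering_subspaceD(2)[OF e(1)] by blast
  then show ?thesis
    by eventually_elim (simp add: inner2_self True)
next
  case False
  then have nonzero: "inner2 e e \<noteq> 0"
    by (simp add: inner2_self)
  show ?thesis
    using wandering_products_proportional[OF z e(2,1) e(1,1)]
      wandering_products_proportional[OF z e(2,2) e(1,1)]
  proof eventually_elim
    case (elim x)
    show ?case
    proof (cases "e x = 0")
      case True
      then show ?thesis
        using elim(2) nonzero by simp
    next
      case False
      then show ?thesis
        using elim(1) by simp
    qed
  qed
qed

lemma cauchy_wandering_proportional:
  assumes z: "0 < Im z" and e: "e \<in> wandering_subspace z" "d \<in> wandering_subspace z" and \<psi>: "\<psi> \<in> L2"
  shows "inner2 e e * cauchy (\<lambda>x. d x * cnj (\<psi> x)) w = inner2 d e * cauchy (\<lambda>x. e x * cnj (\<psi> x)) w"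
proof -
  have "AE x in lborel. inner2 e e * (d x * cnj (\<psi> x)) = inner2 d e * (e x * cnj (\<psi> x))"
    using wandering_subspace_dim_le_1[OF z e] by eventually_elim (simp flip: mult.assoc)
  then show ?thesis
    unfolding cauchy_scale[symmetric]
    by (intro cauchy_cong_AE integrable_mult_right L2_integrable_inner
        wandering_subspaceD(2)[OF e(1)]
        wandering_subspaceD(2)[OF e(2)] \<psi>)
qed

lemma wandering_null_cauchy_eq_0:
  assumes e: "e \<in> wandering_subspace z" "inner2 e e = 0" and \<psi>: "\<psi> \<in> L2"
  shows "cauchy (\<lambda>x. e x * cnj (\<psi> x)) w = 0"
proof -
  note L = wandering_subspaceD(2)[OF e(1)]
  have "AE x in lborel. e x = 0"
    using e(2) norm2_eq_0_iff[OF L] by (simp add: inner2_self)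
  then have "AE x in lborel. e x * cnj (\<psi> x) = 0"
    by eventually_elim simp
  then have "cauchy (\<lambda>x. e x * cnj (\<psi> x)) w = cauchy (\<lambda>x. 0) w"
    by (intro cauchy_cong_AE L2_integrable_inner L \<psi>) auto
  then show ?thesis
    by (simp add: cauchy_def)
qed

end

definition hardy_annihilator :: "fn set \<Rightarrow> fn set" where
  "hardy_annihilator \<Psi> = {h \<in> L2. \<forall>\<psi>\<in>\<Psi>. (\<lambda>x. h x * cnj (\<psi> x)) \<in> hardy_space}"

lemma hardy_annihilatorD:
  "h \<in> hardy_annihilator \<Psi> \<Longrightarrow> h \<in> L2"
  "h \<in> hardy_annihilator \<Psi> \<Longrightarrow> \<psi> \<in> \<Psi> \<Longrightarrow> (\<lambda>x. h x * cnj (\<psi> x)) \<in> hardy_space"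
  by (auto simp: hardy_annihilator_def)

lemma L2_Mop: "f \<in> L2 \<Longrightarrow> Mop l f \<in> L2"
  unfolding Mop_eq_cis by (rule L2_bounded_mult[where C = 1]) auto

lemma inner2_Mop_adjoint: "inner2 (Mop l f) g = inner2 f (Mop (- l) g)"
  by (simp add: inner2_def Mop_eq_cis cis_cnj mult.left_commute mult.commute)

lemma hardy_annihilator_eq_orthogonal_complement:
  assumes "\<Psi> \<subseteq> L2"
  shows "hardy_annihilator \<Psi> = orthogonal_complement {Mop (- l) \<psi> | l \<psi>. 0 \<le> l \<and> \<psi> \<in> \<Psi>}"
proof -
  have "(\<lambda>x. h x * cnj (\<psi> x)) \<in> hardy_space \<longleftrightarrow> (\<forall>l\<ge>0. inner2 (Mop (- l) \<psi>) h = 0)"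
    if "h \<in> L2" "\<psi> \<in> \<Psi>" for h \<psi>
    using that assms L2_integrable_inner[of h \<psi>] inner2_commute[of h]
    by (auto simp: hardy_space_def inner2_Mop_adjoint simp flip: inner2_Mop)
  then show ?thesis
    unfolding hardy_annihilator_def orthogonal_complement_def by blast
qed

lemma hardy_annihilator_resolvent_invariant:
  assumes \<Psi>: "\<Psi> \<subseteq> L2"
  shows "resolvent_invariant_subspace (hardy_annihilator \<Psi>)"
proof
  show "closed_subspace (hardy_annihilator \<Psi>)"
    unfolding hardy_annihilator_eq_orthogonal_complement[OF \<Psi>]
    using \<Psi> by (intro closed_subspace_orthogonal_complement) (auto intro: L2_Mop)
  show "(\<lambda>x. inverse (of_real x - w) * h x) \<in> hardy_annihilator \<Psi>"
    if "h \<in> hardy_annihilator \<Psi>" "Im w < 0" for h w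
    using that hardy_space_resolvent
    by (auto simp: hardy_annihilator_def mult.assoc intro: L2_resolvent)
qed

lemma cauchy_cong_wandering:
  assumes \<Psi>: "\<Psi> \<subseteq> L2" "\<psi> \<in> \<Psi>" and z: "0 < Im z" and L: "g \<in> L2" "e \<in> L2"
    and diff: "(\<lambda>x. g x - e x)
      \<in> resolvent_invariant_subspace.blaschke_multiples (hardy_annihilator \<Psi>) z"
  shows "cauchy (\<lambda>x. g x * cnj (\<psi> x)) z = cauchy (\<lambda>x. e x * cnj (\<psi> x)) z"
proof -
  interpret resolvent_invariant_subspace "hardy_annihilator \<Psi>"
    by (rule hardy_annihilator_resolvent_invariant[OF \<Psi>(1)])
  have \<psi>: "\<psi> \<in> L2"
    using \<Psi> by blast
  have "inverse (of_real x - cnj z) * blaschke (cnj z) x = inverse (of_real x - z)" for x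
    using of_real_minus_nonreal_neq_0[of "cnj z" x] z by (simp add: blaschke_def)
  then have "cauchy (\<lambda>x. (g x - e x) * cnj (\<psi> x)) z
      = cauchy (\<lambda>x. (blaschke (cnj z) x * (g x - e x)) * cnj (\<psi> x)) (cnj z)"
    by (simp add: cauchy_def flip: mult.assoc)
  also have "\<dots> = 0"
    using diff z by (intro cauchy_hardy_space_lower hardy_annihilatorD(2)[OF _ \<Psi>(2)])
      (auto simp: blaschke_multiples_def)
  finally have "cauchy (\<lambda>x. 1 * (g x * cnj (\<psi> x)) + (- 1) * (e x * cnj (\<psi> x))) z = 0"
    by (simp add: left_diff_distrib)
  moreover have "cauchy (\<lambda>x. 1 * (g x * cnj (\<psi> x)) + (- 1) * (e x * cnj (\<psi> x))) z
      = 1 * cauchy (\<lambda>x. g x * cnj (\<psi> x)) z + (- 1) * cauchy (\<lambda>x. e x * cnj (\<psi> x)) z"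
    using z by (intro cauchy_lincomb L2_integrable_inner L \<psi>) auto
  ultimately show ?thesis by simp
qed

text \<open>The matrix of Cauchy integrals has rank one because \<open>g\<^sub>1\<close> and \<open>g\<^sub>2\<close> may be replaced by their
  components in the wandering subspace, which is at most one-dimensional.\<close>

theorem cauchy_hardy_annihilator_rank_1:
  assumes \<Psi>: "\<Psi> \<subseteq> L2" "\<psi>\<^sub>1 \<in> \<Psi>" "\<psi>\<^sub>2 \<in> \<Psi>"
    and g: "g\<^sub>1 \<in> hardy_annihilator \<Psi>" "g\<^sub>2 \<in> hardy_annihilator \<Psi>" and z: "0 < Im z"
  shows "cauchy (\<lambda>x. g\<^sub>1 x * cnj (\<psi>\<^sub>1 x)) z * cauchy (\<lambda>x. g\<^sub>2 x * cnj (\<psi>\<^sub>2 x)) z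
    = cauchy (\<lambda>x. g\<^sub>2 x * cnj (\<psi>\<^sub>1 x)) z * cauchy (\<lambda>x. g\<^sub>1 x * cnj (\<psi>\<^sub>2 x)) z"
proof -
  interpret resolvent_invariant_subspace "hardy_annihilator \<Psi>"
    by (rule hardy_annihilator_resolvent_invariant[OF \<Psi>(1)])
  define F where "F = (\<lambda>g \<psi>. cauchy (\<lambda>x. g x * cnj (\<psi> x)) z)"
  obtain e\<^sub>1 where e\<^sub>1: "e\<^sub>1 \<in> wandering_subspace z" "(\<lambda>x. g\<^sub>1 x - e\<^sub>1 x) \<in> blaschke_multiples z"
    using wandering_decomposition[OF z g(1)] .
  obtain e\<^sub>2 where e\<^sub>2: "e\<^sub>2 \<in> wandering_subspace z" "(\<lambda>x. g\<^sub>2 x - e\<^sub>2 x) \<in> blaschke_multiples z"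
    using wandering_decomposition[OF z g(2)] .
  have F_eq: "F g\<^sub>1 \<psi> = F e\<^sub>1 \<psi>" "F g\<^sub>2 \<psi> = F e\<^sub>2 \<psi>" if "\<psi> \<in> \<Psi>" for \<psi>
    using cauchy_cong_wandering[OF \<Psi>(1) that z _ _ e\<^sub>1(2)]
      cauchy_cong_wandering[OF \<Psi>(1) that z _ _ e\<^sub>2(2)]
      wandering_subspaceD(2)[OF e\<^sub>1(1)] wandering_subspaceD(2)[OF e\<^sub>2(1)]
      g[THEN hardy_annihilatorD(1)]
    by (auto simp: F_def)
  have "F e\<^sub>1 \<psi>\<^sub>1 * F e\<^sub>2 \<psi>\<^sub>2 = F e\<^sub>2 \<psi>\<^sub>1 * F e\<^sub>1 \<psi>\<^sub>2"
  proof (cases "inner2 e\<^sub>1 e\<^sub>1 = 0")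
    case True
    then have "F e\<^sub>1 \<psi> = 0" if "\<psi> \<in> \<Psi>" for \<psi>
      using wandering_null_cauchy_eq_0[OF e\<^sub>1(1) True] that \<Psi>(1) by (auto simp: F_def)
    then show ?thesis
      using \<Psi> by simp
  next
    case False
    have "inner2 e\<^sub>1 e\<^sub>1 * F e\<^sub>2 \<psi> = inner2 e\<^sub>2 e\<^sub>1 * F e\<^sub>1 \<psi>" if "\<psi> \<in> \<Psi>" for \<psi>
      using cauchy_wandering_proportional[OF z e\<^sub>1(1) e\<^sub>2(1)] that \<Psi>(1) by (auto simp: F_def)
    then have "inner2 e\<^sub>1 e\<^sub>1 * (F e\<^sub>1 \<psi>\<^sub>1 * F e\<^sub>2 \<psi>\<^sub>2) = inner2 e\<^sub>1 e\<^sub>1 * (F e\<^sub>2 \<psi>\<^sub>1 * F e\<^sub>1 \<psi>\<^sub>2)"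
      using \<Psi> by (simp add: mult.left_commute flip: mult.assoc)
    then show ?thesis
      using False by simp
  qed
  then show ?thesis
    using F_eq \<Psi> by (simp add: F_def)
qed


section \<open>Exponential type of a product of translates\<close>

lemma holomorphic_divide_out_zero:
  assumes "open S" "connected S" "f holomorphic_on S" "a \<in> S" "f a = 0" "p \<in> S" "f p \<noteq> 0"
  obtains n g where "0 < n" "g holomorphic_on S" "g a \<noteq> 0" "\<And>w. w \<in> S \<Longrightarrow> f w = (w - a) ^ n * g w"
proof -
  have "\<not> f constant_on S"
    using assms unfolding constant_on_def by metis
  then obtain h r n where h: "0 < n" "0 < r" "ball a r \<subseteq> S" "h holomorphic_on ball a r"
      "\<And>w. w \<in> ball a r \<Longrightarrow> f w = (w - a) ^ n * h w" "\<And>w. w \<in> ball a r \<Longrightarrow> h w \<noteq> 0"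
    using holomorphic_factor_zero_nonconstant[OF assms(3,1,2,4,5)] by metis
  define g where "g = (\<lambda>w. if w = a then h a else f w / (w - a) ^ n)"
  have "g holomorphic_on (S - {a})"
  proof (rule holomorphic_transform)
    show "(\<lambda>w. f w / (w - a) ^ n) holomorphic_on (S - {a})"
      using assms(3) by (intro holomorphic_intros) (auto elim: holomorphic_on_subset)
  qed (auto simp: g_def)
  moreover have "g holomorphic_on ball a r"
    by (rule holomorphic_transform[OF h(4)]) (auto simp: g_def h(5))
  ultimately have "g holomorphic_on ((S - {a}) \<union> ball a r)"
    using assms(1) by (intro holomorphic_on_Un) (auto simp: open_delete)
  moreover have "(S - {a}) \<union> ball a r = S"
    using h(2,3) assms(4) by auto
  ultimately have hol: "g holomorphic_on S"
    by simp
  show thesis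
  proof (rule that[OF h(1) hol])
    show "g a \<noteq> 0"
      using h(2) h(6)[of a] by (auto simp: g_def)
    show "f w = (w - a) ^ n * g w" if "w \<in> S" for w
      using h(1) assms(5) by (auto simp: g_def)
  qed
qed

lemma cmod_one_minus_cnj_mult_power2_diff:
  "(cmod (1 - cnj a * w))\<^sup>2 - (cmod (w - a))\<^sup>2 = (1 - (cmod a)\<^sup>2) * (1 - (cmod w)\<^sup>2)"
  unfolding cmod_power2 by (simp add: power2_eq_square algebra_simps)

lemma cmod_diff_le_one_minus_cnj_mult:
  assumes "cmod a \<le> 1" "cmod w \<le> 1"
  shows "cmod (w - a) \<le> cmod (1 - cnj a * w)"
proof -
  have "0 \<le> (1 - (cmod a)\<^sup>2) * (1 - (cmod w)\<^sup>2)"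
    using assms by (intro mult_nonneg_nonneg) (auto simp: power_le_one)
  then show ?thesis
    unfolding cmod_one_minus_cnj_mult_power2_diff[symmetric] by (auto intro: power2_le_imp_le)
qed

lemma cmod_one_minus_cnj_mult_eq:
  assumes "cmod w = 1"
  shows "cmod (1 - cnj a * w) = cmod (w - a)"
  using cmod_one_minus_cnj_mult_power2_diff[of a w] assms by (auto intro: power2_eq_imp_eq)

lemma one_minus_cnj_mult_neq_0:
  assumes "cmod a < 1" "cmod w \<le> 1"
  shows "1 - cnj a * w \<noteq> 0"
proof
  assume "1 - cnj a * w = 0"
  then have "cmod a * cmod w = 1"
    by (metis complex_mod_cnj eq_iff_diff_eq_0 norm_mult norm_one)
  moreover have "cmod a * cmod w \<le> cmod a"
    using assms(2) by (simp add: mult_left_le)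
  ultimately show False
    using assms(1) by simp
qed

lemma reflect_zero_across_unit_circle:
  assumes S: "open S" "connected S" "cball 0 1 \<subseteq> S" and f: "f holomorphic_on S"
    and p: "p \<in> S" "f p \<noteq> 0" and a: "a \<in> ball 0 1" "f a = 0"
  obtains k where "k holomorphic_on S" "\<And>w. w \<in> ball 0 1 \<Longrightarrow> cmod (f w) \<le> cmod (k w)"
    "\<And>w. w \<in> sphere 0 1 \<Longrightarrow> cmod (k w) = cmod (f w)"
    "{w \<in> ball 0 1. k w = 0} = {w \<in> ball 0 1. f w = 0} - {a}"
proof -
  have "a \<in> S"
    using a(1) S(3) by auto
  then obtain n g where g: "0 < n" "g holomorphic_on S" "g a \<noteq> 0"
      "\<And>w. w \<in> S \<Longrightarrow> f w = (w - a) ^ n * g w"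
    using holomorphic_divide_out_zero[OF S(1,2) f _ a(2) p] by metis
  have f_eq: "f w = (w - a) ^ n * g w" if "cmod w \<le> 1" for w
    using that S(3) by (intro g(4)) auto
  show thesis
  proof (rule that)
    show "(\<lambda>w. (1 - cnj a * w) ^ n * g w) holomorphic_on S"
      using g(2) by (intro holomorphic_intros)
    show "cmod (f w) \<le> cmod ((1 - cnj a * w) ^ n * g w)" if "w \<in> ball 0 1" for w
      using that a(1)
      by (auto simp: f_eq norm_mult norm_power
        intro!: mult_right_mono power_mono cmod_diff_le_one_minus_cnj_mult)
    show "cmod ((1 - cnj a * w) ^ n * g w) = cmod (f w)" if "w \<in> sphere 0 1" for w
      using that by (simp add: f_eq norm_mult norm_power cmod_one_minus_cnj_mult_eq)
    show "{w \<in> ball 0 1. (1 - cnj a * w) ^ n * g w = 0} = {w \<in> ball 0 1. f w = 0} - {a}"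
      using a(1) g(1,3) one_minus_cnj_mult_neq_0[of a] by (auto simp: f_eq)
  qed
qed

definition zero_free_majorant :: "(complex \<Rightarrow> complex) \<Rightarrow> (complex \<Rightarrow> complex) \<Rightarrow> bool" where
  "zero_free_majorant f g \<longleftrightarrow> (\<forall>w\<in>ball 0 1. g w \<noteq> 0 \<and> cmod (f w) \<le> cmod (g w))
    \<and> (\<forall>w\<in>sphere 0 1. cmod (g w) = cmod (f w))"

lemma finite_zeros_in_unit_ball:
  assumes S: "open S" "connected S" "cball 0 1 \<subseteq> S" and f: "f holomorphic_on S"
    and p: "p \<in> S" "f p \<noteq> 0"
  shows "finite {w \<in> ball 0 1. f w = 0}"
proof (cases "f constant_on S")
  case True
  then have "f w = f p" if "w \<in> ball 0 1" for w
    using that p(1) subsetD[OF S(3), of w] by (auto simp: constant_on_def)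
  then have "{w \<in> ball 0 1. f w = 0} = {}"
    using p(2) by auto
  then show ?thesis
    by (simp only: finite.emptyI)
next
  case False
  then have "finite {w \<in> cball 0 1. f w = 0}"
    by (rule holomorphic_compact_finite_zeros[OF f S(1,2) compact_cball S(3)])
  then show ?thesis
    by (rule rev_finite_subset) auto
qed

lemma exists_zero_free_majorant:
  assumes S: "open S" "connected S" "cball 0 1 \<subseteq> S" and f: "f holomorphic_on S"
    and p: "p \<in> S" "f p \<noteq> 0"
  obtains g where "g holomorphic_on S" "zero_free_majorant f g"
proof -
  have "\<exists>g. g holomorphic_on S \<and> zero_free_majorant f g"
    if "finite Z" "f holomorphic_on S" "\<exists>p\<in>S. f p \<noteq> 0" "{w \<in> ball 0 1. f w = 0} = Z" for Z
    using that
  proof (induction Z arbitrary: f rule: finite_induct)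
    case empty
    then show ?case
      by (intro exI[of _ f]) (auto simp: zero_free_majorant_def)
  next
    case (insert a Z)
    have a: "a \<in> ball 0 1" "f a = 0"
      using insert.prems(3) by auto
    obtain p where "p \<in> S" "f p \<noteq> 0"
      using insert.prems(2) by blast
    then obtain k where k: "k holomorphic_on S" "\<And>w. w \<in> ball 0 1 \<Longrightarrow> cmod (f w) \<le> cmod (k w)"
        "\<And>w. w \<in> sphere 0 1 \<Longrightarrow> cmod (k w) = cmod (f w)"
        "{w \<in> ball 0 1. k w = 0} = {w \<in> ball 0 1. f w = 0} - {a}"
      using reflect_zero_across_unit_circle[OF S insert.prems(1) _ _ a] by blast
    have zeros: "{w \<in> ball 0 1. k w = 0} = Z"
      unfolding k(4) insert.prems(3) using insert.hyps(2) by auto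
    have "a \<in> S"
      using a(1) S(3) by auto
    then have "\<exists>p\<in>S. k p \<noteq> 0"
      using a(1) insert.hyps(2) zeros by (intro bexI[of _ a]) auto
    then obtain g where "g holomorphic_on S" "zero_free_majorant k g"
      using insert.IH[OF k(1) _ zeros] by blast
    then show ?case
      using k(2,3) by (force simp: zero_free_majorant_def intro: order_trans)
  qed
  then show thesis
    using that f p finite_zeros_in_unit_ball[OF S f p] by blast
qed

lemma Schwarz_Re_pos:
  assumes h: "h holomorphic_on ball 0 1" and pos: "\<And>z. cmod z < 1 \<Longrightarrow> 0 < Re (h z)"
    and w: "cmod w < 1"
  shows "cmod (h w - h 0) \<le> cmod w * cmod (h w + cnj (h 0))"
proof -
  define \<phi> where "\<phi> = (\<lambda>z. (h z - h 0) / (h z + cnj (h 0)))"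
  have denominator: "h z + cnj (h 0) \<noteq> 0" if "cmod z < 1" for z
    using pos[OF that] pos[of 0] by (auto simp: complex_eq_iff)
  have "cmod (\<phi> w) \<le> cmod w"
  proof (rule Schwarz_Lemma(1)[OF _ _ _ w])
    show "\<phi> holomorphic_on ball 0 1"
      unfolding \<phi>_def using h denominator by (intro holomorphic_intros) auto
    show "\<phi> 0 = 0"
      by (simp add: \<phi>_def)
    show "cmod (\<phi> z) < 1" if z: "cmod z < 1" for z
    proof -
      have "(cmod (h z + cnj (h 0)))\<^sup>2 - (cmod (h z - h 0))\<^sup>2 = 4 * (Re (h z) * Re (h 0))"
        unfolding cmod_power2 by (simp add: power2_eq_square algebra_simps)
      moreover have "0 < Re (h z) * Re (h 0)"
        using pos[OF z] pos[of 0] by simp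
      ultimately have "cmod (h z - h 0) < cmod (h z + cnj (h 0))"
        by (intro power2_less_imp_less[of "cmod (h z - h 0)"]) auto
      then show ?thesis
        using denominator[OF z] by (simp add: \<phi>_def norm_divide)
    qed
  qed
  then show ?thesis
    using denominator[OF w] by (simp add: \<phi>_def norm_divide divide_le_eq)
qed

lemma Harnack_Re_pos:
  assumes h: "h holomorphic_on ball 0 1" and pos: "\<And>z. cmod z < 1 \<Longrightarrow> 0 < Re (h z)"
    and w: "cmod w < 1"
  shows "(1 - cmod w) / (1 + cmod w) * Re (h 0) \<le> Re (h w)"
proof -
  have "(cmod (h w - h 0))\<^sup>2 \<le> (cmod w)\<^sup>2 * (cmod (h w + cnj (h 0)))\<^sup>2"
    unfolding power_mult_distrib[symmetric] by (intro power_mono Schwarz_Re_pos assms) auto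
  moreover have "(cmod w)\<^sup>2 * (Im (h w - h 0))\<^sup>2 \<le> (Im (h w - h 0))\<^sup>2"
    using w by (intro mult_left_le_one_le) (auto simp: power_le_one)
  ultimately have "(Re (h w) - Re (h 0))\<^sup>2 \<le> (cmod w)\<^sup>2 * (Re (h w) + Re (h 0))\<^sup>2"
    unfolding cmod_power2[of "h w - h 0"] cmod_power2[of "h w + cnj (h 0)"]
    by (simp add: distrib_left)
  then have "(Re (h 0) - Re (h w))\<^sup>2 \<le> (cmod w * (Re (h w) + Re (h 0)))\<^sup>2"
    by (metis power2_commute power_mult_distrib)
  then have "Re (h 0) - Re (h w) \<le> cmod w * (Re (h w) + Re (h 0))"
    by (rule power2_le_imp_le) (use pos[OF w] pos[of 0] in simp)
  then have "(1 - cmod w) * Re (h 0) \<le> (1 + cmod w) * Re (h w)"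
    by (simp add: algebra_simps)
  moreover have "0 < 1 + cmod w"
    by (simp add: add_pos_nonneg)
  ultimately show ?thesis
    by (simp add: pos_divide_le_eq mult.commute)
qed

lemma Harnack_zero_free:
  assumes g: "g holomorphic_on ball 0 1" "\<And>z. cmod z < 1 \<Longrightarrow> g z \<noteq> 0"
      "\<And>z. cmod z < 1 \<Longrightarrow> cmod (g z) < 1"
    and w: "cmod w < 1"
  shows "ln (cmod (g w)) \<le> (1 - cmod w) / (1 + cmod w) * ln (cmod (g 0))"
proof -
  obtain h where h: "h holomorphic_on ball 0 1" "\<And>z. cmod z < 1 \<Longrightarrow> g z = exp (h z)"
    using contractible_imp_holomorphic_log[OF g(1) convex_imp_contractible[OF convex_ball]] g(2)
    by (metis mem_ball_0)
  have "(1 - cmod w) / (1 + cmod w) * Re (- h 0) \<le> Re (- h w)"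
  proof (rule Harnack_Re_pos[OF _ _ w])
    show "0 < Re (- h z)" if "cmod z < 1" for z
      using g(3)[OF that] h(2)[OF that] by simp
  qed (use h(1) in \<open>intro holomorphic_intros\<close>)
  then show ?thesis
    using h(2)[OF w] h(2)[of 0] by simp
qed

lemma maximum_modulus_unit_disc:
  assumes h: "h holomorphic_on S" "cball 0 1 \<subseteq> S"
    and bound: "\<And>w. cmod w = 1 \<Longrightarrow> cmod (h w) \<le> M" and w: "cmod w \<le> 1"
  shows "cmod (h w) \<le> M"
proof (rule maximum_modulus_frontier[of h "cball 0 1"])
  show "h holomorphic_on interior (cball 0 1)"
    using h interior_subset by (blast intro: holomorphic_on_subset)
  show "continuous_on (closure (cball 0 1)) h"
    using holomorphic_on_imp_continuous_on[OF holomorphic_on_subset[OF h]] by simp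
  show "\<And>z. z \<in> frontier (cball 0 1) \<Longrightarrow> cmod (h z) \<le> M"
    using bound by (simp add: frontier_cball)
qed (use w in auto)

lemma maximum_modulus_unit_disc_strict:
  assumes h: "h holomorphic_on S" "cball 0 1 \<subseteq> S"
    and bound: "\<And>w. cmod w = 1 \<Longrightarrow> cmod (h w) < M" and w: "cmod w \<le> 1"
  shows "cmod (h w) < M"
proof -
  have "sphere 0 1 \<subseteq> S"
    using h(2) sphere_cball by blast
  then have "continuous_on (sphere 0 1) (\<lambda>w. cmod (h w))"
    by (intro continuous_on_norm holomorphic_on_imp_continuous_on holomorphic_on_subset[OF h(1)])
  moreover have "sphere (0::complex) 1 \<noteq> {}"
    by simp
  ultimately obtain \<zeta> where \<zeta>: "cmod \<zeta> = 1" "\<And>w. cmod w = 1 \<Longrightarrow> cmod (h w) \<le> cmod (h \<zeta>)"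
    using continuous_attains_sup[OF compact_sphere] by (metis mem_sphere_0)
  have "cmod (h w) \<le> cmod (h \<zeta>)"
    by (rule maximum_modulus_unit_disc[OF h \<zeta>(2) w])
  with bound[OF \<zeta>(1)] show ?thesis by simp
qed

lemma ln_cmod_add_le_of_circle_bound:
  assumes S: "cball 0 1 \<subseteq> S"
    and hol: "g\<^sub>1 holomorphic_on S" "g\<^sub>2 holomorphic_on S" "q holomorphic_on S"
    and circle: "\<And>w. cmod w = 1 \<Longrightarrow> cmod (g\<^sub>1 w * g\<^sub>2 w) \<le> exp (Re (q w))"
    and nonzero: "g\<^sub>1 0 \<noteq> 0" "g\<^sub>2 0 \<noteq> 0"
  shows "ln (cmod (g\<^sub>1 0)) + ln (cmod (g\<^sub>2 0)) \<le> Re (q 0)"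
proof -
  define h where "h = (\<lambda>w. g\<^sub>1 w * g\<^sub>2 w * exp (- q w))"
  have "cmod (h 0) \<le> 1"
  proof (rule maximum_modulus_unit_disc[OF _ S, of h])
    show "h holomorphic_on S"
      unfolding h_def using hol by (intro holomorphic_intros)
    fix w :: complex assume "cmod w = 1"
    then have "cmod (g\<^sub>1 w * g\<^sub>2 w) * exp (- Re (q w)) \<le> exp (Re (q w)) * exp (- Re (q w))"
      by (intro mult_right_mono circle) auto
    then show "cmod (h w) \<le> 1"
      by (simp add: h_def norm_mult flip: exp_add)
  qed simp
  then have "cmod (g\<^sub>1 0 * g\<^sub>2 0) \<le> exp (Re (q 0))"
    by (simp add: h_def norm_mult norm_divide exp_minus field_simps)
  then have "ln (cmod (g\<^sub>1 0 * g\<^sub>2 0)) \<le> ln (exp (Re (q 0)))"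
    using nonzero by (subst ln_le_cancel_iff) auto
  then show ?thesis
    using nonzero by (simp add: norm_mult ln_mult)
qed

text \<open>After reflecting all zeros out of the disc the logarithms become harmonic: the maximum principle
  controls their sum at the origin, and Harnack's inequality moves one of them to \<open>v\<close>.\<close>

lemma two_point_ln_bound:
  assumes S: "open S" "connected S" "cball 0 1 \<subseteq> S"
    and hol: "f\<^sub>1 holomorphic_on S" "f\<^sub>2 holomorphic_on S" "q holomorphic_on S"
    and f\<^sub>2_lt: "\<And>w. cmod w = 1 \<Longrightarrow> cmod (f\<^sub>2 w) < 1"
    and product: "\<And>w. cmod w = 1 \<Longrightarrow> cmod (f\<^sub>1 w * f\<^sub>2 w) \<le> exp (Re (q w))"
    and v: "cmod v < 1" and nonzero: "f\<^sub>1 0 \<noteq> 0" "f\<^sub>2 v \<noteq> 0"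
  shows "ln (cmod (f\<^sub>1 0)) + (1 + cmod v) / (1 - cmod v) * ln (cmod (f\<^sub>2 v)) \<le> Re (q 0)"
proof -
  have mem: "0 \<in> S" "v \<in> S"
    using S(3) v by auto
  obtain g\<^sub>1 where g\<^sub>1: "g\<^sub>1 holomorphic_on S" "zero_free_majorant f\<^sub>1 g\<^sub>1"
    using exists_zero_free_majorant[OF S hol(1) mem(1) nonzero(1)] .
  obtain g\<^sub>2 where g\<^sub>2: "g\<^sub>2 holomorphic_on S" "zero_free_majorant f\<^sub>2 g\<^sub>2"
    using exists_zero_free_majorant[OF S hol(2) mem(2) nonzero(2)] .
  have g_nonzero: "g\<^sub>1 w \<noteq> 0" "g\<^sub>2 w \<noteq> 0"
    and le_g: "cmod (f\<^sub>1 w) \<le> cmod (g\<^sub>1 w)" "cmod (f\<^sub>2 w) \<le> cmod (g\<^sub>2 w)"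
    if "cmod w < 1" for w
    using that g\<^sub>1(2) g\<^sub>2(2) by (auto simp: zero_free_majorant_def)
  have eq_g: "cmod (g\<^sub>1 w) = cmod (f\<^sub>1 w)" "cmod (g\<^sub>2 w) = cmod (f\<^sub>2 w)" if "cmod w = 1" for w
    using that g\<^sub>1(2) g\<^sub>2(2) by (auto simp: zero_free_majorant_def)
  have sum: "ln (cmod (g\<^sub>1 0)) + ln (cmod (g\<^sub>2 0)) \<le> Re (q 0)"
    using product eq_g g_nonzero[of 0]
    by (intro ln_cmod_add_le_of_circle_bound[OF S(3) g\<^sub>1(1) g\<^sub>2(1) hol(3)]) (auto simp: norm_mult)
  have "ln (cmod (f\<^sub>2 v)) \<le> ln (cmod (g\<^sub>2 v))"
    using le_g(2)[OF v] nonzero(2) by (subst ln_le_cancel_iff) auto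
  also have "\<dots> \<le> (1 - cmod v) / (1 + cmod v) * ln (cmod (g\<^sub>2 0))"
  proof (rule Harnack_zero_free[OF _ g_nonzero(2) _ v])
    show "g\<^sub>2 holomorphic_on ball 0 1"
      by (rule holomorphic_on_subset[OF g\<^sub>2(1) order_trans[OF ball_subset_cball S(3)]])
    show "cmod (g\<^sub>2 z) < 1" if "cmod z < 1" for z
      using maximum_modulus_unit_disc_strict[OF g\<^sub>2(1) S(3)] eq_g(2) f\<^sub>2_lt that by simp
  qed
  finally have "(1 + cmod v) * ln (cmod (f\<^sub>2 v)) \<le> (1 - cmod v) * ln (cmod (g\<^sub>2 0))"
    using norm_ge_zero[of v] by (simp add: field_simps)
  then have "(1 + cmod v) / (1 - cmod v) * ln (cmod (f\<^sub>2 v)) \<le> ln (cmod (g\<^sub>2 0))"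
    using v by (simp add: field_simps)
  moreover have "ln (cmod (f\<^sub>1 0)) \<le> ln (cmod (g\<^sub>1 0))"
    using le_g(1)[of 0] nonzero(1) by (subst ln_le_cancel_iff) auto
  ultimately show ?thesis
    using sum by linarith
qed

text \<open>Apply the bound on the disc of radius \<open>Im z / 2\<close> around \<open>z\<close>, where both translates take the value
  \<open>f z\<close>, at points whose distance relative to the radius is \<open>r\<close>.\<close>

lemma translate_product_ln_bound:
  assumes hol: "f holomorphic_on {z. 0 < Im z}" and lt: "\<And>z. 1 \<le> Im z \<Longrightarrow> cmod (f z) < 1"
    and product: "\<And>z. 1 \<le> Im z \<Longrightarrow> cmod (f z * f (z - of_real m)) \<le> B * exp (- c * Im z)"
    and B: "0 < B" and z: "2 \<le> Im z" "f z \<noteq> 0" and r: "0 \<le> r" "r < 1" "Im z / 2 * r = m"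
  shows "ln (cmod (f z)) + (1 + r) / (1 - r) * ln (cmod (f z)) \<le> ln B - c * Im z"
proof -
  define R where "R = Im z / 2"
  have R: "1 \<le> R" "R * r = m"
    using z(1) r(3) by (simp_all add: R_def)
  define T where "T = (\<lambda>w. z + of_real R * w)"
  define S where "S = {w. - 2 < Im w}"
  have ImT: "Im (T w) = R * (2 + Im w)" for w
    by (simp add: T_def R_def algebra_simps)
  have ImT_pos: "0 < Im (T w)" if "w \<in> S" for w
    using that R(1) by (simp add: ImT S_def)
  have ImT_ge: "1 \<le> Im (T w)" if "cmod w \<le> 1" for w
  proof -
    have "1 * 1 \<le> R * (2 + Im w)"
      using R(1) abs_Im_le_cmod[of w] that by (intro mult_mono) auto
    then show ?thesis
      by (simp add: ImT)
  qed
  have T_hol: "(\<lambda>w. f (T w - of_real s)) holomorphic_on S" for s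
    by (rule holomorphic_on_compose_gen[OF _ hol, unfolded o_def])
      (auto simp: ImT_pos, auto simp: T_def intro!: holomorphic_intros)
  have T_values: "T 0 = z" "T (of_real r) - of_real m = z"
    using R(2) by (simp_all add: T_def flip: of_real_mult)
  have r_norm: "cmod (of_real r) < 1"
    using r by simp
  have "ln (cmod (f (T 0 - of_real 0))) + (1 + cmod (of_real r)) / (1 - cmod (of_real r))
      * ln (cmod (f (T (of_real r) - of_real m))) \<le> Re (of_real (ln B) + \<i> * of_real c * T 0)"
  proof (rule two_point_ln_bound[OF _ _ _ T_hol T_hol _ _ _ r_norm])
    show "open S" "connected S"
      unfolding S_def by (auto intro: open_halfspace_Im_gt convex_connected convex_halfspace_Im_gt)
    show "cball 0 1 \<subseteq> S"
    proof
      fix w :: complex assume "w \<in> cball 0 1"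
      then show "w \<in> S"
        using abs_Im_le_cmod[of w] by (auto simp: S_def)
    qed
    show "(\<lambda>w. of_real (ln B) + \<i> * of_real c * T w) holomorphic_on S"
      unfolding T_def by (intro holomorphic_intros)
    show "cmod (f (T w - of_real m)) < 1" if "cmod w = 1" for w
      using lt ImT_ge[of w] that by simp
    show "cmod (f (T w - of_real 0) * f (T w - of_real m))
      \<le> exp (Re (of_real (ln B) + \<i> * of_real c * T w))"
      if "cmod w = 1" for w
      using product[OF ImT_ge[of w]] that B by (simp add: exp_diff exp_minus divide_inverse)
  qed (use z(2) in \<open>simp_all add: T_values\<close>)
  then show ?thesis
    unfolding T_values using r by (simp add: T_values)
qed

lemma norm_le_exp_of_translate_product:
  assumes hol: "f holomorphic_on {z. 0 < Im z}" and lt: "\<And>z. 1 \<le> Im z \<Longrightarrow> cmod (f z) < 1"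
    and product: "\<And>z. 1 \<le> Im z \<Longrightarrow> cmod (f z * f (z - of_real m)) \<le> B * exp (- c * Im z)"
    and m: "0 \<le> m" and B: "1 \<le> B" and z: "2 \<le> Im z" "2 * m < Im z"
  shows "cmod (f z) \<le> exp (ln B / 2 + m * c - c * Im z / 2)"
proof (cases "f z = 0")
  case False
  define y where "y = Im z"
  define R where "R = y / 2"
  define r where "r = m / R"
  have r: "0 \<le> r" "r < 1" "R * r = m"
    using z m by (auto simp: r_def R_def y_def field_simps)
  have "ln (cmod (f z)) + (1 + r) / (1 - r) * ln (cmod (f z)) \<le> ln B - c * y"
    using False B r z(1) unfolding y_def
    by (intro translate_product_ln_bound[OF hol lt product]) (auto simp: R_def y_def)
  moreover have "1 + (1 + r) / (1 - r) = 2 / (1 - r)"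
    using r by (simp add: field_simps)
  ultimately have "2 / (1 - r) * ln (cmod (f z)) \<le> ln B - c * y"
    by (metis distrib_right mult_1)
  then have "2 * ln (cmod (f z)) \<le> (1 - r) * (ln B - c * y)"
    using r by (simp add: field_simps)
  also have "\<dots> = ln B - r * ln B - c * y + 2 * (c * (R * r))"
    by (simp add: R_def algebra_simps)
  also have "\<dots> \<le> ln B - c * y + 2 * (m * c)"
    using r B by (simp add: mult.commute)
  finally have "ln (cmod (f z)) \<le> ln B / 2 + m * c - c * y / 2"
    by simp
  then show ?thesis
    using False by (metis exp_le_cancel_iff exp_ln y_def zero_less_norm_iff)
qed simp

theorem exponential_decay_of_translate_product:
  assumes hol: "F holomorphic_on {z. 0 < Im z}" and m: "0 \<le> m"
    and bound: "\<And>z. 1 \<le> Im z \<Longrightarrow> cmod (F z) \<le> C\<^sub>1"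
    and product: "\<And>z. 1 \<le> Im z \<Longrightarrow> cmod (F z * F (z - of_real m)) \<le> C\<^sub>2 * exp (- c * Im z)"
  obtains C y\<^sub>0 where "\<And>z. y\<^sub>0 \<le> Im z \<Longrightarrow> cmod (F z) \<le> C * exp (- (c / 2) * Im z)"
proof -
  define A where "A = \<bar>C\<^sub>1\<bar> + 1"
  define B where "B = max 1 (C\<^sub>2 / A\<^sup>2)"
  have A: "0 < A"
    by (simp add: A_def add_nonneg_pos)
  have scaled: "cmod (F z / of_real A) \<le> exp (ln B / 2 + m * c - c * Im z / 2)"
    if "2 * m + 2 \<le> Im z" for z
  proof (rule norm_le_exp_of_translate_product)
    show "(\<lambda>z. F z / of_real A) holomorphic_on {z. 0 < Im z}"
      using hol A by (intro holomorphic_intros) auto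
    show "cmod (F z / of_real A) < 1" if "1 \<le> Im z" for z
      using bound[OF that] A by (simp add: A_def norm_divide)
    show "cmod (F z / of_real A * (F (z - of_real m) / of_real A)) \<le> B * exp (- c * Im z)"
      if "1 \<le> Im z" for z
    proof -
      have "cmod (F z / of_real A * (F (z - of_real m) / of_real A))
        = cmod (F z * F (z - of_real m)) / A\<^sup>2"
        using A by (simp add: norm_mult norm_divide power2_eq_square)
      also have "\<dots> \<le> C\<^sub>2 / A\<^sup>2 * exp (- c * Im z)"
        using product[OF that] A by (simp add: divide_right_mono)
      also have "\<dots> \<le> B * exp (- c * Im z)"
        by (intro mult_right_mono) (auto simp: B_def)
      finally show ?thesis .
    qed
  qed (use that m in \<open>auto simp: B_def\<close>)
  have "cmod (F z) \<le> A * exp (ln B / 2 + m * c) * exp (- (c / 2) * Im z)"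
    if "2 * m + 2 \<le> Im z" for z
    using scaled[OF that] A by (simp add: norm_divide divide_le_eq mult.assoc mult.commute[of _ A]
      flip: exp_add)
  then show thesis
    by (rule that)
qed


section \<open>Decay of the Cauchy integral and the spectrum\<close>

lemma truncated_laplace_holomorphic:
  assumes X: "continuous_on UNIV X"
  shows "truncated_laplace a X holomorphic_on UNIV"
proof -
  have "(\<lambda>z. integral (cbox 0 a) (\<lambda>l. exp (\<i> * z * of_real l) * X l)) holomorphic_on UNIV"
  proof (rule leibniz_rule_holomorphic
      [where fx = "\<lambda>z l. (\<i> * of_real l) * (exp (\<i> * z * of_real l) * X l)"])
    show "((\<lambda>z. exp (\<i> * z * of_real l) * X l) has_field_derivative
        \<i> * of_real l * (exp (\<i> * z * of_real l) * X l)) (at z within UNIV)" for z l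
      by (auto intro!: derivative_eq_intros)
    show "(\<lambda>l. exp (\<i> * z * of_real l) * X l) integrable_on cbox 0 a" for z
      by (intro integrable_continuous continuous_intros continuous_on_subset[OF X]) auto
    show "continuous_on (UNIV \<times> cbox 0 a)
      (\<lambda>(z, l). \<i> * of_real l * (exp (\<i> * z * of_real l) * X l))"
      unfolding split_beta by (intro continuous_intros continuous_on_compose2[OF X]) auto
  qed auto
  then show ?thesis
    by (simp add: truncated_laplace_def[abs_def])
qed

lemma norm_truncated_laplace_le:
  assumes X: "continuous_on UNIV X" "\<And>l. cmod (X l) \<le> M" and a: "0 \<le> a" and y: "0 \<le> y" "- y \<le> Im z"
  shows "cmod (truncated_laplace a X z) \<le> exp (a * y) * M * a"
proof -
  have "cmod (exp (\<i> * z * of_real l) * X l) \<le> exp (a * y) * M" if l: "l \<in> {0..a}" for l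
  proof -
    have "- (l * Im z) \<le> l * y"
      using l y by (metis atLeastAtMost_iff minus_le_iff mult_left_mono mult_minus_right)
    also have "\<dots> \<le> a * y"
      using l y by (intro mult_right_mono) auto
    finally have "cmod (exp (\<i> * z * of_real l)) \<le> exp (a * y)"
      unfolding norm_exp_i_mult_of_real by simp
    then show ?thesis
      unfolding norm_mult by (intro mult_mono X) auto
  qed
  then have "cmod (truncated_laplace a X z) \<le> exp (a * y) * M * (a - 0)"
    unfolding truncated_laplace_def
    by (intro integral_bound a continuous_intros continuous_on_subset[OF X(1)]) auto
  then show ?thesis by simp
qed

lemma norm_truncated_laplace_le_laplace:
  assumes X: "continuous_on UNIV X" "\<And>l. cmod (X l) \<le> M" and a: "0 \<le> a" and z: "0 < Im z"
  shows "cmod (truncated_laplace a X z) \<le> cmod (laplace X z) + exp (- (a * Im z)) * (M / Im z)"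
proof -
  have "continuous_on UNIV (\<lambda>l. X (l + a))"
    by (intro continuous_on_compose2[OF X(1)] continuous_intros) auto
  then have "cmod (laplace (\<lambda>l. X (l + a)) z) \<le> M / Im z"
    by (intro norm_laplace_le borel_measurable_continuous_onI X(2) z)
  then have "cmod (exp (\<i> * z * of_real a) * laplace (\<lambda>l. X (l + a)) z)
    \<le> exp (- (a * Im z)) * (M / Im z)"
    unfolding norm_mult norm_exp_i_mult_of_real by (intro mult_left_mono) auto
  then show ?thesis
    unfolding laplace_split[OF X a z] using norm_diff_ineq norm_triangle_ineq4
    by (smt (verit, best) add_diff_cancel_right')
qed

lemma truncated_laplace_reflect:
  assumes X: "continuous_on UNIV X"
  shows "exp (- \<i> * z * of_real a) * truncated_laplace a X z
    = truncated_laplace a (\<lambda>l. X (a - l)) (- z)"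
proof -
  define g where "g = (\<lambda>l. exp (\<i> * z * of_real l) * X l)"
  have "exp (- \<i> * z * of_real a) * exp (\<i> * z * of_real (a - l))
    = exp (\<i> * (- z) * of_real l)" for l
    by (simp add: mult_exp_exp algebra_simps)
  then have "truncated_laplace a (\<lambda>l. X (a - l)) (- z)
    = exp (- \<i> * z * of_real a) * integral {0..a} (\<lambda>l. g (a - l))"
    by (simp only: truncated_laplace_def g_def mult.assoc[symmetric] flip: integral_mult_right)
  also have "(\<lambda>l. g (a - l)) = (\<lambda>l. g (- l)) \<circ> (\<lambda>l. l + - a)"
    by (simp add: fun_eq_iff)
  also have "integral {0..a} ((\<lambda>l. g (- l)) \<circ> (\<lambda>l. l + - a))
    = integral {0 + - a..a + - a} (\<lambda>l. g (- l))"
    unfolding g_def by (intro integral_shift continuous_intros continuous_on_compose2[OF X]) auto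
  also have "\<dots> = integral {0..a} g"
    using Henstock_Kurzweil_Integration.integral_reflect_real[of a 0 g] by simp
  finally show ?thesis
    by (simp add: truncated_laplace_def g_def)
qed

lemma norm_truncated_laplace_le_of_decay:
  assumes X: "continuous_on UNIV X" "\<And>l. cmod (X l) \<le> M" and a: "0 \<le> a" and z: "1 \<le> Im z"
    and decay: "cmod (laplace X z) \<le> C * exp (- (a * Im z))"
  shows "cmod (truncated_laplace a X z) \<le> (C + M) * exp (- (a * Im z))"
proof -
  have "0 \<le> M"
    using order_trans[OF norm_ge_zero X(2)] .
  then have "M / Im z \<le> M"
    using z by (simp add: divide_le_eq mult_le_cancel_left1)
  then have "exp (- (a * Im z)) * (M / Im z) \<le> exp (- (a * Im z)) * M"
    by (intro mult_left_mono) auto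
  then show ?thesis
    using norm_truncated_laplace_le_laplace[OF X a, of z] decay z by (simp add: algebra_simps)
qed

lemma norm_truncated_laplace_le_inverse:
  assumes X: "continuous_on UNIV X" "\<And>l. cmod (X l) \<le> M" and a: "0 \<le> a" and z: "0 < Im z"
  shows "cmod (truncated_laplace a X z) \<le> 2 * M / Im z"
proof -
  have "0 \<le> M"
    using order_trans[OF norm_ge_zero X(2)] .
  then have "exp (- (a * Im z)) * (M / Im z) \<le> 1 * (M / Im z)"
    using z a by (intro mult_right_mono) auto
  moreover have "cmod (laplace X z) \<le> M / Im z"
    by (intro norm_laplace_le borel_measurable_continuous_onI X z)
  ultimately show ?thesis
    using norm_truncated_laplace_le_laplace[OF X a z] by simp
qed

text \<open>Multiplied by \<open>exp (- \<i> a z)\<close>, the truncated transform is a bounded entire function which tends to \<open>0\<close>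
  along the negative imaginary axis.\<close>

lemma truncated_laplace_eq_0_of_decay:
  assumes X: "continuous_on UNIV X" "\<And>l. cmod (X l) \<le> M" and a: "0 \<le> a"
    and decay: "\<And>z. y\<^sub>0 \<le> Im z \<Longrightarrow> cmod (laplace X z) \<le> C * exp (- (a * Im z))"
  shows "truncated_laplace a X z = 0"
proof -
  define P where "P = (\<lambda>z. exp (- \<i> * z * of_real a) * truncated_laplace a X z)"
  define y where "y = max 1 y\<^sub>0"
  have reflected: "continuous_on UNIV (\<lambda>l. X (a - l))" "\<And>l. cmod (X (a - l)) \<le> M"
    by (auto intro!: continuous_on_compose2[OF X(1)] continuous_intros X(2))
  have upper: "cmod (P z) \<le> C + M" if z: "y \<le> Im z" for z
  proof -
    have "cmod (truncated_laplace a X z) \<le> (C + M) * exp (- (a * Im z))"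
      using z by (intro norm_truncated_laplace_le_of_decay X a decay) (auto simp: y_def)
    then have "exp (a * Im z) * cmod (truncated_laplace a X z)
      \<le> exp (a * Im z) * ((C + M) * exp (- (a * Im z)))"
      by (intro mult_left_mono) auto
    also have "\<dots> = C + M"
      by (simp add: exp_minus)
    finally show ?thesis
      by (simp add: P_def norm_mult norm_exp_eq_Re mult.commute del: norm_inverse exp_minus)
  qed
  have lower: "cmod (P z) \<le> exp (a * y) * M * a" if "Im z \<le> y" for z
    unfolding P_def truncated_laplace_reflect[OF X(1)]
    using that by (intro norm_truncated_laplace_le[OF reflected a]) (auto simp: y_def)
  have "bounded (range P)"
    by (rule boundedI[where B = "max (C + M) (exp (a * y) * M * a)"])
      (use upper lower linear[of y] in \<open>fastforce simp: le_max_iff_disj\<close>)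
  moreover have "P holomorphic_on UNIV"
    unfolding P_def by (intro holomorphic_intros truncated_laplace_holomorphic X(1))
  ultimately obtain \<kappa> where \<kappa>: "P z = \<kappa>" for z
    using Liouville_theorem by (metis UNIV_I constant_on_def)
  have "cmod \<kappa> \<le> 2 * M / real (Suc n)" for n
  proof -
    define w where "w = \<i> * of_real (real (Suc n))"
    have w: "Im w = real (Suc n)"
      by (simp add: w_def)
    have "\<kappa> = truncated_laplace a (\<lambda>l. X (a - l)) w"
      using \<kappa>[of "- w"] by (simp only: P_def truncated_laplace_reflect[OF X(1)] minus_minus)
    then show ?thesis
      using norm_truncated_laplace_le_inverse[OF reflected a, of w] by (simp add: w)
  qed
  moreover have "(\<lambda>n. 2 * M / real (Suc n)) \<longlonglongrightarrow> 0"
    by real_asymp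
  ultimately have "cmod \<kappa> \<le> 0"
    by (intro LIMSEQ_le_const) auto
  then show ?thesis
    using \<kappa>[of z] by (simp add: P_def)
qed

lemma eq_0_of_laplace_decay:
  assumes X: "continuous_on UNIV X" "\<And>l. cmod (X l) \<le> M"
    and decay: "\<And>z. y\<^sub>0 \<le> Im z \<Longrightarrow> cmod (laplace X z) \<le> C * exp (- (a * Im z))"
    and a: "0 < a" and \<xi>: "\<xi> \<in> {0..a}"
  shows "X \<xi> = 0"
proof -
  have integral_0: "integral {0..b} X = 0" if b: "b \<in> {0..a}" for b
  proof -
    have "cmod (laplace X z) \<le> \<bar>C\<bar> * exp (- (b * Im z))" if "max 0 y\<^sub>0 \<le> Im z" for z
    proof -
      have "cmod (laplace X z) \<le> C * exp (- (a * Im z))"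
        using that by (intro decay) auto
      also have "\<dots> \<le> \<bar>C\<bar> * exp (- (b * Im z))"
        using that b by (intro mult_mono) (auto intro: mult_right_mono)
      finally show ?thesis .
    qed
    then have "truncated_laplace b X 0 = 0"
      using b
      by (intro truncated_laplace_eq_0_of_decay[OF X, where C = "\<bar>C\<bar>" and y\<^sub>0 = "max 0 y\<^sub>0"])
        auto
    then show ?thesis
      by (simp add: truncated_laplace_def)
  qed
  have "((\<lambda>b. integral {0..b} X) has_vector_derivative X \<xi>) (at \<xi> within {0..a})"
    by (intro integral_has_vector_derivative continuous_on_subset[OF X(1)] \<xi>) auto
  moreover have "((\<lambda>b. integral {0..b} X) has_vector_derivative 0) (at \<xi> within {0..a})"
    by (rule has_vector_derivative_transform[OF \<xi> _ has_vector_derivative_const])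
      (simp add: integral_0)
  ultimately show ?thesis
    using vector_derivative_unique_within_closed_interval[OF a] \<xi> by (metis box_real(2))
qed

theorem hardy_space_Mop_of_cauchy_decay:
  assumes \<theta>: "\<theta> \<in> hardy_space" and a: "0 < a"
    and decay: "\<And>z. y\<^sub>0 \<le> Im z \<Longrightarrow> cmod (cauchy \<theta> z) \<le> C * exp (- a * Im z)"
  shows "Mop (- a) \<theta> \<in> hardy_space"
proof -
  note int = hardy_spaceD(1)[OF \<theta>]
  have "cmod (laplace (\<lambda>l. fourier \<theta> (- l)) z) \<le> C * exp (- (a * Im z))" if "max 1 y\<^sub>0 \<le> Im z" for z
    using decay[of z] that cauchy_eq_laplace_fourier_upper[OF int, of z] by (simp add: norm_mult)
  moreover have "continuous_on UNIV (\<lambda>l. fourier \<theta> (- l))"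
    by (intro continuous_on_compose2[OF fourier_continuous[OF int]] continuous_intros) auto
  ultimately have "fourier \<theta> (- \<xi>) = 0" if "\<xi> \<in> {0..a}" for \<xi>
    using eq_0_of_laplace_decay[OF _ norm_fourier_le[OF int] _ a that] by blast
  from this[of "- l" for l] have "fourier \<theta> l = 0" if "- a \<le> l" for l
    using that hardy_spaceD(2)[OF \<theta>, of l] by (cases "0 \<le> l") auto
  then show ?thesis
    by (simp add: Mop_in_hardy_space_iff[OF int])
qed


section \<open>Descent to translation invariance\<close>

lemma L2_Dop: "f \<in> L2 \<Longrightarrow> Dop m f \<in> L2"
  unfolding Dop_def by (rule L2_translate)

definition translate_product :: "fn \<Rightarrow> fn \<Rightarrow> real \<Rightarrow> fn" where
  "translate_product f g m = (\<lambda>x. f (x - m) * cnj (g x))"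

lemma translate_product_integrable:
  "f \<in> L2 \<Longrightarrow> g \<in> L2 \<Longrightarrow> integrable lborel (translate_product f g m)"
  unfolding translate_product_def by (intro L2_integrable_inner L2_translate)

lemma inner2_Mop_Dop: "inner2 (Mop l (Dop m f)) g = fourier (translate_product f g m) l"
  by (simp add: inner2_Mop Dop_def translate_product_def)

lemma translate_product_Dop:
  "(\<lambda>x. Mop c (Dop (k + m) f) x * cnj (Dop m g x)) = Mop c (\<lambda>x. translate_product f g k (x - m))"
  by (simp add: Mop_def Dop_def translate_product_def mult.assoc diff_diff_eq add.commute)

lemma Mop_translate: "Mop c (\<lambda>x. \<phi> (x - m)) = (\<lambda>x. cis (c * m) * Mop c \<phi> (x - m))"
  by (simp add: Mop_eq_cis cis_mult right_diff_distrib flip: mult.assoc)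

text \<open>With \<open>\<phi>\<^sub>k = translate_product f \<psi> k\<close> this is the identity \<open>\<phi>\<^sub>m(x) \<phi>\<^sub>m(x - m) = \<phi>\<^bsub>2m\<^esub>(x) \<phi>\<^sub>0(x - m)\<close> for the
  analytic extensions.\<close>

lemma cauchy_translate_product_identity:
  assumes L: "f \<in> L2" "\<psi> \<in> L2" and c: "0 \<le> c" and z: "0 < Im z"
    and hardy: "translate_product f \<psi> 0 \<in> hardy_space"
      "Mop c (translate_product f \<psi> m) \<in> hardy_space"
      "Mop c (translate_product f \<psi> (m + m)) \<in> hardy_space"
  defines "\<theta> \<equiv> Mop c (translate_product f \<psi> m)"
  shows "cauchy \<theta> z * (cis (c * m) * cauchy \<theta> (z - of_real m))
    = cauchy (Mop c (translate_product f \<psi> (m + m))) z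
      * (exp (\<i> * z * of_real c) * cauchy (translate_product f \<psi> 0) (z - of_real m))"
proof -
  define g where "g = (\<lambda>k. Mop c (Dop k f))"
  have products: "(\<lambda>x. g k x * cnj (\<psi> x)) = Mop c (translate_product f \<psi> k)"
      "(\<lambda>x. g (k + m) x * cnj (Dop m \<psi> x)) = Mop c (\<lambda>x. translate_product f \<psi> k (x - m))" for k
    by (simp_all add: g_def translate_product_Dop)
      (simp add: Mop_def Dop_def translate_product_def mult.assoc)
  have shifted: "Mop c (\<lambda>x. translate_product f \<psi> 0 (x - m)) \<in> hardy_space"
      "Mop c (\<lambda>x. translate_product f \<psi> m (x - m)) \<in> hardy_space"
    using hardy_space_Mop[OF hardy_space_translate[OF hardy(1)] c]
      hardy_space_scale[OF hardy_space_translate[OF hardy(2)]]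
    by (simp_all add: Mop_translate)
  have mem: "g m \<in> hardy_annihilator {\<psi>, Dop m \<psi>}" "g (m + m) \<in> hardy_annihilator {\<psi>, Dop m \<psi>}"
    using hardy shifted products(1) products(2)[of 0] products(2)[of m] L
    by (auto simp: hardy_annihilator_def g_def intro: L2_Mop L2_Dop)
  have "cauchy (\<lambda>x. g m x * cnj (\<psi> x)) z * cauchy (\<lambda>x. g (m + m) x * cnj (Dop m \<psi> x)) z
      = cauchy (\<lambda>x. g (m + m) x * cnj (\<psi> x)) z * cauchy (\<lambda>x. g m x * cnj (Dop m \<psi> x)) z"
    by (rule cauchy_hardy_annihilator_rank_1[OF _ _ _ mem z]) (use L L2_Dop in auto)
  moreover have "cauchy (\<lambda>x. g (m + m) x * cnj (Dop m \<psi> x)) z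
    = cis (c * m) * cauchy \<theta> (z - of_real m)"
    by (simp only: products Mop_translate cauchy_scale cauchy_translate \<theta>_def)
  moreover have "cauchy (\<lambda>x. g m x * cnj (Dop m \<psi> x)) z
      = exp (\<i> * z * of_real c) * cauchy (translate_product f \<psi> 0) (z - of_real m)"
    using products(2)[of 0] cauchy_Mop_hardy_space[OF hardy_space_translate[OF hardy(1)] c z]
    by (simp add: cauchy_translate)
  ultimately show ?thesis
    by (simp add: products \<theta>_def)
qed

lemma halve_modulation:
  assumes L: "f \<in> L2" "\<psi> \<in> L2" and c: "0 < c" and m: "0 \<le> m"
    and hardy: "translate_product f \<psi> 0 \<in> hardy_space"
      "Mop c (translate_product f \<psi> m) \<in> hardy_space"
      "Mop c (translate_product f \<psi> (m + m)) \<in> hardy_space"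
  shows "Mop (c / 2) (translate_product f \<psi> m) \<in> hardy_space"
proof -
  define \<theta> where "\<theta> = Mop c (translate_product f \<psi> m)"
  define A where "A = (LINT x|lborel. cmod (Mop c (translate_product f \<psi> (m + m)) x))"
  define B where "B = (LINT x|lborel. cmod (translate_product f \<psi> 0 x))"
  have \<theta>: "\<theta> \<in> hardy_space" "integrable lborel \<theta>"
    using hardy(2) hardy_spaceD(1) by (auto simp: \<theta>_def)
  have product: "cmod (cauchy \<theta> z * cauchy \<theta> (z - of_real m)) \<le> (A * B) * exp (- c * Im z)"
    if z: "1 \<le> Im z" for z
  proof -
    have "cmod (cauchy \<theta> z * cauchy \<theta> (z - of_real m))
        = cmod (cauchy \<theta> z * (cis (c * m) * cauchy \<theta> (z - of_real m)))"
      by (simp add: norm_mult)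
    also have "\<dots> = cmod (cauchy (Mop c (translate_product f \<psi> (m + m))) z)
        * (exp (- (c * Im z)) * cmod (cauchy (translate_product f \<psi> 0) (z - of_real m)))"
      unfolding \<theta>_def using c z by (subst cauchy_translate_product_identity[OF L _ _ hardy])
        (simp_all add: norm_mult norm_exp_i_mult_of_real)
    also have "\<dots> \<le> A * (exp (- (c * Im z)) * B)"
      unfolding A_def B_def using z hardy(1,3)[THEN hardy_spaceD(1)]
      by (intro mult_mono norm_cauchy_le_of_Im_ge_1) auto
    finally show ?thesis
      by (simp add: mult_ac)
  qed
  have "cauchy \<theta> holomorphic_on {z. 0 < Im z}"
    by (rule holomorphic_on_subset[OF cauchy_holomorphic[OF \<theta>(2)]]) auto
  from exponential_decay_of_translate_product[OF this m norm_cauchy_le_of_Im_ge_1[OF \<theta>(2)] product]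
  obtain C y\<^sub>0 where "\<And>z. y\<^sub>0 \<le> Im z \<Longrightarrow> cmod (cauchy \<theta> z) \<le> C * exp (- (c / 2) * Im z)"
    by blast
  then have "Mop (- (c / 2)) \<theta> \<in> hardy_space"
    using c by (intro hardy_space_Mop_of_cauchy_decay \<theta>) auto
  then show ?thesis
    by (simp add: \<theta>_def Mop_Mop)
qed

theorem translate_product_in_hardy_space:
  assumes L: "f \<in> L2" "\<psi> \<in> L2" and c: "0 < c"
    and hardy: "translate_product f \<psi> 0 \<in> hardy_space"
      "\<And>m. 0 \<le> m \<Longrightarrow> Mop c (translate_product f \<psi> m) \<in> hardy_space"
    and m: "0 \<le> m"
  shows "translate_product f \<psi> m \<in> hardy_space"
proof -
  note int = translate_product_integrable[OF L]
  have "Mop (c / 2 ^ n) (translate_product f \<psi> m) \<in> hardy_space" if "0 \<le> m" for n m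
    using that
  proof (induction n arbitrary: m)
    case 0
    then show ?case
      using hardy(2) by simp
  next
    case (Suc n)
    then have "Mop (c / 2 ^ n / 2) (translate_product f \<psi> m) \<in> hardy_space"
      using c by (intro halve_modulation L hardy(1) Suc.IH) auto
    then show ?case
      by (simp add: mult.commute)
  qed
  from this[OF m] have zero: "fourier (translate_product f \<psi> m) (l + c / 2 ^ n) = 0"
    if "0 \<le> l" for n l
    using that Mop_in_hardy_space_iff[OF int, of "c / 2 ^ n" m] by simp
  have "fourier (translate_product f \<psi> m) l = 0" if l: "0 \<le> l" for l
  proof -
    have "(\<lambda>n. l + c / 2 ^ n) \<longlonglongrightarrow> l + 0"
      by (intro tendsto_intros) real_asymp
    then have "(\<lambda>n. fourier (translate_product f \<psi> m) (l + c / 2 ^ n))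
      \<longlonglongrightarrow> fourier (translate_product f \<psi> m) (l + 0)"
      using fourier_continuous[OF int, of UNIV] by (auto simp: continuous_on_sequentially o_def)
    then show ?thesis
      by (simp add: zero[OF l] LIMSEQ_const_iff)
  qed
  then show ?thesis
    using int by (simp add: hardy_space_def)
qed


section \<open>Bounded operators\<close>

lemma bopD:
  assumes "bop T"
  shows "\<And>f. f \<in> L2 \<Longrightarrow> T f \<in> L2"
    "\<And>f g. f \<in> L2 \<Longrightarrow> g \<in> L2 \<Longrightarrow> aeq f g \<Longrightarrow> aeq (T f) (T g)"
    "\<And>f g a b. f \<in> L2 \<Longrightarrow> g \<in> L2 \<Longrightarrow> aeq (T (\<lambda>x. a * f x + b * g x)) (\<lambda>x. a * T f x + b * T g x)"
  using assms by (auto simp: bop_def)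

lemma bop_bounded:
  assumes "bop T"
  obtains C where "0 \<le> C" "\<And>f. f \<in> L2 \<Longrightarrow> norm2 (T f) \<le> C * norm2 f"
proof -
  obtain C where C: "\<And>f. f \<in> L2 \<Longrightarrow> norm2 (T f) \<le> C * norm2 f"
    using assms unfolding bop_def by blast
  have "norm2 (T f) \<le> \<bar>C\<bar> * norm2 f" if "f \<in> L2" for f
    using C[OF that] mult_right_mono[OF abs_ge_self[of C] norm2_nonneg[of f]] by simp
  then show thesis
    using that[of "\<bar>C\<bar>"] by simp
qed

lemma bop_mult_op:
  assumes [measurable]: "h \<in> borel_measurable lborel" and bound: "AE x in lborel. cmod (h x) \<le> B"
  shows "bop (mult_op h)"
  unfolding bop_def
proof (intro conjI ballI allI impI)
  show L: "mult_op h f \<in> L2" if "f \<in> L2" for f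
    unfolding mult_op_def by (rule L2_bounded_mult[OF that assms])
  show "aeq (mult_op h f) (mult_op h g)" if "aeq f g" for f g
    using that unfolding aeq_def by eventually_elim (simp add: mult_op_def)
  show "aeq (mult_op h (\<lambda>x. a * f x + b * g x)) (\<lambda>x. a * mult_op h f x + b * mult_op h g x)"
    for f g a b
    by (simp add: aeq_def mult_op_def algebra_simps)
  have "norm2 (mult_op h f) \<le> \<bar>B\<bar> * norm2 f" if "f \<in> L2" for f
  proof (rule norm2_mono_AE[OF L[OF that] that])
    show "AE x in lborel. cmod (mult_op h f x) \<le> \<bar>B\<bar> * cmod (f x)"
      using bound by eventually_elim (auto simp: mult_op_def norm_mult intro!: mult_right_mono)
  qed simp
  then show "\<exists>C. \<forall>f\<in>L2. norm2 (mult_op h f) \<le> C * norm2 f"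
    by blast
qed

lemma Mop_eq_mult_op: "Mop l = mult_op (\<lambda>x. cis (l * x))"
  by (simp add: Mop_eq_cis mult_op_def fun_eq_iff)

lemma bop_Mop: "bop (Mop l)"
  unfolding Mop_eq_mult_op by (rule bop_mult_op[where B = 1]) auto

lemma bop_Dop: "bop (Dop m)"
  unfolding bop_def
proof (intro conjI ballI allI impI)
  show "aeq (Dop m f) (Dop m g)" if "aeq f g" for f g
    using AE_lborel_translate[of "\<lambda>x. f x = g x" m] that by (simp add: aeq_def Dop_def)
  show "aeq (Dop m (\<lambda>x. a * f x + b * g x)) (\<lambda>x. a * Dop m f x + b * Dop m g x)" for f g a b
    by (simp add: aeq_def Dop_def)
  have "norm2 (Dop m f) = norm2 f" for f
    unfolding norm2_def Dop_def by (subst integral_lborel_translate[of "\<lambda>x. (cmod (f x))\<^sup>2"]) simp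
  then show "\<exists>C. \<forall>f\<in>L2. norm2 (Dop m f) \<le> C * norm2 f"
    by (intro exI[of _ 1]) simp
qed (rule L2_Dop)

lemma bop_add:
  assumes T: "bop T" and S: "bop S"
  shows "bop (\<lambda>f x. T f x + S f x)"
  unfolding bop_def
proof (intro conjI ballI allI impI)
  show "(\<lambda>x. T f x + S f x) \<in> L2" if "f \<in> L2" for f
    by (intro L2_add bopD(1)[OF T] bopD(1)[OF S] that)
  show "aeq (\<lambda>x. T f x + S f x) (\<lambda>x. T g x + S g x)" if "f \<in> L2" "g \<in> L2" "aeq f g" for f g
    using bopD(2)[OF T that] bopD(2)[OF S that] unfolding aeq_def by eventually_elim simp
  show "aeq (\<lambda>x. T (\<lambda>x. a * f x + b * g x) x + S (\<lambda>x. a * f x + b * g x) x)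
      (\<lambda>x. a * (T f x + S f x) + b * (T g x + S g x))" if "f \<in> L2" "g \<in> L2" for f g a b
    using bopD(3)[OF T that, of a b] bopD(3)[OF S that, of a b] unfolding aeq_def
    by eventually_elim (simp add: algebra_simps)
  obtain C where C: "\<And>f. f \<in> L2 \<Longrightarrow> norm2 (T f) \<le> C * norm2 f"
    using bop_bounded[OF T] by blast
  obtain D where D: "\<And>f. f \<in> L2 \<Longrightarrow> norm2 (S f) \<le> D * norm2 f"
    using bop_bounded[OF S] by blast
  have "norm2 (\<lambda>x. T f x + S f x) \<le> (C + D) * norm2 f" if "f \<in> L2" for f
    using norm2_triangle[OF bopD(1)[OF T that] bopD(1)[OF S that]] C[OF that] D[OF that]
    by (simp add: distrib_right)
  then show "\<exists>C. \<forall>f\<in>L2. norm2 (\<lambda>x. T f x + S f x) \<le> C * norm2 f"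
    by blast
qed

lemma bop_comp:
  assumes T: "bop T" and S: "bop S"
  shows "bop (T \<circ> S)"
  unfolding bop_def o_def
proof (intro conjI ballI allI impI)
  show "T (S f) \<in> L2" if "f \<in> L2" for f
    by (intro bopD(1)[OF T] bopD(1)[OF S] that)
  show "aeq (T (S f)) (T (S g))" if "f \<in> L2" "g \<in> L2" "aeq f g" for f g
    by (intro bopD(2)[OF T] bopD(1)[OF S] bopD(2)[OF S] that)
  show "aeq (T (S (\<lambda>x. a * f x + b * g x))) (\<lambda>x. a * T (S f) x + b * T (S g) x)"
    if "f \<in> L2" "g \<in> L2" for f g a b
  proof -
    have "aeq (T (S (\<lambda>x. a * f x + b * g x))) (T (\<lambda>x. a * S f x + b * S g x))"
      by (intro bopD(2)[OF T] bopD(1)[OF S] bopD(3)[OF S] L2_lincomb that)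
    moreover have "aeq (T (\<lambda>x. a * S f x + b * S g x)) (\<lambda>x. a * T (S f) x + b * T (S g) x)"
      by (intro bopD(3)[OF T] bopD(1)[OF S] that)
    ultimately show ?thesis
      unfolding aeq_def by eventually_elim simp
  qed
  obtain C where C: "0 \<le> C" "\<And>f. f \<in> L2 \<Longrightarrow> norm2 (T f) \<le> C * norm2 f"
    using bop_bounded[OF T] by blast
  obtain D where D: "\<And>f. f \<in> L2 \<Longrightarrow> norm2 (S f) \<le> D * norm2 f"
    using bop_bounded[OF S] by blast
  have "norm2 (T (S f)) \<le> (C * D) * norm2 f" if "f \<in> L2" for f
  proof -
    have "norm2 (T (S f)) \<le> C * norm2 (S f)"
      by (intro C(2) bopD(1)[OF S] that)
    also have "\<dots> \<le> C * (D * norm2 f)"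
      by (intro mult_left_mono D C(1) that)
    finally show ?thesis by simp
  qed
  then show "\<exists>C. \<forall>f\<in>L2. norm2 (T (S f)) \<le> C * norm2 f"
    by blast
qed

lemma bop_scale:
  assumes T: "bop T"
  shows "bop (\<lambda>f x. c * T f x)"
  using bop_comp[OF bop_mult_op[of "\<lambda>_. c" "cmod c"] T] by (simp add: mult_op_def o_def)


section \<open>Algebras determined by finite rank functionals\<close>

definition finite_rank_functional :: "(fn \<times> fn) list \<Rightarrow> op \<Rightarrow> complex" where
  "finite_rank_functional vs T = (\<Sum>(f, g)\<leftarrow>vs. inner2 (T f) g)"

definition preannihilator :: "op set \<Rightarrow> (fn \<times> fn) list set" where
  "preannihilator G = {vs. set vs \<subseteq> L2 \<times> L2 \<and> (\<forall>S\<in>G. finite_rank_functional vs S = 0)}"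

text \<open>By the bipolar theorem, the closure of the linear span of \<open>G\<close> in the weak operator topology.\<close>

definition wot_span :: "op set \<Rightarrow> op set" where
  "wot_span G = {T. bop T \<and> (\<forall>vs\<in>preannihilator G. finite_rank_functional vs T = 0)}"

lemma finite_rank_functional_Nil [simp]: "finite_rank_functional [] T = 0"
  by (simp add: finite_rank_functional_def)

lemma finite_rank_functional_Cons [simp]:
  "finite_rank_functional ((f, g) # vs) T = inner2 (T f) g + finite_rank_functional vs T"
  by (simp add: finite_rank_functional_def)

lemma finite_rank_functional_add:
  assumes "bop T" "bop S" "set vs \<subseteq> L2 \<times> L2"
  shows "finite_rank_functional vs (\<lambda>f x. T f x + S f x)
    = finite_rank_functional vs T + finite_rank_functional vs S"
  using assms(3) by (induction vs)
    (auto simp: inner2_add_left bopD(1)[OF assms(1)] bopD(1)[OF assms(2)])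

lemma finite_rank_functional_scale:
  "finite_rank_functional vs (\<lambda>f x. c * T f x) = c * finite_rank_functional vs T"
  by (induction vs) (auto simp: inner2_scale_left distrib_left)

lemma finite_rank_functional_comp_right:
  "finite_rank_functional vs (T \<circ> S) = finite_rank_functional (map (\<lambda>(f, g). (S f, g)) vs) T"
  by (induction vs) auto

definition is_adjoint :: "op \<Rightarrow> op \<Rightarrow> bool" where
  "is_adjoint S S' \<longleftrightarrow> (\<forall>f\<in>L2. \<forall>g\<in>L2. S' g \<in> L2 \<and> inner2 (S f) g = inner2 f (S' g))"

lemma finite_rank_functional_comp_left:
  assumes "is_adjoint S S'" "bop T" "set vs \<subseteq> L2 \<times> L2"
  shows "finite_rank_functional vs (S \<circ> T) = finite_rank_functional (map (\<lambda>(f, g). (f, S' g)) vs) T"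
  using assms(3)
  by (induction vs) (use assms(1) bopD(1)[OF assms(2)] in \<open>auto simp: is_adjoint_def\<close>)

lemma norm_finite_rank_functional_diff_le:
  assumes "\<forall>(f, g)\<in>set vs. cmod (inner2 (S f) g - inner2 (T f) g) \<le> e"
  shows "cmod (finite_rank_functional vs S - finite_rank_functional vs T) \<le> real (length vs) * e"
  using assms
proof (induction vs)
  case (Cons p vs)
  obtain f g where p: "p = (f, g)"
    by force
  have "cmod (finite_rank_functional (p # vs) S - finite_rank_functional (p # vs) T)
      \<le> cmod (inner2 (S f) g - inner2 (T f) g)
        + cmod (finite_rank_functional vs S - finite_rank_functional vs T)"
    unfolding p finite_rank_functional_Cons by (metis add_diff_add norm_triangle_ineq)
  also have "\<dots> \<le> e + real (length vs) * e"
    using Cons p by (intro add_mono) auto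
  finally show ?case
    by (simp add: algebra_simps)
qed simp

lemma preannihilatorD:
  assumes "vs \<in> preannihilator G"
  shows "set vs \<subseteq> L2 \<times> L2" "S \<in> G \<Longrightarrow> finite_rank_functional vs S = 0"
  using assms by (auto simp: preannihilator_def)

lemma wot_spanD:
  assumes "T \<in> wot_span G"
  shows "bop T" "vs \<in> preannihilator G \<Longrightarrow> finite_rank_functional vs T = 0"
  using assms by (auto simp: wot_span_def)

lemma wot_spanI:
  assumes "bop T" "\<And>vs. vs \<in> preannihilator G \<Longrightarrow> finite_rank_functional vs T = 0"
  shows "T \<in> wot_span G"
  using assms by (simp add: wot_span_def)

lemma subset_wot_span: "G \<subseteq> Collect bop \<Longrightarrow> G \<subseteq> wot_span G"
  by (auto simp: wot_span_def preannihilator_def)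

lemma wot_span_add: "T \<in> wot_span G \<Longrightarrow> S \<in> wot_span G \<Longrightarrow> (\<lambda>f x. T f x + S f x) \<in> wot_span G"
  by (simp add: wot_span_def bop_add finite_rank_functional_add preannihilatorD)

lemma wot_span_scale: "T \<in> wot_span G \<Longrightarrow> (\<lambda>f x. c * T f x) \<in> wot_span G"
  by (simp add: wot_span_def bop_scale finite_rank_functional_scale)

lemma wot_span_comp_left:
  assumes S: "bop S" "is_adjoint S S'" and G: "G \<subseteq> Collect bop" "\<And>R. R \<in> G \<Longrightarrow> S \<circ> R \<in> wot_span G"
    and T: "T \<in> wot_span G"
  shows "S \<circ> T \<in> wot_span G"
proof (rule wot_spanI)
  show "bop (S \<circ> T)"
    by (rule bop_comp[OF S(1) wot_spanD(1)[OF T]])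
  fix vs assume vs: "vs \<in> preannihilator G"
  note comp = finite_rank_functional_comp_left[OF S(2) _ preannihilatorD(1)[OF vs]]
  have "finite_rank_functional (map (\<lambda>(f, g). (f, S' g)) vs) R = 0" if "R \<in> G" for R
    using comp[of R] wot_spanD(2)[OF G(2)[OF that] vs] that G(1) by auto
  moreover have "set (map (\<lambda>(f, g). (f, S' g)) vs) \<subseteq> L2 \<times> L2"
    using preannihilatorD(1)[OF vs] S(2) by (auto simp: is_adjoint_def)
  ultimately have "map (\<lambda>(f, g). (f, S' g)) vs \<in> preannihilator G"
    by (simp add: preannihilator_def)
  then show "finite_rank_functional vs (S \<circ> T) = 0"
    unfolding comp[OF wot_spanD(1)[OF T]] by (rule wot_spanD(2)[OF T])
qed

lemma wot_span_comp_right: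
  assumes S: "bop S" and G: "\<And>R. R \<in> G \<Longrightarrow> R \<circ> S \<in> wot_span G" and T: "T \<in> wot_span G"
  shows "T \<circ> S \<in> wot_span G"
proof (rule wot_spanI)
  show "bop (T \<circ> S)"
    by (rule bop_comp[OF wot_spanD(1)[OF T] S])
  fix vs assume vs: "vs \<in> preannihilator G"
  have "finite_rank_functional (map (\<lambda>(f, g). (S f, g)) vs) R = 0" if "R \<in> G" for R
    using wot_spanD(2)[OF G[OF that] vs] by (simp add: finite_rank_functional_comp_right)
  moreover have "set (map (\<lambda>(f, g). (S f, g)) vs) \<subseteq> L2 \<times> L2"
    using preannihilatorD(1)[OF vs] bopD(1)[OF S] by auto
  ultimately have "map (\<lambda>(f, g). (S f, g)) vs \<in> preannihilator G"
    by (simp add: preannihilator_def)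
  then show "finite_rank_functional vs (T \<circ> S) = 0"
    unfolding finite_rank_functional_comp_right by (rule wot_spanD(2)[OF T])
qed

theorem op_algebra_wot_span:
  assumes nonempty: "G \<noteq> {}" and G: "G \<subseteq> Collect bop"
    and adjoint: "\<And>S. S \<in> G \<Longrightarrow> \<exists>S'. is_adjoint S S'"
    and mult: "\<And>R S. R \<in> G \<Longrightarrow> S \<in> G \<Longrightarrow> R \<circ> S \<in> wot_span G"
  shows "op_algebra (wot_span G)"
  unfolding op_algebra_def
proof (intro conjI ballI allI)
  show "wot_span G \<noteq> {}"
    using subset_wot_span[OF G] nonempty by blast
  show "T \<circ> S \<in> wot_span G" if "T \<in> wot_span G" "S \<in> wot_span G" for T S
  proof (rule wot_span_comp_right[OF wot_spanD(1)[OF that(2)] _ that(1)])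
    fix R assume R: "R \<in> G"
    then obtain R' where R': "is_adjoint R R'"
      using adjoint by blast
    show "R \<circ> S \<in> wot_span G"
      by (rule wot_span_comp_left[OF _ R' G mult[OF R] that(2)]) (use R G in auto)
  qed
qed (auto dest: wot_spanD(1) intro: wot_span_add wot_span_scale)

definition rank_one_sequence :: "fn \<Rightarrow> nat \<Rightarrow> fn" where
  "rank_one_sequence f n = (if n = 0 then f else (\<lambda>x. 0))"

lemma ultraweak_data_rank_one_sequence:
  assumes "f \<in> L2" "g \<in> L2"
  shows "ultraweak_data (rank_one_sequence f) (rank_one_sequence g)"
proof -
  have "summable (\<lambda>n. (norm2 (rank_one_sequence f n))\<^sup>2)" for f
    by (rule summable_finite[of "{0}"]) (auto simp: rank_one_sequence_def)
  then show ?thesis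
    using assms by (auto simp: ultraweak_data_def rank_one_sequence_def)
qed

lemma ultraweak_fun_rank_one_sequence:
  "ultraweak_fun (rank_one_sequence f) (rank_one_sequence g) T = inner2 (T f) g"
proof -
  have "(\<Sum>n. inner2 (T (rank_one_sequence f n)) (rank_one_sequence g n))
      = (\<Sum>n\<in>{0}. inner2 (T (rank_one_sequence f n)) (rank_one_sequence g n))"
    by (rule suminf_finite) (auto simp: rank_one_sequence_def)
  then show ?thesis
    by (simp add: ultraweak_fun_def rank_one_sequence_def)
qed

theorem weak_star_closed_wot_span: "weak_star_closed (wot_span G)"
  unfolding weak_star_closed_def
proof (intro conjI allI impI)
  show "wot_span G \<subseteq> Collect bop"
    by (auto dest: wot_spanD(1))
  fix T assume "bop T" and approx: "\<forall>ps. \<forall>e>0. (\<forall>(x, y)\<in>set ps. ultraweak_data x y) \<longrightarrow>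
      (\<exists>S\<in>wot_span G. \<forall>(x, y)\<in>set ps. cmod (ultraweak_fun x y S - ultraweak_fun x y T) < e)"
  then show "T \<in> wot_span G"
  proof (intro wot_spanI)
    fix vs assume vs: "vs \<in> preannihilator G"
    have "cmod (finite_rank_functional vs T) \<le> 0 + e" if e: "0 < e" for e
    proof -
      define d where "d = e / (real (length vs) + 1)"
      have d: "0 < d" "real (length vs) * d \<le> e"
        using e by (auto simp: d_def field_simps add_nonneg_pos)
      have "\<forall>(x, y)\<in>set (map (\<lambda>(f, g). (rank_one_sequence f, rank_one_sequence g)) vs).
        ultraweak_data x y"
        using preannihilatorD(1)[OF vs] by (auto intro: ultraweak_data_rank_one_sequence)
      with approx d(1) obtain S where S: "S \<in> wot_span G"
          "\<forall>(x, y)\<in>set (map (\<lambda>(f, g). (rank_one_sequence f, rank_one_sequence g)) vs).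
            cmod (ultraweak_fun x y S - ultraweak_fun x y T) < d"
        by blast
      then have "cmod (finite_rank_functional vs S - finite_rank_functional vs T)
        \<le> real (length vs) * d"
        by (intro norm_finite_rank_functional_diff_le) (auto simp: ultraweak_fun_rank_one_sequence)
      then show ?thesis
        using d(2) wot_spanD(2)[OF S(1) vs] by simp
    qed
    then have "cmod (finite_rank_functional vs T) \<le> 0"
      by (rule field_le_epsilon)
    then show "finite_rank_functional vs T = 0"
      by simp
  qed
qed

lemma Lat_antimono: "A \<subseteq> B \<Longrightarrow> Lat B \<subseteq> Lat A"
  by (auto simp: Lat_def)

theorem Lat_wot_span:
  assumes G: "G \<subseteq> Collect bop"
  shows "Lat (wot_span G) = Lat G"
proof
  show "Lat (wot_span G) \<subseteq> Lat G"
    by (rule Lat_antimono[OF subset_wot_span[OF G]])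
  show "Lat G \<subseteq> Lat (wot_span G)"
  proof
    fix K assume "K \<in> Lat G"
    then have K: "closed_subspace K" and inv: "\<And>S f. S \<in> G \<Longrightarrow> f \<in> K \<Longrightarrow> S f \<in> K"
      by (auto simp: Lat_def)
    have "T f \<in> K" if T: "T \<in> wot_span G" and f: "f \<in> K" for T f
    proof -
      have fL: "f \<in> L2"
        by (rule closed_subspaceD(1)[OF K f])
      have "[(f, g)] \<in> preannihilator G" if "g \<in> orthogonal_complement K" for g
        using that fL inv f by (auto simp: preannihilator_def dest: orthogonal_complementD)
      then have "inner2 (T f) g = 0" if "g \<in> orthogonal_complement K" for g
        using wot_spanD(2)[OF T, of "[(f, g)]"] that by simp
      then show ?thesis
        using closed_subspace_mem_iff[OF K bopD(1)[OF wot_spanD(1)[OF T] fL]] by blast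
    qed
    then show "K \<in> Lat (wot_span G)"
      using K by (simp add: Lat_def)
  qed
qed


section \<open>The parabolic algebra and its invariant subspaces\<close>

definition leaving_invariant :: "fn set \<Rightarrow> op set" where
  "leaving_invariant K = {T. bop T \<and> (\<forall>f\<in>K. T f \<in> K)}"

lemma op_algebra_leaving_invariant:
  assumes K: "closed_subspace K"
  shows "op_algebra (leaving_invariant K)"
  unfolding op_algebra_def
proof (intro conjI ballI allI)
  have "Mop 0 \<in> leaving_invariant K"
    by (simp add: leaving_invariant_def bop_Mop)
  then show "leaving_invariant K \<noteq> {}"
    by blast
  fix T assume T: "T \<in> leaving_invariant K"
  then show "bop T"
    by (simp add: leaving_invariant_def)
  show "(\<lambda>f x. a * T f x) \<in> leaving_invariant K" for a
    using T closed_subspaceD(3)[OF K, of _ _ a 0]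
    by (auto simp: leaving_invariant_def intro: bop_scale)
  fix S assume S: "S \<in> leaving_invariant K"
  show "(\<lambda>f x. T f x + S f x) \<in> leaving_invariant K"
    using T S closed_subspaceD(3)[OF K, of _ _ 1 1]
    by (auto simp: leaving_invariant_def intro: bop_add)
  show "T \<circ> S \<in> leaving_invariant K"
    using T S by (auto simp: leaving_invariant_def intro: bop_comp)
qed

lemma wot_closed_leaving_invariant:
  assumes K: "closed_subspace K"
  shows "wot_closed (leaving_invariant K)"
  unfolding wot_closed_def
proof (intro conjI allI impI)
  fix T assume T: "bop T" and approx: "\<forall>vs :: (fn \<times> fn) list. \<forall>e>0. set vs \<subseteq> L2 \<times> L2 \<longrightarrow>
      (\<exists>S\<in>leaving_invariant K. \<forall>(f, g)\<in>set vs. cmod (inner2 (S f) g - inner2 (T f) g) < e)"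
  have "T f \<in> K" if f: "f \<in> K" for f
  proof -
    have fL: "f \<in> L2"
      by (rule closed_subspaceD(1)[OF K f])
    have "inner2 (T f) g = 0" if g: "g \<in> orthogonal_complement K" for g
    proof -
      have "cmod (inner2 (T f) g) \<le> 0 + e" if e: "0 < e" for e
      proof -
        have "set [(f, g)] \<subseteq> L2 \<times> L2"
          using fL orthogonal_complementD(1)[OF g] by simp
        then obtain S where "\<forall>f\<in>K. S f \<in> K" "cmod (inner2 (S f) g - inner2 (T f) g) < e"
          using approx[rule_format, OF e, of "[(f, g)]"] by (auto simp: leaving_invariant_def)
        then show ?thesis
          using orthogonal_complementD(2)[OF g] f by simp
      qed
      then have "cmod (inner2 (T f) g) \<le> 0"
        by (rule field_le_epsilon)
      then show ?thesis by simp
    qed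
    then show ?thesis
      using closed_subspace_mem_iff[OF K bopD(1)[OF T fL]] by blast
  qed
  then show "T \<in> leaving_invariant K"
    using T by (simp add: leaving_invariant_def)
qed (auto simp: leaving_invariant_def)

definition parabolic_generators :: "op set" where
  "parabolic_generators = Mop ` {0..} \<union> Dop ` {0..}"

lemma parabolic_generators_subset: "parabolic_generators \<subseteq> parabolic_algebra"
  by (auto simp: parabolic_generators_def parabolic_algebra_def)

theorem Lat_parabolic_algebra: "Lat parabolic_algebra = Lat parabolic_generators"
proof
  show "Lat parabolic_algebra \<subseteq> Lat parabolic_generators"
    by (rule Lat_antimono[OF parabolic_generators_subset])
  show "Lat parabolic_generators \<subseteq> Lat parabolic_algebra"
  proof
    fix K assume K: "K \<in> Lat parabolic_generators"
    then have closed: "closed_subspace K"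
      by (simp add: Lat_def)
    have "parabolic_algebra \<subseteq> leaving_invariant K"
      unfolding parabolic_algebra_def
      using K op_algebra_leaving_invariant[OF closed] wot_closed_leaving_invariant[OF closed]
      by (intro Inter_lower) (auto simp: leaving_invariant_def bop_Mop bop_Dop Lat_def
        parabolic_generators_def)
    then show "K \<in> Lat parabolic_algebra"
      using closed by (auto simp: Lat_def leaving_invariant_def)
  qed
qed


section \<open>A smaller algebra with the same invariant subspaces\<close>

definition weyl_op :: "real \<Rightarrow> real \<Rightarrow> op" where
  "weyl_op l m = Mop l \<circ> Dop m"

lemma bop_weyl_op: "bop (weyl_op l m)"
  unfolding weyl_op_def by (intro bop_comp bop_Mop bop_Dop)

lemma weyl_op_0_right: "weyl_op l 0 = Mop l"
  by (simp add: weyl_op_def Dop_def fun_eq_iff)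

lemma weyl_op_0_left: "weyl_op 0 m = Dop m"
  by (simp add: weyl_op_def fun_eq_iff)

lemma Dop_Mop: "Dop m (Mop l f) = (\<lambda>x. cis (- (l * m)) * Mop l (Dop m f) x)"
  by (simp add: Dop_def Mop_eq_cis cis_mult right_diff_distrib add.commute flip: mult.assoc)

lemma weyl_op_comp: "weyl_op l m \<circ> weyl_op l' m'
  = (\<lambda>f x. cis (- (l' * m)) * weyl_op (l + l') (m + m') f x)"
proof (intro ext)
  fix f x
  have "(weyl_op l m \<circ> weyl_op l' m') f x = cis (- (l' * m)) * Mop l (Mop l' (Dop m (Dop m' f))) x"
    unfolding weyl_op_def o_def Dop_Mop by (simp add: Mop_def)
  then show "(weyl_op l m \<circ> weyl_op l' m') f x = cis (- (l' * m)) * weyl_op (l + l') (m + m') f x"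
    by (simp add: Mop_Mop weyl_op_def Dop_def diff_diff_eq)
qed

lemma is_adjoint_weyl_op: "is_adjoint (weyl_op l m) (Dop (- m) \<circ> Mop (- l))"
proof -
  have "inner2 (Dop m f) h = inner2 f (Dop (- m) h)" for f h
    using integral_lborel_translate[of "\<lambda>x. f x * cnj (h (x + m))" m]
    by (simp add: inner2_def Dop_def)
  then show ?thesis
    by (simp add: is_adjoint_def weyl_op_def inner2_Mop_adjoint L2_Mop L2_Dop)
qed

definition weyl_semigroup :: "real \<Rightarrow> op set" where
  "weyl_semigroup c = {weyl_op l m | l m. 0 \<le> l \<and> 0 \<le> m \<and> (m = 0 \<or> c \<le> l)}"

lemma weyl_op_in_weyl_semigroup: "0 \<le> l \<Longrightarrow> 0 \<le> m \<Longrightarrow> m = 0 \<or> c \<le> l \<Longrightarrow> weyl_op l m \<in> weyl_semigroup c"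
  by (auto simp: weyl_semigroup_def)

lemma weyl_semigroup_bop: "weyl_semigroup c \<subseteq> Collect bop"
  by (auto simp: weyl_semigroup_def bop_weyl_op)

definition reduced_parabolic_algebra :: "real \<Rightarrow> op set" where
  "reduced_parabolic_algebra c = wot_span (weyl_semigroup c)"

lemma op_algebra_reduced_parabolic_algebra: "op_algebra (reduced_parabolic_algebra c)"
  unfolding reduced_parabolic_algebra_def
proof (rule op_algebra_wot_span[OF _ weyl_semigroup_bop])
  show "weyl_semigroup c \<noteq> {}"
    by (force simp: weyl_semigroup_def)
  show "\<exists>S'. is_adjoint S S'" if "S \<in> weyl_semigroup c" for S
    using that is_adjoint_weyl_op by (auto simp: weyl_semigroup_def)
  fix R S assume "R \<in> weyl_semigroup c" "S \<in> weyl_semigroup c"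
  then obtain l m l' m' where eq: "R = weyl_op l m" "S = weyl_op l' m'"
    and "0 \<le> l" "0 \<le> m" "m = 0 \<or> c \<le> l" "0 \<le> l'" "0 \<le> m'" "m' = 0 \<or> c \<le> l'"
    unfolding weyl_semigroup_def by blast
  then have "weyl_op (l + l') (m + m') \<in> weyl_semigroup c"
    by (intro weyl_op_in_weyl_semigroup) auto
  then show "R \<circ> S \<in> wot_span (weyl_semigroup c)"
    unfolding eq weyl_op_comp using subset_wot_span[OF weyl_semigroup_bop]
    by (blast intro: wot_span_scale)
qed

lemma Dop_invariant_of_weyl_invariant:
  assumes K: "K \<in> Lat (weyl_semigroup c)" and c: "0 < c" and m: "0 \<le> m" and f: "f \<in> K"
  shows "Dop m f \<in> K"
proof -
  have closed: "closed_subspace K"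
    using K by (simp add: Lat_def)
  have inv: "Mop l (Dop m f) \<in> K" if "0 \<le> l" "0 \<le> m" "m = 0 \<or> c \<le> l" for l m
    using K weyl_op_in_weyl_semigroup[OF that] f by (auto simp: Lat_def weyl_op_def)
  have fL: "f \<in> L2"
    by (rule closed_subspaceD(1)[OF closed f])
  have "inner2 (Dop m f) \<psi> = 0" if \<psi>: "\<psi> \<in> orthogonal_complement K" for \<psi>
  proof -
    have \<psi>L: "\<psi> \<in> L2"
      by (rule orthogonal_complementD(1)[OF \<psi>])
    have fourier_0: "fourier (translate_product f \<psi> k) l = 0"
      if "0 \<le> l" "0 \<le> k" "k = 0 \<or> c \<le> l" for k l
      using orthogonal_complementD(2)[OF \<psi> inv[OF that]] by (simp add: inner2_Mop_Dop)
    have "translate_product f \<psi> m \<in> hardy_space"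
    proof (rule translate_product_in_hardy_space[OF fL \<psi>L c _ _ m])
      show "translate_product f \<psi> 0 \<in> hardy_space"
        using fourier_0 translate_product_integrable[OF fL \<psi>L] by (simp add: hardy_space_def)
      show "Mop c (translate_product f \<psi> k) \<in> hardy_space" if "0 \<le> k" for k
        using fourier_0 that c
        by (simp add: Mop_in_hardy_space_iff translate_product_integrable fL \<psi>L)
    qed
    then show ?thesis
      using inner2_Mop_Dop[of 0 m f \<psi>] by (simp add: hardy_spaceD(2))
  qed
  then show ?thesis
    using closed_subspace_mem_iff[OF closed L2_Dop[OF fL]] by blast
qed

theorem Lat_reduced_parabolic_algebra:
  assumes c: "0 < c"
  shows "Lat (reduced_parabolic_algebra c) = Lat parabolic_algebra"
proof -
  have "Lat (weyl_semigroup c) = Lat parabolic_generators"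
  proof (intro equalityI subsetI)
    fix K assume K: "K \<in> Lat (weyl_semigroup c)"
    have "Mop l f \<in> K" if "0 \<le> l" "f \<in> K" for l f
      using K weyl_op_in_weyl_semigroup[of l 0 c] that by (auto simp: Lat_def weyl_op_0_right)
    then show "K \<in> Lat parabolic_generators"
      using K Dop_invariant_of_weyl_invariant[OF K c]
      by (auto simp: Lat_def parabolic_generators_def)
  next
    fix K assume "K \<in> Lat parabolic_generators"
    then show "K \<in> Lat (weyl_semigroup c)"
      by (auto simp: Lat_def parabolic_generators_def weyl_semigroup_def weyl_op_def)
  qed
  then show ?thesis
    by (simp add: reduced_parabolic_algebra_def Lat_wot_span weyl_semigroup_bop
      Lat_parabolic_algebra)
qed

definition finite_rank_symbol :: "(fn \<times> fn) list \<Rightarrow> fn" where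
  "finite_rank_symbol vs x = (\<Sum>(f, g)\<leftarrow>vs. f x * cnj (g x))"

lemma finite_rank_symbol_integrable:
  "set vs \<subseteq> L2 \<times> L2 \<Longrightarrow> integrable lborel (finite_rank_symbol vs)"
  unfolding finite_rank_symbol_def[abs_def] by (induction vs) (auto intro: L2_integrable_inner)

lemma finite_rank_functional_mult_op:
  assumes h: "h \<in> borel_measurable lborel" "AE x in lborel. cmod (h x) \<le> B" and "set vs \<subseteq> L2 \<times> L2"
  shows "finite_rank_functional vs (mult_op h) = (LINT x|lborel. h x * finite_rank_symbol vs x)"
  using assms(3)
proof (induction vs)
  case Nil
  show ?case
    by (simp add: finite_rank_symbol_def)
next
  case (Cons p vs)
  obtain f g where p: "p = (f, g)" and fg: "f \<in> L2" "g \<in> L2"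
    using Cons.prems by (cases p) auto
  have "inner2 (mult_op h f) g = (LINT x|lborel. h x * (f x * cnj (g x)))"
    by (simp add: inner2_def mult_op_def mult.assoc)
  moreover have "finite_rank_symbol (p # vs) x = f x * cnj (g x) + finite_rank_symbol vs x" for x
    by (simp add: finite_rank_symbol_def p)
  moreover have "integrable lborel (\<lambda>x. h x * (f x * cnj (g x)))"
    "integrable lborel (\<lambda>x. h x * finite_rank_symbol vs x)"
    using Cons.prems
    by (auto intro!: bounded_mult_integral(1)[OF _ h]
      L2_integrable_inner[OF fg] finite_rank_symbol_integrable)
  ultimately show ?case
    using Cons by (simp add: p distrib_left)
qed

theorem mult_op_Hinf_in_reduced_parabolic_algebra:
  assumes h: "h \<in> Hinf"
  shows "mult_op h \<in> reduced_parabolic_algebra c"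
  unfolding reduced_parabolic_algebra_def
proof (rule wot_spanI)
  obtain B where B: "AE x in lborel. cmod (h x) \<le> B"
    using Hinf_AE_bounded[OF h] .
  show "bop (mult_op h)"
    by (rule bop_mult_op[OF Hinf_measurable[OF h] B])
  fix vs assume vs: "vs \<in> preannihilator (weyl_semigroup c)"
  note functional = finite_rank_functional_mult_op[OF _ _ preannihilatorD(1)[OF vs]]
  have "fourier (finite_rank_symbol vs) l = 0" if "0 \<le> l" for l
  proof -
    have "finite_rank_functional vs (mult_op (\<lambda>x. cis (l * x))) = 0"
      using preannihilatorD(2)[OF vs weyl_op_in_weyl_semigroup[of l 0]] that
      by (simp add: weyl_op_0_right Mop_eq_mult_op)
    then show ?thesis
      using functional[of "\<lambda>x. cis (l * x)" 1] by (simp add: fourier_def)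
  qed
  then have "finite_rank_symbol vs \<in> hardy_space"
    using finite_rank_symbol_integrable[OF preannihilatorD(1)[OF vs]] by (simp add: hardy_space_def)
  then show "finite_rank_functional vs (mult_op h) = 0"
    using functional[OF Hinf_measurable[OF h] B] integral_Hinf_mult_hardy_space_eq_0[OF _ h] by simp
qed


section \<open>Separation from the parabolic algebra\<close>

definition resolvent :: fn where
  "resolvent x = inverse (of_real x + \<i>)"

lemma resolvent_L2: "resolvent \<in> L2"
proof -
  have "(cmod (of_real x + \<i>))\<^sup>2 = x\<^sup>2 + 1" for x
    unfolding cmod_power2 by simp
  then have "(cmod (resolvent x))\<^sup>2 = poisson_kernel 1 (x - 0)" for x
    by (simp add: resolvent_def poisson_kernel_def norm_inverse power_inverse divide_inverse)
  moreover have "resolvent \<in> borel_measurable borel"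
    unfolding resolvent_def by measurable
  ultimately show ?thesis
    using integral_poisson_kernel(1)[of 1 0] by (simp add: L2_def)
qed

lemma resolvent_neq_0: "resolvent x \<noteq> 0"
  using of_real_minus_nonreal_neq_0[of "- \<i>" x] by (simp add: resolvent_def)

lemma resolvent_product_in_hardy_space: "(\<lambda>x. resolvent (x - m) * resolvent x) \<in> hardy_space"
proof -
  define G where "G = (\<lambda>z. inverse (z - of_real m + \<i>) * inverse (z + \<i>))"
  have "(\<lambda>s. G (of_real s)) \<in> hardy_space"
  proof (rule hardy_space_of_analytic_decay[of 1])
    have "z - of_real m + \<i> \<noteq> 0" "z + \<i> \<noteq> 0" if "- 1 < Im z" for z
      using that by (auto simp: complex_eq_iff)
    then show "G holomorphic_on {z. - 1 < Im z}"
      unfolding G_def by (intro holomorphic_intros) auto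
    fix z assume z: "0 \<le> Im z"
    define u where "u = z - of_real m + \<i>"
    define v where "v = z + \<i>"
    have "1 \<le> cmod u"
      using z abs_Im_le_cmod[of u] by (simp add: u_def)
    moreover have "cmod v \<le> cmod u + \<bar>m\<bar>"
      using norm_triangle_ineq[of u "of_real m"] by (simp add: u_def v_def)
    moreover have "\<bar>m\<bar> * 1 \<le> \<bar>m\<bar> * cmod u"
      using \<open>1 \<le> cmod u\<close> by (intro mult_left_mono) auto
    ultimately have "cmod v * cmod v \<le> (1 + \<bar>m\<bar>) * cmod u * cmod v"
      by (intro mult_right_mono) (auto simp: distrib_right)
    moreover have "1 + (cmod z)\<^sup>2 \<le> cmod v * cmod v"
      using z unfolding power2_eq_square[symmetric] v_def cmod_power2
      by (simp add: power2_eq_square algebra_simps)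
    ultimately have le: "1 + (cmod z)\<^sup>2 \<le> (1 + \<bar>m\<bar>) * (cmod u * cmod v)"
      by (simp add: mult.assoc)
    have pos: "0 < 1 + (cmod z)\<^sup>2"
      by (simp add: add_pos_nonneg)
    then have "0 < cmod u * cmod v"
      using le by (smt (verit) abs_ge_zero zero_less_mult_pos)
    then have "1 / (cmod u * cmod v) \<le> (1 + \<bar>m\<bar>) / (1 + (cmod z)\<^sup>2)"
      using le pos by (simp add: divide_le_eq le_divide_eq mult.commute)
    then show "cmod (G z) \<le> (1 + \<bar>m\<bar>) / (1 + (cmod z)\<^sup>2)"
      by (simp add: G_def norm_mult norm_inverse divide_inverse flip: u_def v_def)
  qed simp
  then show ?thesis
    by (simp add: G_def resolvent_def)
qed

lemma hardy_space_fourier_neq_0: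
  assumes \<phi>: "\<phi> \<in> hardy_space" and nonzero: "\<And>x. \<phi> x \<noteq> 0"
  obtains c where "0 < c" "fourier \<phi> (- c) \<noteq> 0"
proof (rule ccontr)
  assume "\<not> thesis"
  then have "fourier \<phi> l = 0" for l
    using that[of "- l"] hardy_spaceD(2)[OF \<phi>, of l] by (cases "0 \<le> l") auto
  then have "AE x in (lborel :: real measure). False"
    using AE_eq_0_of_fourier_eq_0[OF hardy_spaceD(1)[OF \<phi>]] nonzero by simp
  then show False
    by (simp add: eventually_False ae_filter_eq_bot_iff)
qed

text \<open>The separating functional is \<open>T \<mapsto> \<langle>T q, g\<rangle> - \<langle>T (M\<^bsub>-\<pi>\<^esub> q), M\<^bsub>-\<pi>\<^esub> g\<rangle>\<close> with \<open>q\<close> the resolvent function and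
  \<open>g\<^sup>* = M\<^bsub>-c\<^esub> q\<close>.\<close>

definition separating_functional :: "real \<Rightarrow> (fn \<times> fn) list" where
  "separating_functional c = (let g = (\<lambda>x. cnj (Mop (- c) resolvent x)) in
    [(resolvent, g), (Mop (- pi) resolvent, \<lambda>x. - Mop (- pi) g x)])"

lemma set_separating_functional: "set (separating_functional c) \<subseteq> L2 \<times> L2"
  by (auto simp only: separating_functional_def Let_def list.set
    intro!: L2_cnj L2_minus L2_Mop resolvent_L2)

lemma separating_functional_weyl_op:
  "finite_rank_functional (separating_functional c) (weyl_op l m)
    = (1 - cis (pi * m)) * fourier (\<lambda>x. resolvent (x - m) * resolvent x) (l - c)"
proof -
  define g where "g = (\<lambda>x. cnj (Mop (- c) resolvent x))"
  have "(\<lambda>x. Dop m resolvent x * cnj (g x)) = Mop (- c) (\<lambda>x. resolvent (x - m) * resolvent x)"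
    by (simp add: g_def Mop_def Dop_def mult.left_commute)
  then have first: "inner2 (weyl_op l m resolvent) g
    = fourier (\<lambda>x. resolvent (x - m) * resolvent x) (l - c)"
    by (simp add: weyl_op_def inner2_Mop fourier_Mop)
  have "Mop pi (weyl_op l m (Mop (- pi) resolvent)) = (\<lambda>x. cis (pi * m) * weyl_op l m resolvent x)"
    unfolding weyl_op_def o_def Dop_Mop
    by (simp add: Mop_eq_cis cis_mult add.commute flip: mult.assoc)
  then have "inner2 (weyl_op l m (Mop (- pi) resolvent)) (Mop (- pi) g)
      = cis (pi * m) * inner2 (weyl_op l m resolvent) g"
    by (simp add: inner2_scale_left flip: inner2_Mop_adjoint)
  then show ?thesis
    by (simp add: separating_functional_def Let_def inner2_minus_right first left_diff_distrib
      flip: g_def)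
qed

theorem reduced_parabolic_algebra_neq:
  obtains c where "0 < c" "reduced_parabolic_algebra c \<noteq> parabolic_algebra"
proof -
  obtain c where c: "0 < c" "fourier (\<lambda>x. resolvent (x - 1) * resolvent x) (- c) \<noteq> 0"
    using hardy_space_fourier_neq_0[OF resolvent_product_in_hardy_space[of 1]] resolvent_neq_0
    by auto
  have "separating_functional c \<in> preannihilator (weyl_semigroup c)"
    using set_separating_functional hardy_spaceD(2)[OF resolvent_product_in_hardy_space]
    by (auto simp: preannihilator_def weyl_semigroup_def separating_functional_weyl_op)
  moreover have "finite_rank_functional (separating_functional c) (Dop 1) \<noteq> 0"
    using c(2) separating_functional_weyl_op[of c 0 1] by (simp add: weyl_op_0_left)
  ultimately have "Dop 1 \<notin> reduced_parabolic_algebra c"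
    using wot_spanD(2) by (auto simp: reduced_parabolic_algebra_def)
  moreover have "Dop 1 \<in> parabolic_algebra"
    using parabolic_generators_subset by (auto simp: parabolic_generators_def)
  ultimately show thesis
    using that[OF c(1)] by blast
qed

theorem theorem3p1:
  shows "\<exists>A. op_algebra A \<and> weak_star_closed A \<and>
           (\<forall>h\<in>Hinf. mult_op h \<in> A) \<and>
           Lat A = Lat parabolic_algebra \<and> A \<noteq> parabolic_algebra"
proof -
  obtain c where c: "0 < c" "reduced_parabolic_algebra c \<noteq> parabolic_algebra"
    using reduced_parabolic_algebra_neq .
  have "weak_star_closed (reduced_parabolic_algebra c)"
    unfolding reduced_parabolic_algebra_def by (rule weak_star_closed_wot_span)
  then show ?thesis
    using op_algebra_reduced_parabolic_algebra mult_op_Hinf_in_reduced_parabolic_algebra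
      Lat_reduced_parabolic_algebra[OF c(1)] c(2) by blast
qed

end
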